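(* Let $\mathcal N$, $\mathcal T$, $G$, $\mathcal B$, $f$, $\boldsymbol f$, $\iota_f$, $\iota_\Delta$ be as in the context. The condition that $N^*(\iota_f)\cap N^*(\iota_\Delta)$ contain no nonzero covectors holds if and only if, for every $\mathcal Y\in\mathrm{Fix}(\boldsymbol f)$ and every $g_0\in G$ such that $\mathfrak a_{g_0}\circ f$ is the identity on $\mathcal Y$, the map $$(\mathfrak a_{g_0}\circ f)^*\big|_{N^*_p\mathcal Y}-I:N^*_p\mathcal Y\to N^*_p\mathcal Y$$ has trivial kernel for $p\in\mathcal Y$.
   Context: $\mathcal N$ is a closed (compact, without boundary) smooth $n$-manifold, $\mathcal T$ is a nowhere vanishing smooth real vector field on $\mathcal N$ that preserves some Riemannian metric $\mathrm g$, with flow $\mathfrak a_t$. $G$ is the closure of $\{\mathfrak a_t:t\in\mathbb R\}$ in the (compact) group of isometries of $\mathrm g$; it is a compact connected abelian Lie group, and $\mathfrak a_g$ denotes the isometry defined by $g\in G$, with $\mathfrak a_{g_1}\circ\mathfrak a_{g_2}=\mathfrak a_{g_1g_2}$. $\mathcal B$ is the space of orbits of $G$ in $\mathcal N$ with the quotient topology. $f:\mathcal N\to\mathcal N$ is a smooth map with $f_*\mathcal T=\mathcal T$ (i.e. $df(\mathcal T(p))=\mathcal T(f(p))$ for all $p$). Then $f$ commutes with every $\mathfrak a_g$, maps $G$-orbits onto $G$-orbits, and induces a continuous map $\boldsymbol f:\mathcal B\to\mathcal B$; $\mathrm{Fix}(\boldsymbol f)=\{\mathcal Y\in\mathcal B:f(\mathcal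 Y)=\mathcal Y\}$. For $\mathcal Y\in\mathrm{Fix}(\boldsymbol f)$ there is $g_0\in G$ such that $\mathfrak a_{g_0}\circ f$ is the identity on $\mathcal Y$. $N^*_p\mathcal Y\subset T^*_p\mathcal N$ is the fiber at $p$ of the conormal bundle of $\mathcal Y$. The maps $\iota_f:\mathcal N\times G\to\mathcal N\times\mathcal N$ and $\iota_\Delta:\mathcal N\to\mathcal N\times\mathcal N$ are $\iota_f(p,g)=(\mathfrak a_g(p),f(p))$ and $\iota_\Delta(p)=(p,p)$. For a smooth map $\iota:X\to Y$ between manifolds, $$N^*(\iota)=\{\eta\in T^*Y:\ \exists x\in X\text{ such that }\eta\in T^*_{\iota(x)}Y\text{ and }\iota^*\eta=0\in T^*_xX\}.$$ *)

theory Defs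
  imports "HOL-Analysis.Analysis"
begin

section \<open>Smooth maps between open subsets of Euclidean spaces\<close>

primrec Ck_on :: "nat \<Rightarrow> 'a::euclidean_space set \<Rightarrow> ('a \<Rightarrow> 'b::real_normed_vector) \<Rightarrow> bool" where
  "Ck_on 0 S h \<longleftrightarrow> continuous_on S h"
| "Ck_on (Suc k) S h \<longleftrightarrow>
     (\<forall>x\<in>S. h differentiable (at x)) \<and> (\<forall>v. Ck_on k S (\<lambda>x. frechet_derivative h (at x) v))"

definition smooth_on :: "'a::euclidean_space set \<Rightarrow> ('a \<Rightarrow> 'b::real_normed_vector) \<Rightarrow> bool" where
  "smooth_on S h \<longleftrightarrow> open S \<and> (\<forall>k. Ck_on k S h)"


section \<open>Smooth manifolds\<close>

text \<open>A chart is a domain together with a total function that is meaningful on the domain only.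
  The dimension of a manifold is the dimension of the model space \<open>'e\<close>.  Atlases need not be
  maximal.\<close>

type_synonym ('a, 'e) chart = "'a set \<times> ('a \<Rightarrow> 'e)"

definition chart_inv :: "('a, 'e) chart \<Rightarrow> 'e \<Rightarrow> 'a" where
  "chart_inv c = inv_into (fst c) (snd c)"

definition is_chart :: "'a topology \<Rightarrow> ('a, 'e::euclidean_space) chart \<Rightarrow> bool" where
  "is_chart X c \<longleftrightarrow> openin X (fst c) \<and> open (snd c ` fst c) \<and>
     homeomorphic_map (subtopology X (fst c)) (top_of_set (snd c ` fst c)) (snd c)"

definition smooth_manifold :: "'a topology \<Rightarrow> ('a, 'e::euclidean_space) chart set \<Rightarrow> bool" where
  "smooth_manifold X A \<longleftrightarrow>
     Hausdorff_space X \<and> second_countable X \<and>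
     (\<forall>c\<in>A. is_chart X c) \<and> (\<Union>c\<in>A. fst c) = topspace X \<and>
     (\<forall>c\<in>A. \<forall>d\<in>A. smooth_on (snd c ` (fst c \<inter> fst d)) (snd d \<circ> chart_inv c))"

definition smooth_map ::
  "'a topology \<Rightarrow> ('a, 'e::euclidean_space) chart set \<Rightarrow>
   'b topology \<Rightarrow> ('b, 'f::euclidean_space) chart set \<Rightarrow> ('a \<Rightarrow> 'b) \<Rightarrow> bool" where
  "smooth_map X A Y B h \<longleftrightarrow> continuous_map X Y h \<and>
     (\<forall>c\<in>A. \<forall>d\<in>B. smooth_on (snd c ` {x \<in> fst c. h x \<in> fst d}) (snd d \<circ> h \<circ> chart_inv c))"

definition euclidean_atlas :: "('e::euclidean_space, 'e) chart set" where
  "euclidean_atlas = {(UNIV, id)}"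

definition prod_atlas ::
  "('a, 'e::euclidean_space) chart set \<Rightarrow> ('b, 'f::euclidean_space) chart set \<Rightarrow>
   ('a \<times> 'b, 'e \<times> 'f) chart set" where
  "prod_atlas A B = (\<lambda>(c, d). (fst c \<times> fst d, map_prod (snd c) (snd d))) ` (A \<times> B)"


section \<open>Tangent and cotangent vectors\<close>

text \<open>For every point one chart around it is selected, and the tangent space at \<open>p\<close> is identified
  with the model space \<open>'e\<close> through the selected chart at \<open>p\<close>.  Accordingly a tangent vector at \<open>p\<close>
  is an element of \<open>'e\<close>, a cotangent vector at \<open>p\<close> is an element of the dual \<open>'e \<Rightarrow>\<^sub>L real\<close>,
  and an element of the cotangent bundle is a pair of a point and a cotangent vector.\<close>

definition chart_at :: "('a, 'e) chart set \<Rightarrow> 'a \<Rightarrow> ('a, 'e) chart" where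
  "chart_at A p = (SOME c. c \<in> A \<and> p \<in> fst c)"

definition tangent_map ::
  "('a, 'e::euclidean_space) chart set \<Rightarrow> ('b, 'f::euclidean_space) chart set \<Rightarrow>
   ('a \<Rightarrow> 'b) \<Rightarrow> 'a \<Rightarrow> ('e \<Rightarrow>\<^sub>L 'f)" where
  "tangent_map A B h p =
     Blinfun (frechet_derivative (snd (chart_at B (h p)) \<circ> h \<circ> chart_inv (chart_at A p))
                (at (snd (chart_at A p) p)))"

definition pullback ::
  "('a, 'e::euclidean_space) chart set \<Rightarrow> ('b, 'f::euclidean_space) chart set \<Rightarrow>
   ('a \<Rightarrow> 'b) \<Rightarrow> 'a \<Rightarrow> ('f \<Rightarrow>\<^sub>L real) \<Rightarrow> ('e \<Rightarrow>\<^sub>L real)" where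
  "pullback A B h p \<eta> = \<eta> o\<^sub>L tangent_map A B h p"

text \<open>\<open>velocity A \<gamma> t\<close> is the velocity at time \<open>t\<close> of the curve \<open>\<gamma>\<close>, a tangent vector at \<open>\<gamma> t\<close>.\<close>

definition velocity :: "('a, 'e::euclidean_space) chart set \<Rightarrow> (real \<Rightarrow> 'a) \<Rightarrow> real \<Rightarrow> 'e" where
  "velocity A \<gamma> t = blinfun_apply (tangent_map euclidean_atlas A \<gamma> t) 1"

text \<open>The conormal set \<open>N\<^sup>*(\<iota>)\<close> of a map \<open>\<iota>\<close> from the manifold \<open>(X, A)\<close> to the manifold
  with atlas \<open>B\<close>.\<close>

definition conormal_of_map ::
  "'a topology \<Rightarrow> ('a, 'e::euclidean_space) chart set \<Rightarrow>
   ('b, 'f::euclidean_space) chart set \<Rightarrow> ('a \<Rightarrow> 'b) \<Rightarrow> ('b \<times> ('f \<Rightarrow>\<^sub>L real)) set" where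
  "conormal_of_map X A B \<iota> =
     {(y, \<eta>). \<exists>x\<in>topspace X. y = \<iota> x \<and> pullback A B \<iota> x \<eta> = 0}"

text \<open>The tangent space at \<open>p\<close> of an embedded submanifold \<open>S\<close> consists of the velocities of the
  smooth curves that run inside \<open>S\<close>; the fiber of the conormal bundle is its annihilator.\<close>

definition submanifold_tangent ::
  "'a topology \<Rightarrow> ('a, 'e::euclidean_space) chart set \<Rightarrow> 'a set \<Rightarrow> 'a \<Rightarrow> 'e set" where
  "submanifold_tangent X A S p =
     {velocity A \<gamma> 0 | \<gamma>. smooth_map euclidean euclidean_atlas X A \<gamma> \<and> range \<gamma> \<subseteq> S \<and> \<gamma> 0 = p}"

definition conormal_fiber ::
  "'a topology \<Rightarrow> ('a, 'e::euclidean_space) chart set \<Rightarrow> 'a set \<Rightarrow> 'a \<Rightarrow> ('e \<Rightarrow>\<^sub>L real) set" where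
  "conormal_fiber X A S p = {\<eta>. \<forall>v\<in>submanifold_tangent X A S p. blinfun_apply \<eta> v = 0}"


section \<open>Vector fields, flows, Riemannian metrics and isometries\<close>

text \<open>From here on the manifold is the whole type \<open>'m\<close> with its own topology.\<close>

definition smooth_vector_field ::
  "('m::topological_space, 'e::euclidean_space) chart set \<Rightarrow> ('m \<Rightarrow> 'e) \<Rightarrow> bool" where
  "smooth_vector_field A V \<longleftrightarrow>
     (\<forall>c\<in>A. smooth_on (snd c ` fst c)
        (\<lambda>x. let p = chart_inv c x in
           blinfun_apply (tangent_map A euclidean_atlas (snd c) p) (V p)))"

definition is_flow ::
  "('m::topological_space, 'e::euclidean_space) chart set \<Rightarrow> ('m \<Rightarrow> 'e) \<Rightarrow>
   (real \<Rightarrow> 'm \<Rightarrow> 'm) \<Rightarrow> bool" where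
  "is_flow A V a \<longleftrightarrow>
     (\<forall>p. a 0 p = p \<and> smooth_map euclidean euclidean_atlas euclidean A (\<lambda>t. a t p) \<and>
          (\<forall>t. velocity A (\<lambda>t. a t p) t = V (a t p)))"

text \<open>\<open>coordinate_vector A c v x\<close> is the tangent vector at the point \<open>chart_inv c x\<close> whose
  coordinates in the chart \<open>c\<close> are \<open>v\<close>.\<close>

definition coordinate_vector ::
  "('m::topological_space, 'e::euclidean_space) chart set \<Rightarrow> ('m, 'e) chart \<Rightarrow> 'e \<Rightarrow> 'e \<Rightarrow> 'e" where
  "coordinate_vector A c v x = blinfun_apply (tangent_map euclidean_atlas A (chart_inv c) x) v"

definition riemannian_metric ::
  "('m::topological_space, 'e::euclidean_space) chart set \<Rightarrow> ('m \<Rightarrow> 'e \<Rightarrow> 'e \<Rightarrow> real) \<Rightarrow> bool" where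
  "riemannian_metric A g \<longleftrightarrow>
     (\<forall>p. bilinear (g p) \<and> (\<forall>v w. g p v w = g p w v) \<and> (\<forall>v. v \<noteq> 0 \<longrightarrow> g p v v > 0)) \<and>
     (\<forall>c\<in>A. \<forall>v w. smooth_on (snd c ` fst c)
        (\<lambda>x. g (chart_inv c x) (coordinate_vector A c v x) (coordinate_vector A c w x)))"

definition isometries ::
  "('m::topological_space, 'e::euclidean_space) chart set \<Rightarrow> ('m \<Rightarrow> 'e \<Rightarrow> 'e \<Rightarrow> real) \<Rightarrow>
   ('m \<Rightarrow> 'm) set" where
  "isometries A g =
     {h. bij h \<and> smooth_map euclidean A euclidean A h \<and> smooth_map euclidean A euclidean A (inv h) \<and>
         (\<forall>p v w. g (h p) (blinfun_apply (tangent_map A A h p) v)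
                         (blinfun_apply (tangent_map A A h p) w) = g p v w)}"


section \<open>Transformation groups\<close>

definition compact_open :: "('m::topological_space \<Rightarrow> 'm) topology" where
  "compact_open = topology_generated_by
     {{h. continuous_on UNIV h \<and> h ` K \<subseteq> U} | K U. compact K \<and> open U}"

abbreviation transformation_topology :: "('m::topological_space \<Rightarrow> 'm) set \<Rightarrow> ('m \<Rightarrow> 'm) topology"
  where "transformation_topology G \<equiv> subtopology compact_open G"

text \<open>The closure is taken inside the group of isometries.  Elements of \<open>G\<close> are themselves
  transformations of \<open>'m\<close>: the group law is composition and \<open>g \<in> G\<close> acts by \<open>p \<mapsto> g p\<close>.\<close>

definition flow_closure ::
  "('m::topological_space, 'e::euclidean_space) chart set \<Rightarrow> ('m \<Rightarrow> 'e \<Rightarrow> 'e \<Rightarrow> real) \<Rightarrow>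
   (real \<Rightarrow> 'm \<Rightarrow> 'm) \<Rightarrow> ('m \<Rightarrow> 'm) set" where
  "flow_closure A g a = transformation_topology (isometries A g) closure_of range a"

text \<open>\<open>\<Gamma>\<close> is the Lie group structure of the transformation group \<open>G\<close>: it is compatible with the
  compact-open topology, the group operations are smooth and so is the action.  For a closed
  subgroup of the isometry group of a compact Riemannian manifold such a structure exists and is
  unique up to equivalence of atlases (theorems of Myers--Steenrod and Cartan).\<close>

definition lie_transformation_group ::
  "('m::topological_space, 'e::euclidean_space) chart set \<Rightarrow> ('m \<Rightarrow> 'm) set \<Rightarrow>
   ('m \<Rightarrow> 'm, 'k::euclidean_space) chart set \<Rightarrow> bool" where
  "lie_transformation_group A G \<Gamma> \<longleftrightarrow>
     smooth_manifold (transformation_topology G) \<Gamma> \<and>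
     smooth_map (prod_topology (transformation_topology G) (transformation_topology G))
       (prod_atlas \<Gamma> \<Gamma>) (transformation_topology G) \<Gamma> (\<lambda>(g, h). g \<circ> h) \<and>
     smooth_map (transformation_topology G) \<Gamma> (transformation_topology G) \<Gamma> inv \<and>
     smooth_map (prod_topology euclidean (transformation_topology G))
       (prod_atlas A \<Gamma>) euclidean A (\<lambda>(p, g). g p)"

definition orbits :: "('m \<Rightarrow> 'm) set \<Rightarrow> 'm set set" where
  "orbits G = range (\<lambda>p. {g p | g. g \<in> G})"

text \<open>The map induced by \<open>f\<close> on the space of orbits is \<open>\<Y> \<mapsto> f ` \<Y>\<close>.\<close>

definition Fix_orbits :: "('m \<Rightarrow> 'm) set \<Rightarrow> ('m \<Rightarrow> 'm) \<Rightarrow> 'm set set" where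
  "Fix_orbits G f = {Y \<in> orbits G. f ` Y = Y}"

definition iota_map :: "('m \<Rightarrow> 'm) \<Rightarrow> 'm \<times> ('m \<Rightarrow> 'm) \<Rightarrow> 'm \<times> 'm" where
  "iota_map f = (\<lambda>(p, g). (g p, f p))"

definition iota_diag :: "'m \<Rightarrow> 'm \<times> 'm" where
  "iota_diag p = (p, p)"

end

theory Submission
  imports Defs
begin

text \<open>A covector in both conormal sets lives over a point \<open>(q, q)\<close> with \<open>q = g p = f p\<close>, and by the
  diagonal it has the form \<open>(\<xi>, - \<xi>)\<close>. Being conormal to \<open>\<iota>\<^sub>f\<close> means that \<open>\<xi>\<close> kills the derivative at
  \<open>g\<close> of \<open>g \<mapsto> g p\<close> and that \<open>g\<^sup>*\<xi> = f\<^sup>*\<xi>\<close> at \<open>p\<close>. With \<open>g\<^sub>0 = g\<inverse>\<close> the covector \<open>g\<^sup>*\<xi>\<close> is then conormal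
  to the orbit of \<open>p\<close> and fixed by \<open>(g\<^sub>0 \<circ> f)\<^sup>*\<close>, and the construction can be reversed. Besides
  this, two facts are needed. Uniqueness of integral curves shows that \<open>f\<close> and the flow maps
  commute with each other, hence with their closure \<open>G\<close>. And the velocities of smooth curves
  running in an orbit are exactly the derivatives in group directions, which follows from the
  constant rank theorem and Baire's theorem.\<close>

text \<open>Commutation is what spreads a coincidence at one point over an orbit: from
  \<open>f p = g p\<close> it follows that \<open>f (h p) = h (f p) = h (g p) = g (h p)\<close>, so
  the orbit of \<open>p\<close> lies in \<open>Fix_orbits G f\<close> and
  \<open>inv g \<circ> f\<close> is the identity on all of it. Since \<open>f\<close> may have a
  singular differential, covectors are moved only by pullback under elements of \<open>G\<close>,
  which are diffeomorphisms; this is why nonzero covectors stay nonzero. The tangent spaces of an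
  orbit are the hard point because \<open>submanifold_tangent\<close> allows every smooth curve of
  the manifold whose values lie in the orbit, and such a curve comes with no lift to
  \<open>G\<close>. A tangent vector is a coordinate vector in a selected chart, and the selection
  can jump from point to point. On the product it may even use two different charts at
  \<open>(q, q)\<close>, so the form \<open>(\<xi>, - \<xi>)\<close> appears only after coordinate
  changes. Derivatives are therefore taken in arbitrary pairs of charts and compared with the
  selected ones at single points.\<close>

subsection \<open>Calculus of smooth maps\<close>

text \<open>The derivative at a point sees only nearby values, so agreement on an open set passes to
  derivatives of every order.\<close>

lemma Ck_on_cong:
  assumes "open S" "\<And>x. x \<in> S \<Longrightarrow> f x = g x" "Ck_on k S f"
  shows "Ck_on k S g"
  using assms(2,3)
proof (induction k arbitrary: f g)
  case 0
  then show ?case by (simp cong: continuous_on_cong)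
next
  case (Suc k)
  have der: "(g has_derivative frechet_derivative f (at x)) (at x)" if "x \<in> S" for x
  proof (rule has_derivative_transform_within_open[OF _ assms(1) that Suc.prems(1)])
    show "(f has_derivative frechet_derivative f (at x)) (at x)"
      using Suc.prems(2) that frechet_derivative_works[of f "at x"] by simp
  qed
  have eq: "frechet_derivative g (at x) = frechet_derivative f (at x)" if "x \<in> S" for x
    using frechet_derivative_at[OF der[OF that]] by simp
  have "Ck_on k S (\<lambda>x. frechet_derivative g (at x) v)" for v
    by (rule Suc.IH[of "\<lambda>x. frechet_derivative f (at x) v"]) (use Suc.prems(2) eq in auto)
  then show ?case using der by (auto simp: differentiable_def)
qed

text \<open>\<open>frechet_derivative\<close> is a choice operator; the closure properties below
  exhibit a candidate \<open>h'\<close> instead and let uniqueness of the derivative identify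
  it.\<close>

lemma Ck_on_SucI:
  assumes "open S" "\<And>x. x \<in> S \<Longrightarrow> (h has_derivative h' x) (at x)"
    and "\<And>v. Ck_on k S (\<lambda>x. h' x v)"
  shows "Ck_on (Suc k) S h"
proof -
  have eq: "frechet_derivative h (at x) = h' x" if "x \<in> S" for x
    using frechet_derivative_at[OF assms(2)[OF that]] by simp
  have "Ck_on k S (\<lambda>x. frechet_derivative h (at x) v)" for v
    by (rule Ck_on_cong[OF assms(1) _ assms(3)[of v]]) (simp add: eq)
  then show ?thesis
    using assms(2) by (auto simp: differentiable_def)
qed

lemma Ck_on_has_derivative:
  "Ck_on (Suc k) S h \<Longrightarrow> x \<in> S \<Longrightarrow> (h has_derivative frechet_derivative h (at x)) (at x)"
  using frechet_derivative_works[of h "at x"] by simp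

lemma Ck_on_Suc_imp: "Ck_on (Suc k) S h \<Longrightarrow> Ck_on k S h"
proof (induction k arbitrary: h)
  case 0
  then show ?case
    by (auto intro!: continuous_at_imp_continuous_on differentiable_imp_continuous_within)
next
  case (Suc k)
  then show ?case by (metis Ck_on.simps(2))
qed

lemma Ck_on_subset: "Ck_on k S h \<Longrightarrow> T \<subseteq> S \<Longrightarrow> Ck_on k T h"
  by (induction k arbitrary: h) (auto intro: continuous_on_subset)

lemma Ck_on_const: "open S \<Longrightarrow> Ck_on k S (\<lambda>x. c)"
proof (induction k arbitrary: c)
  case (Suc k)
  show ?case
    by (rule Ck_on_SucI[where h' = "\<lambda>x v. 0"]) (use Suc in auto)
qed auto

lemma Ck_on_linear:
  assumes "bounded_linear L" "open S" "Ck_on k S h"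
  shows "Ck_on k S (\<lambda>x. L (h x))"
  using assms(3)
proof (induction k arbitrary: h)
  case 0
  then show ?case using assms(1) by (simp add: bounded_linear.continuous_on)
next
  case (Suc k)
  show ?case
  proof (rule Ck_on_SucI[OF assms(2)])
    show "((\<lambda>x. L (h x)) has_derivative (\<lambda>v. L (frechet_derivative h (at x) v))) (at x)" if "x \<in> S" for x
      using bounded_linear.has_derivative[OF assms(1) Ck_on_has_derivative[OF Suc.prems that]] .
    show "Ck_on k S (\<lambda>x. L (frechet_derivative h (at x) v))" for v
      using Suc by auto
  qed
qed

lemma Ck_on_add:
  assumes "open S" "Ck_on k S f" "Ck_on k S g"
  shows "Ck_on k S (\<lambda>x. f x + g x)"
  using assms(2,3)
proof (induction k arbitrary: f g)
  case 0
  then show ?case by (auto intro: continuous_intros)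
next
  case (Suc k)
  show ?case
  proof (rule Ck_on_SucI[OF assms(1)])
    show "((\<lambda>x. f x + g x) has_derivative (\<lambda>v. frechet_derivative f (at x) v + frechet_derivative g (at x) v)) (at x)"
      if "x \<in> S" for x
      using has_derivative_add[OF Ck_on_has_derivative[OF Suc.prems(1) that] Ck_on_has_derivative[OF Suc.prems(2) that]] .
    show "Ck_on k S (\<lambda>x. frechet_derivative f (at x) v + frechet_derivative g (at x) v)" for v
      using Suc by auto
  qed
qed

lemma Ck_on_sum:
  assumes "open S" "finite I" "\<And>i. i \<in> I \<Longrightarrow> Ck_on k S (f i)"
  shows "Ck_on k S (\<lambda>x. \<Sum>i\<in>I. f i x)"
  using assms(2,3) by (induction I) (auto intro: Ck_on_const Ck_on_add assms(1))

lemma Ck_on_scaleR: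
  assumes "open S" "Ck_on k S f" "Ck_on k S g"
  shows "Ck_on k S (\<lambda>x. f x *\<^sub>R g x)"
  using assms(2,3)
proof (induction k arbitrary: f g)
  case 0
  then show ?case by (auto intro: continuous_intros)
next
  case (Suc k)
  show ?case
  proof (rule Ck_on_SucI[OF assms(1)])
    show "((\<lambda>x. f x *\<^sub>R g x) has_derivative
        (\<lambda>v. f x *\<^sub>R frechet_derivative g (at x) v + frechet_derivative f (at x) v *\<^sub>R g x)) (at x)"
      if "x \<in> S" for x
      using has_derivative_scaleR[OF Ck_on_has_derivative[OF Suc.prems(1) that] Ck_on_has_derivative[OF Suc.prems(2) that]] .
    show "Ck_on k S (\<lambda>x. f x *\<^sub>R frechet_derivative g (at x) v + frechet_derivative f (at x) v *\<^sub>R g x)" for v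
      using Suc.prems
      by (intro Ck_on_add assms(1) Suc.IH[OF Ck_on_Suc_imp[OF Suc.prems(1)]] Suc.IH[OF _ Ck_on_Suc_imp[OF Suc.prems(2)]]) auto
  qed
qed

lemma Ck_on_Pair:
  assumes "open S" "Ck_on k S f" "Ck_on k S g"
  shows "Ck_on k S (\<lambda>x. (f x, g x))"
  using assms(2,3)
proof (induction k arbitrary: f g)
  case 0
  then show ?case by (auto intro: continuous_intros)
next
  case (Suc k)
  show ?case
  proof (rule Ck_on_SucI[OF assms(1)])
    show "((\<lambda>x. (f x, g x)) has_derivative (\<lambda>v. (frechet_derivative f (at x) v, frechet_derivative g (at x) v))) (at x)"
      if "x \<in> S" for x
      using has_derivative_Pair[OF Ck_on_has_derivative[OF Suc.prems(1) that] Ck_on_has_derivative[OF Suc.prems(2) that]] .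
    show "Ck_on k S (\<lambda>x. (frechet_derivative f (at x) v, frechet_derivative g (at x) v))" for v
      using Suc by auto
  qed
qed

text \<open>\<open>Ck_on\<close> differentiates along fixed vectors, but in the chain rule the
  direction fed to the derivative of \<open>g\<close> varies with \<open>x\<close>. Expanding this
  direction in the basis leaves a finite sum of products, to which the induction hypothesis applies
  factor by factor.\<close>

lemma Ck_on_compose:
  fixes f :: "'a::euclidean_space \<Rightarrow> 'b::euclidean_space" and g :: "'b \<Rightarrow> 'c::real_normed_vector"
  assumes "open S" "f ` S \<subseteq> T" "Ck_on k S f" "Ck_on k T g"
  shows "Ck_on k S (\<lambda>x. g (f x))"
  using assms(3,4)
proof (induction k arbitrary: g)
  case 0
  then show ?case using assms(2) by (auto intro: continuous_on_compose2)
next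
  case (Suc k)
  let ?h' = "\<lambda>x v. \<Sum>b\<in>Basis. (frechet_derivative f (at x) v \<bullet> b) *\<^sub>R frechet_derivative g (at (f x)) b"
  show ?case
  proof (rule Ck_on_SucI[OF assms(1), where h' = ?h'])
    show "((\<lambda>x. g (f x)) has_derivative ?h' x) (at x)" if "x \<in> S" for x
    proof -
      have g: "(g has_derivative frechet_derivative g (at (f x))) (at (f x))"
        using that assms(2) by (intro Ck_on_has_derivative[OF Suc.prems(2)]) auto
      have "linear (frechet_derivative g (at (f x)))"
        using g has_derivative_linear by blast
      then have eq: "frechet_derivative g (at (f x)) w = (\<Sum>b\<in>Basis. (w \<bullet> b) *\<^sub>R frechet_derivative g (at (f x)) b)" for w
        using linear_sum[of "frechet_derivative g (at (f x))" "\<lambda>b. (w \<bullet> b) *\<^sub>R b" Basis]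
        by (simp add: euclidean_representation linear_scale)
      have "?h' x = (\<lambda>v. frechet_derivative g (at (f x)) (frechet_derivative f (at x) v))" by (intro ext) (rule eq[symmetric])
      then show ?thesis
        using has_derivative_compose[OF Ck_on_has_derivative[OF Suc.prems(1) that] g] by simp
    qed
    show "Ck_on k S (\<lambda>x. ?h' x v)" for v
    proof (intro Ck_on_sum Ck_on_scaleR assms(1) finite_Basis)
      fix b :: 'b
      show "Ck_on k S (\<lambda>x. frechet_derivative f (at x) v \<bullet> b)"
        using Suc.prems(1) by (intro Ck_on_linear[OF bounded_linear_inner_left] assms(1)) auto
      show "Ck_on k S (\<lambda>x. frechet_derivative g (at (f x)) b)"
        using Suc.IH[OF Ck_on_Suc_imp[OF Suc.prems(1)], of "\<lambda>y. frechet_derivative g (at y) b"] Suc.prems(2)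
        by simp
    qed
  qed
qed

lemma smooth_on_compose:
  fixes f :: "'a::euclidean_space \<Rightarrow> 'b::euclidean_space"
  assumes "smooth_on S f" "smooth_on T g" "f ` S \<subseteq> T"
  shows "smooth_on S (\<lambda>x. g (f x))"
  using assms by (auto simp: smooth_on_def intro: Ck_on_compose[where T = T])

lemma smooth_on_subset: "smooth_on S f \<Longrightarrow> open T \<Longrightarrow> T \<subseteq> S \<Longrightarrow> smooth_on T f"
  unfolding smooth_on_def by (blast intro: Ck_on_subset)

lemma smooth_on_cong:
  "smooth_on S f \<Longrightarrow> (\<And>x. x \<in> S \<Longrightarrow> f x = g x) \<Longrightarrow> smooth_on S g"
  unfolding smooth_on_def using Ck_on_cong[of S f g] by simp

lemma Ck_on_id: "open S \<Longrightarrow> Ck_on k S (\<lambda>x. x)"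
proof (cases k)
  case (Suc n)
  show "open S \<Longrightarrow> ?thesis"
    unfolding Suc by (rule Ck_on_SucI[where h' = "\<lambda>x v. v"]) (auto intro: Ck_on_const has_derivative_ident)
qed auto

lemma smooth_on_const: "open S \<Longrightarrow> smooth_on S (\<lambda>x. c)"
  and smooth_on_id: "open S \<Longrightarrow> smooth_on S (\<lambda>x. x)"
  and smooth_on_Pair: "smooth_on S f \<Longrightarrow> smooth_on S g \<Longrightarrow> smooth_on S (\<lambda>x. (f x, g x))"
  by (simp_all add: smooth_on_def Ck_on_const Ck_on_id Ck_on_Pair)

text \<open>Differentiation stays in this family with \<open>x = 0\<close>, hence the generalization
  over \<open>x\<close>, \<open>\<alpha>\<close> and \<open>\<beta>\<close>. The sine is wanted for
  curves that exist for all times, stay in a small ball and start with nonzero velocity.\<close>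

lemma Ck_on_sin_cos:
  "Ck_on k UNIV (\<lambda>t::real. x + (\<alpha> * sin t + \<beta> * cos t) *\<^sub>R w)"
proof (induction k arbitrary: x \<alpha> \<beta>)
  case 0
  then show ?case by (auto intro!: continuous_intros)
next
  case (Suc k)
  have 1: "v * (\<alpha> * cos t - \<beta> * sin t) = (- v * \<beta>) * sin t + (v * \<alpha>) * cos t" for v t :: real
    by (simp add: algebra_simps)
  have 2: "Ck_on k UNIV (\<lambda>t. (v * (\<alpha> * cos t - \<beta> * sin t)) *\<^sub>R w)" for v
    unfolding 1 using Suc[of 0 "- v * \<beta>" "v * \<alpha>"] by simp
  show ?case
  proof (rule Ck_on_SucI[where h' = "\<lambda>t v. (v * (\<alpha> * cos t - \<beta> * sin t)) *\<^sub>R w"])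
    show "((\<lambda>t. x + (\<alpha> * sin t + \<beta> * cos t) *\<^sub>R w) has_derivative
        (\<lambda>v. (v * (\<alpha> * cos t - \<beta> * sin t)) *\<^sub>R w)) (at t)" for t :: real
      by (auto intro!: derivative_eq_intros simp: algebra_simps)
  qed (auto intro: 2)
qed

lemma smooth_on_sin: "smooth_on UNIV (\<lambda>t::real. x + (\<epsilon> * sin t) *\<^sub>R w)"
  using Ck_on_sin_cos[of _ x \<epsilon> 0 w] by (simp add: smooth_on_def)

lemma smooth_on_has_derivative:
  "smooth_on S h \<Longrightarrow> x \<in> S \<Longrightarrow> (h has_derivative frechet_derivative h (at x)) (at x)"
  unfolding smooth_on_def by (rule Ck_on_has_derivative[of 0]) auto

lemma smooth_on_continuous_frechet:
  "smooth_on S h \<Longrightarrow> continuous_on S (\<lambda>x. frechet_derivative h (at x) v)"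
  unfolding smooth_on_def using Ck_on.simps(2)[of 0 S h] by simp

text \<open>In finite dimension continuity along each direction gives continuity in operator norm,
  the form asked for by the inverse function theorem and by Lipschitz estimates.\<close>

lemma smooth_on_continuous_derivative:
  assumes "smooth_on S h"
  obtains h' where "\<And>x. x \<in> S \<Longrightarrow> (h has_derivative blinfun_apply (h' x)) (at x)"
    "\<And>x. x \<in> S \<Longrightarrow> blinfun_apply (h' x) = frechet_derivative h (at x)"
    "continuous_on S h'"
proof
  let ?h' = "\<lambda>x. Blinfun (frechet_derivative h (at x))"
  show eq: "blinfun_apply (?h' x) = frechet_derivative h (at x)" if "x \<in> S" for x
    using smooth_on_has_derivative[OF assms that] bounded_linear_Blinfun_apply has_derivative_bounded_linear by blast
  then show "(h has_derivative blinfun_apply (?h' x)) (at x)" if "x \<in> S" for x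
    using smooth_on_has_derivative[OF assms that] that by simp
  have "open S" using assms by (simp add: smooth_on_def)
  show "continuous_on S ?h'"
  proof (rule continuous_on_blinfun_componentwise)
    show "continuous_on S (\<lambda>x. blinfun_apply (?h' x) i)" for i
      using smooth_on_continuous_frechet[OF assms, of i] eq by (simp cong: continuous_on_cong)
  qed
qed

subsection \<open>Maps of constant rank\<close>

text \<open>A linear right inverse \<open>g\<close> of \<open>D\<close> on its range satisfies the
  first identity; the composite of \<open>g\<close>, \<open>D\<close> and \<open>g\<close> satisfies
  both.\<close>

lemma blinfun_generalized_inverse:
  fixes D :: "'a::euclidean_space \<Rightarrow>\<^sub>L 'b::euclidean_space"
  obtains R :: "'b \<Rightarrow>\<^sub>L 'a" where "D o\<^sub>L R o\<^sub>L D = D" "R o\<^sub>L D o\<^sub>L R = R"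
proof -
  have lD: "linear (blinfun_apply D)"
    by (simp add: blinfun.bounded_linear_right bounded_linear.linear)
  obtain g where g: "linear g" "\<And>v. v \<in> range D \<Longrightarrow> D (g v) = v"
    using linear_exists_right_inverse_on[OF lD, of UNIV] by auto
  define R where "R = Blinfun g o\<^sub>L D o\<^sub>L Blinfun g"
  have "blinfun_apply (Blinfun g) = g"
    using g(1) by (simp add: bounded_linear_Blinfun_apply linear_linear)
  then have "D o\<^sub>L R o\<^sub>L D = D" "R o\<^sub>L D o\<^sub>L R = R"
    by (auto intro!: blinfun_eqI simp: R_def g(2))
  then show thesis by (rule that)
qed

lemma linear_blinfun: "linear (blinfun_apply D)"
  by (simp add: blinfun.bounded_linear_right bounded_linear.linear)

text \<open>\<open>R\<close> is injective on the range of \<open>D\<close>, because \<open>D\<close>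
  undoes it there.\<close>

lemma dim_generalized_inverse:
  fixes D :: "'a::euclidean_space \<Rightarrow>\<^sub>L 'b::euclidean_space"
  assumes "D o\<^sub>L R o\<^sub>L D = D"
  shows "dim (range (R o\<^sub>L D)) = dim (range D)"
proof -
  have DRD: "D (R (D x)) = D x" for x
    using arg_cong[OF assms, of "\<lambda>L. blinfun_apply L x"] by simp
  have "inj_on R (span (range D))"
  proof -
    have "span (range D) = range D"
      by (simp add: linear_blinfun linear_subspace_image span_eq_iff)
    then show ?thesis by (metis (mono_tags, lifting) DRD f_inv_into_f inj_on_inverseI)
  qed
  then have "dim (R ` range D) = dim (range D)"
    by (rule dim_image_eq[OF linear_blinfun])
  then show ?thesis by (simp add: image_image)
qed

text \<open>\<open>R \<circ> D\<close> is a projection onto a complement \<open>W\<close> of the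
  kernel of \<open>D\<close>. On \<open>W\<close> it is the identity, and for \<open>L\<close> near
  \<open>D\<close> the norm of \<open>R \<circ> (L - D)\<close> is below 1, so \<open>L\<close> has
  no kernel in \<open>W\<close>. The dimension of \<open>W\<close> is the rank of
  \<open>D\<close>.\<close>

lemma rank_lower_semicontinuous:
  fixes D :: "'a::euclidean_space \<Rightarrow>\<^sub>L 'b::euclidean_space"
  obtains \<epsilon> where "\<epsilon> > 0" "\<And>L :: 'a \<Rightarrow>\<^sub>L 'b. norm (L - D) < \<epsilon> \<Longrightarrow> dim (range D) \<le> dim (range L)"
proof -
  obtain R where DRD: "D o\<^sub>L R o\<^sub>L D = D"
    by (rule blinfun_generalized_inverse)
  have RD: "R (D (R (D x))) = R (D x)" for x
    using arg_cong[OF DRD, of "\<lambda>L. blinfun_apply L x"] by simp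
  \<comment> \<open>The added 1 covers \<open>R = 0\<close> and makes
    \<open>norm R * \<epsilon>\<close> strictly less than 1.\<close>
  define \<epsilon> where "\<epsilon> = 1 / (norm R + 1)"
  have "\<epsilon> > 0" by (simp add: \<epsilon>_def add_nonneg_pos)
  moreover have "dim (range D) \<le> dim (range L)" if L: "norm (L - D) < \<epsilon>" for L :: "'a \<Rightarrow>\<^sub>L 'b"
  proof -
    let ?W = "range (R o\<^sub>L D)"
    have W: "subspace ?W" by (rule linear_subspace_image[OF linear_blinfun subspace_UNIV])
    then have W_span: "span ?W = ?W" by (simp add: span_eq_iff)
    have "norm R * norm (L - D) \<le> norm R * \<epsilon>"
      using L by (intro mult_left_mono) auto
    also have "\<dots> < 1" by (simp add: \<epsilon>_def divide_simps add_nonneg_pos)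
    finally have small: "norm (R o\<^sub>L (L - D)) < 1"
      using norm_blinfun_compose[of R "L - D"] by linarith
    have "w = 0" if w: "w \<in> ?W" "L w = 0" for w
    proof (rule ccontr)
      assume "w \<noteq> 0"
      have "R (D w) = w" using w(1) RD by auto
      then have "(R o\<^sub>L (L - D)) w = - w"
        using w(2) by (simp add: blinfun.diff_left blinfun.minus_right)
      then have "norm w \<le> norm (R o\<^sub>L (L - D)) * norm w"
        by (metis norm_blinfun norm_minus_cancel)
      also have "\<dots> < 1 * norm w" using small \<open>w \<noteq> 0\<close> by (intro mult_strict_right_mono) auto
      finally show False by simp
    qed
    then have "inj_on L (span ?W)"
      unfolding W_span using linear_injective_on_subspace_0[OF linear_blinfun W] by blast
    then have "dim (L ` ?W) = dim ?W" by (rule dim_image_eq[OF linear_blinfun])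
    moreover have "dim (L ` ?W) \<le> dim (range L)" by (intro dim_subset) auto
    ultimately show ?thesis using dim_generalized_inverse[OF DRD] by simp
  qed
  ultimately show thesis by (rule that)
qed

text \<open>With a generalized inverse \<open>R\<close> of the derivative \<open>D\<close> at \<open>x0\<close>, the map
  \<open>\<Phi> x = R (E x) + x - R (D x)\<close> is a local diffeomorphism. By constancy of the rank, \<open>E \<circ> \<Phi>\<inverse>\<close> depends
  only on the projection by \<open>R \<circ> D\<close>, and this projection of \<open>\<Phi> x\<close> is \<open>R (E x)\<close>. So locally
  \<open>E x = F (R (E x))\<close> for a differentiable \<open>F\<close>, and \<open>c = F \<circ> R \<circ> c\<close> for curves \<open>c\<close> in the image.\<close>

lemma constant_rank_curve:
  fixes E :: "'a::euclidean_space \<Rightarrow> 'b::euclidean_space"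
  assumes S: "open S" "x0 \<in> S"
    and der: "\<And>x. x \<in> S \<Longrightarrow> (E has_derivative blinfun_apply (E' x)) (at x)"
    and cont: "continuous_on S E'"
    and rank: "\<And>x. x \<in> S \<Longrightarrow> dim (range (E' x)) = dim (range (E' x0))"
  obtains \<delta> where "\<delta> > 0" "cball x0 \<delta> \<subseteq> S"
    "\<And>c c' t0. (c has_vector_derivative c') (at t0) \<Longrightarrow> \<forall>\<^sub>F t in nhds t0. c t \<in> E ` cball x0 \<delta> \<Longrightarrow>
       \<exists>x\<in>S. c t0 = E x \<and> c' \<in> range (E' x)"
proof -
  define D where "D = E' x0"
  obtain R where DRD: "D o\<^sub>L R o\<^sub>L D = D" and RDR: "R o\<^sub>L D o\<^sub>L R = R"
    by (rule blinfun_generalized_inverse)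
  have RDR': "R (D (R x)) = R x" for x
    using arg_cong[OF RDR, of "\<lambda>L. blinfun_apply L x"] by simp
  define Q where "Q = R o\<^sub>L D"
  have Q: "Q x = R (D x)" for x by (simp add: Q_def)
  have QQ: "Q (Q x) = Q x" for x by (simp add: Q RDR')
  define \<Phi> where "\<Phi> x = R (E x) + x - Q x" for x
  define \<Phi>' where "\<Phi>' x = (R o\<^sub>L E' x) + id_blinfun - Q" for x
  have Q\<Phi>: "Q (\<Phi> x) = R (E x)" for x
    by (simp add: \<Phi>_def blinfun.add_right blinfun.diff_right QQ) (simp add: Q RDR')
  have Q\<Phi>': "Q (\<Phi>' x v) = R (E' x v)" for x v
    by (simp add: \<Phi>'_def blinfun.add_left blinfun.diff_left blinfun.add_right blinfun.diff_right QQ)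
       (simp add: Q RDR')
  have der\<Phi>: "(\<Phi> has_derivative \<Phi>' x) (at x)" if "x \<in> S" for x
    unfolding \<Phi>_def \<Phi>'_def
    by (rule derivative_eq_intros der[OF that] refl
        bounded_linear.has_derivative[OF blinfun.bounded_linear_right])+
       (simp add: blinfun.add_left blinfun.diff_left fun_eq_iff)
  have cont\<Phi>': "continuous_on S \<Phi>'"
    unfolding \<Phi>'_def
    by (intro continuous_intros cont bounded_bilinear.continuous_on[OF bounded_bilinear_blinfun_compose])
  \<comment> \<open>At \<open>x0\<close> the terms \<open>R o\<^sub>L D\<close> and \<open>Q\<close>
    cancel, so the derivative there is the identity and the inverse function theorem
    applies.\<close>
  have inv: "id_blinfun o\<^sub>L \<Phi>' x0 = id_blinfun"
    by (auto intro!: blinfun_eqI simp: \<Phi>'_def blinfun.add_left blinfun.diff_left Q D_def)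
  obtain U V \<Psi> \<Psi>' where U: "open U" "U \<subseteq> S" "x0 \<in> U" and V: "open V" "\<Phi> x0 \<in> V"
    and hom: "homeomorphism U V \<Phi> \<Psi>"
    and der\<Psi>: "\<And>y. y \<in> V \<Longrightarrow> (\<Psi> has_derivative \<Psi>' y) (at y)"
    and \<Psi>': "\<And>y. y \<in> V \<Longrightarrow> \<Psi>' y = inv (\<Phi>' (\<Psi> y))"
    and bij: "\<And>y. y \<in> V \<Longrightarrow> bij (\<Phi>' (\<Psi> y))"
    using inverse_function_theorem[OF S(1) der\<Phi> cont\<Phi>' S(2) inv] by metis
  have \<Psi>U: "\<Psi> y \<in> U" if "y \<in> V" for y using hom that by (auto simp: homeomorphism_def)
  define H where "H y = E (\<Psi> y)" for y
  define H' where "H' y v = E' (\<Psi> y) (\<Psi>' y v)" for y v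
  have derH: "(H has_derivative H' y) (at y)" if "y \<in> V" for y
    unfolding H_def H'_def
    using has_derivative_compose[OF der\<Psi>[OF that] der] \<Psi>U[OF that] U(2) by auto
  have rangeH': "range (H' y) = range (E' (\<Psi> y))" if "y \<in> V" for y
  proof -
    have "surj (\<Psi>' y)" unfolding \<Psi>'[OF that] using bij[OF that] by (simp add: bij_imp_bij_inv bij_is_surj)
    then show ?thesis unfolding H'_def by (metis image_image)
  qed
  \<comment> \<open>Here constancy of the rank enters. By \<open>R (H' y u) = Q u\<close>, the map
    \<open>H' y\<close> is injective on the range of \<open>Q\<close>, whose dimension is the rank
    of \<open>D\<close> and so that of \<open>H' y\<close>. Hence \<open>H' y v = H' y w\<close> for
    some \<open>w\<close> in the range of \<open>Q\<close>, and applying \<open>R\<close> gives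
    \<open>w = Q w = Q v = 0\<close>.\<close>
  have H'0: "H' y v = 0" if y: "y \<in> V" and v: "Q v = 0" for y v
  proof -
    have lin: "linear (H' y)" using derH[OF y] has_derivative_linear by blast
    have RH': "R (H' y u) = Q u" for u
    proof -
      have "\<Phi>' (\<Psi> y) (\<Psi>' y u) = u"
        unfolding \<Psi>'[OF y] using bij[OF y] by (simp add: bij_is_surj surj_f_inv_f)
      then show ?thesis unfolding H'_def Q\<Phi>'[symmetric] by simp
    qed
    let ?W = "range Q"
    have W: "subspace ?W" by (rule linear_subspace_image[OF linear_blinfun subspace_UNIV])
    then have W_span: "span ?W = ?W" by (simp add: span_eq_iff)
    have "inj_on (H' y) ?W"
      by (rule inj_on_inverseI[where g = R]) (auto simp: RH' QQ)
    then have "dim (H' y ` ?W) = dim ?W"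
      using dim_image_eq[OF lin, of ?W] W_span by simp
    also have "\<dots> = dim (range D)" unfolding Q_def by (rule dim_generalized_inverse[OF DRD])
    also have "\<dots> = dim (range (H' y))"
      unfolding rangeH'[OF y] D_def using rank[of "\<Psi> y"] \<Psi>U[OF y] U(2) by (metis subsetD)
    finally have "H' y ` ?W = range (H' y)"
      by (intro subspace_dim_equal) (auto intro!: linear_subspace_image[OF lin] W)
    then obtain w where w: "w \<in> ?W" "H' y v = H' y w" by (metis (mono_tags, lifting) imageE rangeI)
    then have "Q w = 0" using RH'[of v] RH'[of w] v by simp
    then have "w = 0" using w(1) QQ by auto
    then show ?thesis using w(2) linear_0[OF lin] by simp
  qed
  obtain \<rho> where \<rho>: "\<rho> > 0" "ball (\<Phi> x0) \<rho> \<subseteq> V" using V open_contains_ball by blast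
  \<comment> \<open>The segment from \<open>z\<close> to \<open>z'\<close> stays in the ball, and
    its direction lies in the kernel of \<open>Q\<close>, where \<open>H'\<close> vanishes.\<close>
  have H_eq: "H z = H z'" if z: "z \<in> ball (\<Phi> x0) \<rho>" "z' \<in> ball (\<Phi> x0) \<rho>" and "Q z = Q z'" for z z'
  proof -
    define l where "l s = z + s *\<^sub>R (z' - z)" for s :: real
    have l: "l s \<in> V" if "s \<in> {0..1}" for s
    proof -
      have "l s = (1 - s) *\<^sub>R z + s *\<^sub>R z'" by (simp add: l_def algebra_simps)
      then have "l s \<in> ball (\<Phi> x0) \<rho>"
        using convexD[OF convex_ball z, of "1 - s" s] that by auto
      then show ?thesis using \<rho>(2) by auto
    qed
    have "((\<lambda>s. H (l s)) has_derivative (\<lambda>_. 0)) (at s within {0..1})" if "s \<in> {0..1}" for s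
    proof -
      have "(l has_derivative (\<lambda>h. h *\<^sub>R (z' - z))) (at s within {0..1})"
        unfolding l_def by (auto intro!: derivative_eq_intros)
      from has_derivative_compose[OF this derH[OF l[OF that]]]
      have "((\<lambda>s. H (l s)) has_derivative (\<lambda>h. H' (l s) (h *\<^sub>R (z' - z)))) (at s within {0..1})" .
      moreover have "H' (l s) (h *\<^sub>R (z' - z)) = 0" for h
        by (rule H'0[OF l[OF that]]) (simp add: blinfun.scaleR_right blinfun.diff_right \<open>Q z = Q z'\<close>)
      ultimately show ?thesis by simp
    qed
    then obtain c where "\<forall>s\<in>{0..1}. H (l s) = c"
      using has_derivative_zero_constant[of "{0..1::real}" "\<lambda>s. H (l s)"] by auto
    then have "H (l 0) = H (l 1)" by simp
    then show ?thesis by (simp add: l_def)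
  qed
  \<comment> \<open>A translation taking \<open>R (E x0)\<close> to \<open>\<Phi> x0\<close>, so
    distances to the two centers agree; on the range of \<open>R\<close> it is a section of
    \<open>Q\<close>. The factor \<open>F\<close> of the text above is
    \<open>H \<circ> \<sigma>\<close>.\<close>
  define \<sigma> where "\<sigma> w = w + \<Phi> x0 - R (E x0)" for w
  have Q\<sigma>: "Q (\<sigma> (R v)) = R v" for v
    by (simp add: \<sigma>_def blinfun.add_right blinfun.diff_right Q\<Phi>) (simp add: Q RDR')
  have dist\<sigma>: "dist (\<Phi> x0) (\<sigma> w) = dist w (R (E x0))" for w
    by (simp add: \<sigma>_def dist_norm norm_minus_commute algebra_simps)
  have contS: "continuous_on S E" "continuous_on S \<Phi>"
    using der der\<Phi> has_derivative_continuous by (blast intro: continuous_at_imp_continuous_on)+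
  \<comment> \<open>The last condition puts \<open>\<sigma> (R (E x))\<close> in the same ball as
    \<open>\<Phi> x\<close>, so that \<open>H_eq\<close> can compare the two points.\<close>
  let ?N = "{x \<in> U. \<Phi> x \<in> ball (\<Phi> x0) \<rho> \<and> R (E x) \<in> ball (R (E x0)) \<rho>}"
  have "open ?N"
  proof -
    have "?N = (U \<inter> \<Phi> -` ball (\<Phi> x0) \<rho>) \<inter> (U \<inter> (\<lambda>x. R (E x)) -` ball (R (E x0)) \<rho>)" by auto
    moreover have "continuous_on U \<Phi>" "continuous_on U (\<lambda>x. R (E x))"
      using contS U(2) by (auto intro!: continuous_intros intro: continuous_on_subset)
    ultimately show ?thesis
      using U(1) by (simp add: continuous_open_preimage open_Int)
  qed
  moreover have "x0 \<in> ?N" using U(3) \<rho>(1) by simp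
  ultimately obtain \<delta> where \<delta>: "\<delta> > 0" "cball x0 \<delta> \<subseteq> ?N"
    by (meson open_contains_cball)
  have E_eq: "E x = H (\<sigma> (R (E x)))" "\<sigma> (R (E x)) \<in> V" if x: "x \<in> cball x0 \<delta>" for x
  proof -
    have N: "x \<in> U" "\<Phi> x \<in> ball (\<Phi> x0) \<rho>" "\<sigma> (R (E x)) \<in> ball (\<Phi> x0) \<rho>"
      using x \<delta>(2) dist\<sigma>[of "R (E x)"] by (auto simp: dist_commute)
    have "E x = H (\<Phi> x)" using hom N(1) by (simp add: H_def homeomorphism_def)
    also have "\<dots> = H (\<sigma> (R (E x)))" by (rule H_eq) (use N in \<open>auto simp: Q\<sigma> Q\<Phi>\<close>)
    finally show "E x = H (\<sigma> (R (E x)))" .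
    show "\<sigma> (R (E x)) \<in> V" using N(3) \<rho>(2) by auto
  qed
  show thesis
  proof
    show "\<delta> > 0" "cball x0 \<delta> \<subseteq> S" using \<delta> U(2) by auto
    fix c :: "real \<Rightarrow> 'b" and c' t0
    assume c: "(c has_vector_derivative c') (at t0)" and ev: "\<forall>\<^sub>F t in nhds t0. c t \<in> E ` cball x0 \<delta>"
    have H_eq_c: "H (\<sigma> (R y)) = y \<and> \<sigma> (R y) \<in> V" if "y \<in> E ` cball x0 \<delta>" for y
      using that E_eq(1)[symmetric] E_eq(2) by (elim imageE) simp
    have c0: "c t0 = H (\<sigma> (R (c t0)))" "\<sigma> (R (c t0)) \<in> V"
      using H_eq_c[OF eventually_nhds_x_imp_x[OF ev]] by simp_all
    \<comment> \<open>Differentiating \<open>c = H \<circ> \<sigma> \<circ> R \<circ> c\<close> near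
      \<open>t0\<close> exhibits \<open>c'\<close> as a value of \<open>H' ?y\<close>, without
      lifting the curve to the source.\<close>
    let ?y = "\<sigma> (R (c t0))"
    have "((\<lambda>t. \<sigma> (R (c t))) has_vector_derivative R c') (at t0)"
      unfolding \<sigma>_def
      by (auto intro!: derivative_eq_intros bounded_linear.has_vector_derivative[OF blinfun.bounded_linear_right] c)
    then have "((\<lambda>t. \<sigma> (R (c t))) has_derivative (\<lambda>h. h *\<^sub>R R c')) (at t0)"
      by (simp add: has_vector_derivative_def)
    from has_derivative_compose[OF this derH[OF c0(2)]]
    have "((\<lambda>t. H (\<sigma> (R (c t)))) has_derivative (\<lambda>h. H' ?y (h *\<^sub>R R c'))) (at t0)" .
    moreover have "\<forall>\<^sub>F t in nhds t0. H (\<sigma> (R (c t))) = c t"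
      using ev by eventually_elim (use H_eq_c in simp)
    then have "\<forall>\<^sub>F t in at t0. H (\<sigma> (R (c t))) = c t"
      by (simp add: eventually_nhds_conv_at)
    ultimately have "(c has_derivative (\<lambda>h. H' ?y (h *\<^sub>R R c'))) (at t0)"
      by (rule has_derivative_transform_eventually) (simp_all add: c0(1)[symmetric])
    then have "(\<lambda>h. H' ?y (h *\<^sub>R R c')) = (\<lambda>h. h *\<^sub>R c')"
      using c unfolding has_vector_derivative_def by (rule has_derivative_unique)
    from fun_cong[OF this, of 1] have "H' ?y (R c') = c'" by simp
    then have "c' \<in> range (H' ?y)" by (rule range_eqI[OF sym])
    then have "c' \<in> range (E' (\<Psi> ?y))" unfolding rangeH'[OF c0(2)] .
    moreover have "\<Psi> ?y \<in> S" using \<Psi>U[OF c0(2)] U(2) by (rule rev_subsetD)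
    moreover have "c t0 = E (\<Psi> ?y)" by (rule c0(1)[unfolded H_def])
    ultimately show "\<exists>x\<in>S. c t0 = E x \<and> c' \<in> range (E' x)" by (intro bexI conjI)
  qed
qed

subsection \<open>Derivatives in charts\<close>

text \<open>A composite of maps between manifolds is smooth piecewise, with one open piece for each
  intermediate chart; this glues the pieces.\<close>

lemma Ck_on_local:
  assumes "\<And>x. x \<in> S \<Longrightarrow> \<exists>U. open U \<and> x \<in> U \<and> Ck_on k U f"
  shows "Ck_on k S f"
  using assms
proof (induction k arbitrary: f)
  case 0
  show ?case unfolding Ck_on.simps
  proof (rule continuous_at_imp_continuous_on, rule ballI)
    fix x assume "x \<in> S"
    then obtain U where "open U" "x \<in> U" "continuous_on U f" using 0 by force
    then show "isCont f x" by (simp add: continuous_on_eq_continuous_at)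
  qed
next
  case (Suc k)
  have "f differentiable at x" if "x \<in> S" for x using Suc.prems[OF that] by auto
  moreover have "Ck_on k S (\<lambda>x. frechet_derivative f (at x) v)" for v
  proof (rule Suc.IH)
    fix x assume "x \<in> S"
    then show "\<exists>U. open U \<and> x \<in> U \<and> Ck_on k U (\<lambda>x. frechet_derivative f (at x) v)"
      using Suc.prems by (metis Ck_on.simps(2))
  qed
  ultimately show ?case by simp
qed

lemma smooth_on_local:
  assumes "open S" "\<And>x. x \<in> S \<Longrightarrow> \<exists>U. x \<in> U \<and> smooth_on U f"
  shows "smooth_on S f"
  unfolding smooth_on_def
proof (intro conjI allI)
  show "Ck_on k S f" for k
    by (rule Ck_on_local) (use assms(2) smooth_on_def in metis)
qed (rule assms(1))

lemma chart_subset: "is_chart X c \<Longrightarrow> fst c \<subseteq> topspace X"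
  by (simp add: is_chart_def openin_subset)

lemma chart_inj_on: "is_chart X c \<Longrightarrow> inj_on (snd c) (fst c)"
  unfolding is_chart_def
  by (metis homeomorphic_imp_injective_map openin_subset topspace_subtopology_subset)

lemma chart_inv_left [simp]: "inj_on (snd c) (fst c) \<Longrightarrow> p \<in> fst c \<Longrightarrow> chart_inv c (snd c p) = p"
  by (simp add: chart_inv_def)

lemma chart_inv_in: "x \<in> snd c ` fst c \<Longrightarrow> chart_inv c x \<in> fst c"
  by (simp add: chart_inv_def inv_into_into)

lemma chart_inv_right: "x \<in> snd c ` fst c \<Longrightarrow> snd c (chart_inv c x) = x"
  by (simp add: chart_inv_def f_inv_into_f)

lemma chart_continuous: "is_chart X c \<Longrightarrow> continuous_map (subtopology X (fst c)) euclidean (snd c)"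
  unfolding is_chart_def by (metis continuous_map_into_fulltopology homeomorphic_imp_continuous_map)

lemma chart_inv_continuous:
  assumes "is_chart X c"
  shows "continuous_map (top_of_set (snd c ` fst c)) X (chart_inv c)"
proof -
  have top: "topspace (subtopology X (fst c)) = fst c"
    using chart_subset[OF assms] by auto
  obtain g where g: "homeomorphic_maps (subtopology X (fst c)) (top_of_set (snd c ` fst c)) (snd c) g"
    using assms unfolding is_chart_def homeomorphic_map_maps by blast
  then have "continuous_map (top_of_set (snd c ` fst c)) X g"
    by (auto simp: homeomorphic_maps_def intro: continuous_map_into_fulltopology)
  moreover have "g x = chart_inv c x" if "x \<in> snd c ` fst c" for x
    using that g chart_inj_on[OF assms] top by (auto simp: homeomorphic_maps_def)
  ultimately show ?thesis by (auto intro: continuous_map_eq)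
qed

lemma chart_inv_id [simp]: "chart_inv (UNIV, id) = id"
  by (simp add: chart_inv_def)

text \<open>The counterpart of \<open>tangent_map\<close> in a free pair of charts. Continuity along
  a curve and constancy of rank make sense only in charts that stay fixed while the point
  moves.\<close>

definition chart_deriv ::
  "('a, 'e::euclidean_space) chart \<Rightarrow> ('b, 'f::euclidean_space) chart \<Rightarrow> ('a \<Rightarrow> 'b) \<Rightarrow> 'a \<Rightarrow> 'e \<Rightarrow> 'f"
  where "chart_deriv c d h p = frechet_derivative (snd d \<circ> h \<circ> chart_inv c) (at (snd c p))"

lemma chart_deriv_unique:
  "((snd d \<circ> h \<circ> chart_inv c) has_derivative h') (at (snd c p)) \<Longrightarrow> chart_deriv c d h p = h'"
  unfolding chart_deriv_def by (metis frechet_derivative_at)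

lemma smooth_map_open_image:
  assumes "smooth_map X A Y B h" "c \<in> A" "d \<in> B"
  shows "open (snd c ` {x \<in> fst c. h x \<in> fst d})"
  using assms by (auto simp: smooth_map_def smooth_on_def)

lemma smooth_map_has_derivative:
  assumes "smooth_map X A Y B h" "c \<in> A" "d \<in> B" "p \<in> fst c" "h p \<in> fst d"
  shows "((snd d \<circ> h \<circ> chart_inv c) has_derivative chart_deriv c d h p) (at (snd c p))"
  unfolding chart_deriv_def
  by (rule smooth_on_has_derivative[of "snd c ` {x \<in> fst c. h x \<in> fst d}"])
     (use assms in \<open>auto simp: smooth_map_def\<close>)

lemma smooth_map_bounded_linear:
  assumes "smooth_map X A Y B h" "c \<in> A" "d \<in> B" "p \<in> fst c" "h p \<in> fst d"
  shows "bounded_linear (chart_deriv c d h p)"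
  using smooth_map_has_derivative[OF assms] by (rule has_derivative_bounded_linear)

text \<open>The map \<open>m\<close> has to agree with \<open>k \<circ> h\<close> only pointwise on
  the chart domain, so terms such as \<open>\<lambda>g. g (h p)\<close> can be used without being
  rewritten as compositions.\<close>

lemma chart_deriv_compose:
  assumes inj: "inj_on (snd c) (fst c)" "inj_on (snd d) (fst d)"
    and h: "smooth_map X A Y B h" "c \<in> A" "d \<in> B" "p \<in> fst c" "h p \<in> fst d"
    and k: "smooth_map Y B Z C k" "e \<in> C" "k (h p) \<in> fst e"
    and m: "\<And>x. x \<in> fst c \<Longrightarrow> m x = k (h x)"
  shows "chart_deriv c e m p = (\<lambda>v. chart_deriv d e k (h p) (chart_deriv c d h p v))"
proof (rule chart_deriv_unique)
  let ?N = "snd c ` {x \<in> fst c. h x \<in> fst d}"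
  let ?h = "snd d \<circ> h \<circ> chart_inv c" and ?k = "snd e \<circ> k \<circ> chart_inv d"
  have "?h (snd c p) = snd d (h p)" using inj h by simp
  then have "((\<lambda>x. ?k (?h x)) has_derivative (\<lambda>v. chart_deriv d e k (h p) (chart_deriv c d h p v))) (at (snd c p))"
    using has_derivative_compose[OF smooth_map_has_derivative[OF h]] smooth_map_has_derivative[OF k(1) h(3) k(2) h(5) k(3)]
    by metis
  then show "((snd e \<circ> m \<circ> chart_inv c) has_derivative
      (\<lambda>v. chart_deriv d e k (h p) (chart_deriv c d h p v))) (at (snd c p))"
  proof (rule has_derivative_transform_within_open)
    show "open ?N" by (rule smooth_map_open_image[OF h(1-3)])
    show "snd c p \<in> ?N" using h by auto
    show "?k (?h x) = (snd e \<circ> m \<circ> chart_inv c) x" if "x \<in> ?N" for x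
      using that inj m by auto
  qed
qed

lemma chart_deriv_id:
  assumes "is_chart X c" "p \<in> fst c"
  shows "chart_deriv c c (\<lambda>x. x) p v = v"
proof -
  have "chart_deriv c c (\<lambda>x. x) p = (\<lambda>v. v)"
  proof (rule chart_deriv_unique, rule has_derivative_transform_within_open[where f = "\<lambda>x. x"])
    show "open (snd c ` fst c)" using assms(1) by (simp add: is_chart_def)
  qed (use assms in \<open>auto simp: chart_inv_right\<close>)
  then show ?thesis by simp
qed

lemma smooth_manifold_is_chart: "smooth_manifold X A \<Longrightarrow> c \<in> A \<Longrightarrow> is_chart X c"
  by (simp add: smooth_manifold_def)

lemma smooth_manifold_inj_on: "smooth_manifold X A \<Longrightarrow> c \<in> A \<Longrightarrow> inj_on (snd c) (fst c)"
  using chart_inj_on smooth_manifold_is_chart by blast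

lemma smooth_manifold_open: "smooth_manifold X A \<Longrightarrow> c \<in> A \<Longrightarrow> open (snd c ` fst c)"
  using smooth_manifold_is_chart unfolding is_chart_def by blast

lemma smooth_manifold_subset: "smooth_manifold X A \<Longrightarrow> c \<in> A \<Longrightarrow> x \<in> fst c \<Longrightarrow> x \<in> topspace X"
  using chart_subset smooth_manifold_is_chart by blast

lemma smooth_manifold_chart:
  assumes "smooth_manifold X A" "x \<in> topspace X"
  obtains c where "c \<in> A" "x \<in> fst c"
  using assms unfolding smooth_manifold_def by blast

lemma chart_at:
  assumes "c \<in> A" "x \<in> fst c"
  shows "chart_at A x \<in> A" "x \<in> fst (chart_at A x)"
  using someI[of "\<lambda>c. c \<in> A \<and> x \<in> fst c" c] assms by (auto simp: chart_at_def)

lemma smooth_map_id: "smooth_manifold X A \<Longrightarrow> smooth_map X A X A (\<lambda>x. x)"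
  unfolding smooth_map_def smooth_manifold_def by (auto simp: o_def Int_def)

lemma smooth_map_const:
  assumes "smooth_manifold X A" "y \<in> topspace Y"
  shows "smooth_map X A Y B (\<lambda>x. y)"
proof -
  have "smooth_on (snd c ` {x \<in> fst c. y \<in> fst d}) (\<lambda>x. snd d y)" if "c \<in> A" "d \<in> B" for c d
    using smooth_manifold_open[OF assms(1) that(1)] by (cases "y \<in> fst d") (auto intro!: smooth_on_const)
  then show ?thesis using assms(2) by (auto simp: smooth_map_def o_def)
qed

text \<open>The middle space is often a product, for which only injectivity of the charts and the
  covering property are established; these are the hypotheses made on it.\<close>

lemma smooth_map_compose:
  assumes X: "smooth_manifold X A" and injY: "\<And>d. d \<in> B \<Longrightarrow> inj_on (snd d) (fst d)"
    and Y: "topspace Y \<subseteq> (\<Union>d\<in>B. fst d)"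
    and h: "smooth_map X A Y B h" and k: "smooth_map Y B Z C k"
  shows "smooth_map X A Z C (\<lambda>x. k (h x))"
  unfolding smooth_map_def
proof (intro conjI ballI)
  show cont: "continuous_map X Z (\<lambda>x. k (h x))"
    using continuous_map_compose[of X Y h Z k] h k by (simp add: smooth_map_def o_def)
  fix c e assume c: "c \<in> A" and e: "e \<in> C"
  \<comment> \<open>The part of the domain that \<open>h\<close> sends into the chart
    \<open>d\<close>. Each part is open, and together they give the whole domain in
    coordinates.\<close>
  let ?U = "\<lambda>d. snd c ` {x \<in> fst c. h x \<in> fst d \<and> k (h x) \<in> fst e}"
  let ?m = "snd e \<circ> (\<lambda>x. k (h x)) \<circ> chart_inv c"
  have *: "smooth_on (?U d) ?m" if d: "d \<in> B" for d
  proof -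
    let ?V = "snd d ` {y \<in> fst d. k y \<in> fst e}" and ?h = "snd d \<circ> h \<circ> chart_inv c"
    note inj = smooth_manifold_inj_on[OF X c] injY[OF d]
    have sh: "smooth_on (snd c ` {x \<in> fst c. h x \<in> fst d}) ?h"
      using h c d by (auto simp: smooth_map_def)
    have sk: "smooth_on ?V (snd e \<circ> k \<circ> chart_inv d)"
      using k d e by (auto simp: smooth_map_def)
    have "?U d = snd c ` {x \<in> fst c. h x \<in> fst d} \<inter> ?h -` ?V"
    proof (intro equalityI subsetI)
      fix x assume "x \<in> snd c ` {x \<in> fst c. h x \<in> fst d} \<inter> ?h -` ?V"
      then obtain p y where p: "x = snd c p" "p \<in> fst c" "h p \<in> fst d"
        and y: "snd d (h p) = snd d y" "y \<in> fst d" "k y \<in> fst e"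
        using inj by auto
      then have "h p = y" using inj_onD[OF inj(2)] by blast
      then show "x \<in> ?U d" using p y by auto
    qed (use inj in auto)
    moreover have "open (snd c ` {x \<in> fst c. h x \<in> fst d} \<inter> ?h -` ?V)"
    proof (rule continuous_open_preimage)
      show "continuous_on (snd c ` {x \<in> fst c. h x \<in> fst d}) ?h"
        using sh unfolding smooth_on_def by (metis Ck_on.simps(1))
    qed (use sh sk in \<open>auto simp: smooth_on_def\<close>)
    ultimately have op: "open (?U d)" by simp
    have "smooth_on (?U d) (\<lambda>x. (snd e \<circ> k \<circ> chart_inv d) (?h x))"
      by (rule smooth_on_compose[OF smooth_on_subset[OF sh op] sk]) (use inj in auto)
    then show ?thesis by (rule smooth_on_cong) (use inj in auto)
  qed
  have cov: "\<exists>d\<in>B. h x \<in> fst d" if "x \<in> fst c" for x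
  proof -
    have "h x \<in> topspace Y"
      using h smooth_manifold_subset[OF X c that] unfolding smooth_map_def continuous_map_def by blast
    then show ?thesis using Y by blast
  qed
  have eq: "snd c ` {x \<in> fst c. k (h x) \<in> fst e} = (\<Union>d\<in>B. ?U d)"
  proof (intro equalityI subsetI)
    fix x assume "x \<in> snd c ` {x \<in> fst c. k (h x) \<in> fst e}"
    then obtain p where p: "x = snd c p" "p \<in> fst c" "k (h p) \<in> fst e" by auto
    obtain d where d: "d \<in> B" "h p \<in> fst d" using cov[OF p(2)] by blast
    have "p \<in> {x \<in> fst c. h x \<in> fst d \<and> k (h x) \<in> fst e}" using p d by simp
    then have "x \<in> ?U d" unfolding p(1) by (rule imageI)
    then show "x \<in> (\<Union>d\<in>B. ?U d)" by (rule UN_I[OF d(1)])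
  qed auto
  show "smooth_on (snd c ` {x \<in> fst c. k (h x) \<in> fst e}) ?m"
    unfolding eq
  proof (rule smooth_on_local)
    have op: "open (?U d)" if "d \<in> B" for d using *[OF that] unfolding smooth_on_def by (rule conjunct1)
    show "open (\<Union>d\<in>B. ?U d)" by (intro open_UN ballI op)
    fix x assume "x \<in> (\<Union>d\<in>B. ?U d)"
    then obtain d where "d \<in> B" "x \<in> ?U d" by (rule UN_E)
    with * show "\<exists>U. x \<in> U \<and> smooth_on U ?m" by (intro exI conjI)
  qed
qed

section \<open>Products of charts and partial derivatives\<close>

definition prod_chart :: "('a, 'e) chart \<Rightarrow> ('b, 'f) chart \<Rightarrow> ('a \<times> 'b, 'e \<times> 'f) chart" where
  "prod_chart c d = (fst c \<times> fst d, map_prod (snd c) (snd d))"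

lemma prod_chart_simps [simp]:
  "fst (prod_chart c d) = fst c \<times> fst d" "snd (prod_chart c d) (x, y) = (snd c x, snd d y)"
  by (simp_all add: prod_chart_def)

lemma prod_atlas_iff: "e \<in> prod_atlas A B \<longleftrightarrow> (\<exists>c\<in>A. \<exists>d\<in>B. e = prod_chart c d)"
  by (force simp: prod_atlas_def prod_chart_def)

lemma prod_chart_inj_on:
  "inj_on (snd c) (fst c) \<Longrightarrow> inj_on (snd d) (fst d) \<Longrightarrow> inj_on (snd (prod_chart c d)) (fst (prod_chart c d))"
  by (simp add: prod_chart_def map_prod_inj_on)

lemma chart_inv_prod_chart:
  assumes "inj_on (snd c) (fst c)" "inj_on (snd d) (fst d)" "x \<in> snd c ` fst c" "y \<in> snd d ` fst d"
  shows "chart_inv (prod_chart c d) (x, y) = (chart_inv c x, chart_inv d y)"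
proof -
  obtain p q where "x = snd c p" "y = snd d q" "p \<in> fst c" "q \<in> fst d" using assms by auto
  then show ?thesis
    using chart_inv_left[OF prod_chart_inj_on[OF assms(1,2)], of "(p, q)"] assms by simp
qed

lemma smooth_map_Pair:
  assumes h: "smooth_map X A Y B h" and k: "smooth_map X A Z C k"
    and inj: "\<And>c. c \<in> A \<Longrightarrow> inj_on (snd c) (fst c)"
  shows "smooth_map X A (prod_topology Y Z) (prod_atlas B C) (\<lambda>x. (h x, k x))"
  unfolding smooth_map_def
proof (intro conjI ballI)
  show "continuous_map X (prod_topology Y Z) (\<lambda>x. (h x, k x))"
    using h k by (simp add: smooth_map_def continuous_map_pairedI)
  fix c e assume c: "c \<in> A" and "e \<in> prod_atlas B C"
  then obtain d d' where d: "d \<in> B" "d' \<in> C" and e: "e = prod_chart d d'"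
    by (auto simp: prod_atlas_iff)
  let ?H = "snd c ` {x \<in> fst c. h x \<in> fst d}" and ?K = "snd c ` {x \<in> fst c. k x \<in> fst d'}"
  have s: "smooth_on ?H (snd d \<circ> h \<circ> chart_inv c)" "smooth_on ?K (snd d' \<circ> k \<circ> chart_inv c)"
    using h k c d by (auto simp: smooth_map_def)
  have eq: "snd c ` {x \<in> fst c. (h x, k x) \<in> fst e} = ?H \<inter> ?K"
    using inj_onD[OF inj[OF c]] by (auto simp: e)
  have op: "open (?H \<inter> ?K)" using s by (auto simp: smooth_on_def)
  have "smooth_on (?H \<inter> ?K) (\<lambda>x. ((snd d \<circ> h \<circ> chart_inv c) x, (snd d' \<circ> k \<circ> chart_inv c) x))"
    by (intro smooth_on_Pair smooth_on_subset[OF s(1) op] smooth_on_subset[OF s(2) op]) auto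
  then show "smooth_on (snd c ` {x \<in> fst c. (h x, k x) \<in> fst e}) (snd e \<circ> (\<lambda>x. (h x, k x)) \<circ> chart_inv c)"
    unfolding eq by (rule smooth_on_cong) (simp add: e)
qed

lemma chart_deriv_Pair:
  assumes "smooth_map X A Y B h" "smooth_map X A Z C k"
    and "c \<in> A" "d \<in> B" "e \<in> C" "p \<in> fst c" "h p \<in> fst d" "k p \<in> fst e"
  shows "chart_deriv c (prod_chart d e) (\<lambda>x. (h x, k x)) p = (\<lambda>v. (chart_deriv c d h p v, chart_deriv c e k p v))"
  by (rule chart_deriv_unique)
     (use has_derivative_Pair[OF smooth_map_has_derivative[OF assms(1,3,4,6,7)]
          smooth_map_has_derivative[OF assms(2,3,5,6,8)]] in \<open>simp add: o_def\<close>)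

lemma chart_deriv_const: "chart_deriv c d (\<lambda>x. y) p v = 0"
proof -
  have "chart_deriv c d (\<lambda>x. y) p = (\<lambda>v. 0)"
    by (rule chart_deriv_unique) (simp add: o_def)
  then show ?thesis by simp
qed

lemma prod_atlas_inj_on:
  assumes "smooth_manifold X A" "smooth_manifold Y B" "d \<in> prod_atlas A B"
  shows "inj_on (snd d) (fst d)"
proof -
  obtain c e where "c \<in> A" "e \<in> B" "d = prod_chart c e" using assms(3) by (auto simp: prod_atlas_iff)
  then show ?thesis
    using prod_chart_inj_on[OF smooth_manifold_inj_on[OF assms(1)] smooth_manifold_inj_on[OF assms(2)]] by blast
qed

lemma prod_atlas_cover:
  assumes "smooth_manifold X A" "smooth_manifold Y B"
  shows "topspace (prod_topology X Y) \<subseteq> (\<Union>d\<in>prod_atlas A B. fst d)"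
proof clarify
  fix x y assume xy: "(x, y) \<in> topspace (prod_topology X Y)"
  obtain c where c: "c \<in> A" "x \<in> fst c" using xy smooth_manifold_chart[OF assms(1), of x] by auto
  obtain d where d: "d \<in> B" "y \<in> fst d" using xy smooth_manifold_chart[OF assms(2), of y] by auto
  have "prod_chart c d \<in> prod_atlas A B" unfolding prod_atlas_iff using c d by blast
  then show "(x, y) \<in> (\<Union>d\<in>prod_atlas A B. fst d)"
    by (rule UN_I) (use c d in simp)
qed

lemma smooth_map_partial:
  assumes X: "smooth_manifold X A" and Y: "smooth_manifold Y B"
    and H: "smooth_map (prod_topology X Y) (prod_atlas A B) Z C H"
  shows "x \<in> topspace X \<Longrightarrow> smooth_map Y B Z C (\<lambda>y. H (x, y))"
    and "y \<in> topspace Y \<Longrightarrow> smooth_map X A Z C (\<lambda>x. H (x, y))"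
proof -
  note prod = prod_atlas_inj_on[OF X Y] prod_atlas_cover[OF X Y]
  show "smooth_map Y B Z C (\<lambda>y. H (x, y))" if "x \<in> topspace X"
    by (rule smooth_map_compose[OF Y prod smooth_map_Pair[OF smooth_map_const[OF Y that] smooth_map_id[OF Y]
      smooth_manifold_inj_on[OF Y]] H])
  show "smooth_map X A Z C (\<lambda>x. H (x, y))" if "y \<in> topspace Y"
    by (rule smooth_map_compose[OF X prod smooth_map_Pair[OF smooth_map_id[OF X] smooth_map_const[OF X that]
      smooth_manifold_inj_on[OF X]] H])
qed

text \<open>A slice of \<open>H\<close> is its composite with an inclusion of a factor, whose
  derivative is \<open>w \<mapsto> (0, w)\<close> or \<open>u \<mapsto> (u, 0)\<close>; the sum
  formula is linearity of the total derivative.\<close>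

lemma chart_deriv_partial:
  assumes X: "smooth_manifold X A" and Y: "smooth_manifold Y B"
    and H: "smooth_map (prod_topology X Y) (prod_atlas A B) Z C H"
    and c: "c \<in> A" "x \<in> fst c" and d: "d \<in> B" "y \<in> fst d" and e: "e \<in> C" "H (x, y) \<in> fst e"
  shows "chart_deriv d e (\<lambda>y. H (x, y)) y w = chart_deriv (prod_chart c d) e H (x, y) (0, w)"
    and "chart_deriv c e (\<lambda>x. H (x, y)) x u = chart_deriv (prod_chart c d) e H (x, y) (u, 0)"
    and "chart_deriv (prod_chart c d) e H (x, y) (u, w) =
      chart_deriv c e (\<lambda>x. H (x, y)) x u + chart_deriv d e (\<lambda>y. H (x, y)) y w"
proof -
  note injc = smooth_manifold_inj_on[OF X c(1)] and injd = smooth_manifold_inj_on[OF Y d(1)]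
  have cd: "prod_chart c d \<in> prod_atlas A B" using c d by (auto simp: prod_atlas_iff)
  have xy: "(x, y) \<in> fst (prod_chart c d)" using c d by simp
  note sX = smooth_map_id[OF X] smooth_map_const[OF X smooth_manifold_subset[OF Y d]]
  note sY = smooth_map_const[OF Y smooth_manifold_subset[OF X c]] smooth_map_id[OF Y]
  show 1: "chart_deriv d e (\<lambda>y. H (x, y)) y w = chart_deriv (prod_chart c d) e H (x, y) (0, w)" for w
    by (subst chart_deriv_compose[OF injd prod_chart_inj_on[OF injc injd]
          smooth_map_Pair[OF sY smooth_manifold_inj_on[OF Y]] d(1) cd d(2) xy H e refl])
       (simp_all add: chart_deriv_Pair[OF sY d(1) c(1) d(1) d(2) c(2) d(2)] chart_deriv_const
          chart_deriv_id[OF smooth_manifold_is_chart[OF Y d(1)] d(2)])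
  show 2: "chart_deriv c e (\<lambda>x. H (x, y)) x u = chart_deriv (prod_chart c d) e H (x, y) (u, 0)" for u
    by (subst chart_deriv_compose[OF injc prod_chart_inj_on[OF injc injd]
          smooth_map_Pair[OF sX smooth_manifold_inj_on[OF X]] c(1) cd c(2) xy H e refl])
       (simp_all add: chart_deriv_Pair[OF sX c(1) c(1) d(1) c(2) c(2) d(2)] chart_deriv_const
          chart_deriv_id[OF smooth_manifold_is_chart[OF X c(1)] c(2)])
  have "linear (chart_deriv (prod_chart c d) e H (x, y))"
    using smooth_map_bounded_linear[OF H cd e(1) xy e(2)] by (rule bounded_linear.linear)
  from linear_add[OF this, of "(u, 0)" "(0, w)"]
  show "chart_deriv (prod_chart c d) e H (x, y) (u, w) =
      chart_deriv c e (\<lambda>x. H (x, y)) x u + chart_deriv d e (\<lambda>y. H (x, y)) y w"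
    by (simp add: 1 2)
qed

lemma chart_deriv_inverse:
  assumes X: "smooth_manifold X A" and Y: "smooth_manifold Y B"
    and h: "smooth_map X A Y B h" and k: "smooth_map Y B X A k"
    and inv: "\<And>y. y \<in> topspace Y \<Longrightarrow> h (k y) = y"
    and c: "c \<in> A" "k y \<in> fst c" and d: "d \<in> B" "y \<in> fst d"
  shows "chart_deriv c d h (k y) (chart_deriv d c k y v) = v"
proof -
  have hk: "h (k y) \<in> fst d" using inv[OF smooth_manifold_subset[OF Y d]] d(2) by simp
  have "chart_deriv d d (\<lambda>y. y) y = (\<lambda>v. chart_deriv c d h (k y) (chart_deriv d c k y v))"
    by (rule chart_deriv_compose[OF smooth_manifold_inj_on[OF Y d(1)] smooth_manifold_inj_on[OF X c(1)]
          k d(1) c(1) d(2) c(2) h d(1) hk])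
       (use inv smooth_manifold_subset[OF Y d(1)] in auto)
  from fun_cong[OF this, of v] show ?thesis
    using chart_deriv_id[OF smooth_manifold_is_chart[OF Y d(1)] d(2)] by simp
qed

lemma prod_chart_image: "snd (prod_chart c d) ` (S \<times> T) = snd c ` S \<times> snd d ` T"
  by (force simp: prod_chart_def)

lemma smooth_map_comp_fst:
  assumes X: "smooth_manifold X A" and Y: "smooth_manifold Y B" and f: "smooth_map X A Z C f"
  shows "smooth_map (prod_topology X Y) (prod_atlas A B) Z C (\<lambda>x. f (fst x))"
  unfolding smooth_map_def
proof (intro conjI ballI)
  show "continuous_map (prod_topology X Y) Z (\<lambda>x. f (fst x))"
    using continuous_map_compose[OF continuous_map_fst[of X Y], of Z f] f
    by (simp add: smooth_map_def o_def)
  fix e c' assume "e \<in> prod_atlas A B" and c': "c' \<in> C"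
  then obtain c d where c: "c \<in> A" and d: "d \<in> B" and e: "e = prod_chart c d"
    by (auto simp: prod_atlas_iff)
  note inj = smooth_manifold_inj_on[OF X c] smooth_manifold_inj_on[OF Y d]
  let ?S = "snd c ` {x \<in> fst c. f x \<in> fst c'}"
  have s: "smooth_on ?S (snd c' \<circ> f \<circ> chart_inv c)" using f c c' by (auto simp: smooth_map_def)
  have "{x \<in> fst e. f (fst x) \<in> fst c'} = {x \<in> fst c. f x \<in> fst c'} \<times> fst d" by (auto simp: e)
  then have eq: "snd e ` {x \<in> fst e. f (fst x) \<in> fst c'} = ?S \<times> snd d ` fst d"
    using prod_chart_image[of c d "{x \<in> fst c. f x \<in> fst c'}" "fst d"] by (simp add: e)
  have op: "open (?S \<times> snd d ` fst d)"
    using s smooth_manifold_open[OF Y d] by (intro open_Times) (auto simp: smooth_on_def)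
  have "smooth_on (?S \<times> snd d ` fst d) fst"
    unfolding smooth_on_def using op Ck_on_linear[OF bounded_linear_fst op Ck_on_id[OF op]] by simp
  then have "smooth_on (?S \<times> snd d ` fst d) (\<lambda>x. (snd c' \<circ> f \<circ> chart_inv c) (fst x))"
    by (rule smooth_on_compose[OF _ s]) auto
  then show "smooth_on (snd e ` {x \<in> fst e. f (fst x) \<in> fst c'}) (snd c' \<circ> (\<lambda>x. f (fst x)) \<circ> chart_inv e)"
    unfolding eq by (rule smooth_on_cong) (auto simp: e chart_inv_prod_chart inj)
qed

text \<open>\<open>submanifold_tangent\<close> uses curves over all real times. Test curves are
  therefore built from a map \<open>s\<close> defined everywhere whose values remain in one chart
  image.\<close>

lemma smooth_map_chart_inv:
  fixes s :: "'e::euclidean_space \<Rightarrow> 'f::euclidean_space"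
  assumes X: "smooth_manifold X A" and d: "d \<in> A"
    and s: "smooth_on UNIV s" "range s \<subseteq> snd d ` fst d"
  shows "smooth_map euclidean euclidean_atlas X A (\<lambda>t. chart_inv d (s t))"
  unfolding smooth_map_def
proof (intro conjI ballI)
  have cont: "continuous_on UNIV s" using s(1) unfolding smooth_on_def by (metis Ck_on.simps(1))
  then have "continuous_map euclidean (top_of_set (snd d ` fst d)) s"
    using s(2) by (simp add: continuous_map_in_subtopology image_subset_iff_funcset)
  from continuous_map_compose[OF this chart_inv_continuous[OF smooth_manifold_is_chart[OF X d]]]
  show "continuous_map euclidean X (\<lambda>t. chart_inv d (s t))" by (simp add: o_def)
  fix c :: "('e, 'e) chart" and e assume "c \<in> euclidean_atlas" and e: "e \<in> A"
  then have c: "c = (UNIV, id)" by (simp add: euclidean_atlas_def)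
  let ?S = "snd d ` (fst d \<inter> fst e)"
  have se: "smooth_on ?S (snd e \<circ> chart_inv d)" using X d e by (auto simp: smooth_manifold_def)
  have "snd c ` {x \<in> fst c. chart_inv d (s x) \<in> fst e} = s -` ?S"
  proof -
    have "chart_inv d y \<in> fst e \<longleftrightarrow> y \<in> ?S" if "y \<in> snd d ` fst d" for y
      using that smooth_manifold_inj_on[OF X d] inj_onD[OF smooth_manifold_inj_on[OF X d]] by fastforce
    moreover have "s t \<in> snd d ` fst d" for t using s(2) by auto
    ultimately show ?thesis by (simp add: c vimage_def)
  qed
  moreover have op: "open (s -` ?S)"
    using cont se by (intro open_vimage) (auto simp: smooth_on_def)
  moreover have "smooth_on (s -` ?S) (\<lambda>t. (snd e \<circ> chart_inv d) (s t))"
    by (rule smooth_on_compose[OF smooth_on_subset[OF s(1) op] se]) auto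
  ultimately show "smooth_on (snd c ` {x \<in> fst c. chart_inv d (s x) \<in> fst e})
      (snd e \<circ> (\<lambda>t. chart_inv d (s t)) \<circ> chart_inv c)"
    by (simp add: c o_def)
qed

subsection \<open>Tangent maps and integral curves\<close>

lemma tangent_map_apply:
  assumes "smooth_map X A Y B h" "c \<in> A" "p \<in> fst c" "d \<in> B" "h p \<in> fst d"
  shows "blinfun_apply (tangent_map A B h p) = chart_deriv (chart_at A p) (chart_at B (h p)) h p"
  unfolding tangent_map_def chart_deriv_def[symmetric]
  by (intro bounded_linear_Blinfun_apply smooth_map_bounded_linear[OF assms(1)] chart_at[OF assms(2,3)] chart_at[OF assms(4,5)])

lemma chart_at_euclidean_atlas: "chart_at euclidean_atlas t = (UNIV, id)"
  unfolding chart_at_def euclidean_atlas_def by (rule some_equality) auto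

lemma euclidean_chart_simps [simp]: "(UNIV, id) \<in> euclidean_atlas" "inj_on (snd (UNIV, id)) (fst (UNIV, id))"
  by (simp_all add: euclidean_atlas_def)

lemma velocity_eq:
  assumes "smooth_map euclidean euclidean_atlas X A \<gamma>" "d \<in> A" "\<gamma> t \<in> fst d"
  shows "velocity A \<gamma> t = chart_deriv (UNIV, id) (chart_at A (\<gamma> t)) \<gamma> t 1"
  unfolding velocity_def
  by (subst tangent_map_apply[OF assms(1) euclidean_chart_simps(1) _ assms(2,3)])
     (simp_all add: chart_at_euclidean_atlas)

lemma smooth_curve_has_vector_derivative:
  assumes "smooth_map euclidean euclidean_atlas X A \<gamma>" "d \<in> A" "\<gamma> t \<in> fst d"
  shows "((\<lambda>s. snd d (\<gamma> s)) has_vector_derivative chart_deriv (UNIV, id) d \<gamma> t 1) (at t)"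
proof -
  have der: "((\<lambda>s. snd d (\<gamma> s)) has_derivative chart_deriv (UNIV, id) d \<gamma> t) (at t)"
    using smooth_map_has_derivative[OF assms(1) euclidean_chart_simps(1) assms(2) _ assms(3)] by (simp add: o_def)
  have "chart_deriv (UNIV, id) d \<gamma> t h = h *\<^sub>R chart_deriv (UNIV, id) d \<gamma> t 1" for h
    using linear_scale[OF has_derivative_linear[OF der], of h 1] by simp
  then show ?thesis using der unfolding has_vector_derivative_def by (metis (no_types, lifting) ext)
qed

text \<open>The derivative of the identity map between two charts is the Jacobian of the coordinate
  change.\<close>

lemma chart_deriv_change:
  assumes A: "smooth_manifold X A" and d: "d \<in> A" "d' \<in> A"
    and h: "smooth_map Y B X A h" "c \<in> B" "inj_on (snd c) (fst c)" "p \<in> fst c" "h p \<in> fst d" "h p \<in> fst d'"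
  shows "chart_deriv c d' h p v = chart_deriv d d' (\<lambda>x. x) (h p) (chart_deriv c d h p v)"
  by (simp add: chart_deriv_compose[OF h(3) smooth_manifold_inj_on[OF A d(1)] h(1,2) d(1) h(4,5) smooth_map_id[OF A] d(2) h(6)])

lemma chart_deriv_change_inverse:
  assumes A: "smooth_manifold X A" and d: "d \<in> A" "d' \<in> A" "p \<in> fst d" "p \<in> fst d'"
  shows "chart_deriv d d' (\<lambda>x. x) p (chart_deriv d' d (\<lambda>x. x) p v) = v"
  using chart_deriv_change[OF A d(1,2) smooth_map_id[OF A] d(2) smooth_manifold_inj_on[OF A d(2)] d(4) d(3) d(4)]
    chart_deriv_id[OF smooth_manifold_is_chart[OF A d(2)] d(4)] by simp

section \<open>Uniqueness of integral curves\<close>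

lemma ode_unique_local:
  fixes X :: "'a::euclidean_space \<Rightarrow> 'a"
  assumes X: "smooth_on S X" and x0: "x1 t0 \<in> S" "x1 t0 = x2 t0"
    and x1: "\<forall>\<^sub>F t in nhds t0. (x1 has_vector_derivative X (x1 t)) (at t)"
    and x2: "\<forall>\<^sub>F t in nhds t0. (x2 has_vector_derivative X (x2 t)) (at t)"
  shows "\<forall>\<^sub>F t in nhds t0. x1 t = x2 t"
proof -
  obtain X' where X': "\<And>x. x \<in> S \<Longrightarrow> (X has_derivative blinfun_apply (X' x)) (at x)" "continuous_on S X'"
    using smooth_on_continuous_derivative[OF X] by metis
  have "open S" using X by (simp add: smooth_on_def)
  define y0 where "y0 = x1 t0"
  \<comment> \<open>Exceeds the norm of \<open>X'\<close> at \<open>y0\<close> strictly, hence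
    bounds it nearby and is a Lipschitz constant of \<open>X\<close> on a small ball.\<close>
  define L where "L = norm (X' y0) + 1"
  have L: "L \<ge> 1" by (simp add: L_def)
  have "isCont X' y0" using X'(2) \<open>open S\<close> x0(1) by (simp add: continuous_on_eq_continuous_at y0_def)
  then have "\<forall>\<^sub>F y in nhds y0. norm (X' y) < L"
    unfolding continuous_at tendsto_at_iff_tendsto_nhds
    by (intro order_tendstoD(2)[OF tendsto_norm]) (auto simp: L_def)
  moreover have "\<forall>\<^sub>F y in nhds y0. y \<in> S"
    using \<open>open S\<close> x0(1) by (auto simp: y0_def eventually_nhds)
  ultimately have "\<forall>\<^sub>F y in nhds y0. norm (X' y) < L \<and> y \<in> S" by (rule eventually_conj)
  then obtain r0 where r0: "r0 > 0" "\<And>y. dist y y0 < r0 \<Longrightarrow> norm (X' y) < L \<and> y \<in> S"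
    unfolding eventually_nhds_metric by blast
  have Lip: "norm (X y - X z) \<le> L * norm (y - z)" if "y \<in> ball y0 r0" "z \<in> ball y0 r0" for y z
  proof (rule differentiable_bound[OF convex_ball _ _ that])
    fix w assume "w \<in> ball y0 r0"
    then have w: "norm (X' w) < L" "w \<in> S" using r0(2)[of w] by (auto simp: dist_commute)
    show "(X has_derivative X' w) (at w within ball y0 r0)"
      by (rule has_derivative_at_withinI[OF X'(1)[OF w(2)]])
    show "onorm (X' w) \<le> L" using w(1) by (simp add: norm_blinfun.rep_eq)
  qed
  have near: "\<forall>\<^sub>F t in nhds t0. x t \<in> ball y0 r0"
    if "x t0 = y0" "\<forall>\<^sub>F t in nhds t0. (x has_vector_derivative X (x t)) (at t)" for x
  proof -
    have "isCont x t0"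
      using eventually_nhds_x_imp_x[OF that(2)] has_vector_derivative_continuous by blast
    then have "(x \<longlongrightarrow> y0) (nhds t0)"
      unfolding continuous_at tendsto_at_iff_tendsto_nhds by (simp only: that(1))
    then show ?thesis using r0(1) by (auto simp: tendsto_iff dist_commute)
  qed
  have "\<forall>\<^sub>F t in nhds t0. (x1 t \<in> ball y0 r0 \<and> x2 t \<in> ball y0 r0) \<and>
      (x1 has_vector_derivative X (x1 t)) (at t) \<and> (x2 has_vector_derivative X (x2 t)) (at t)"
    by (intro eventually_conj near x1 x2) (use x0 in \<open>auto simp: y0_def\<close>)
  then obtain \<delta>0 where \<delta>0: "\<delta>0 > 0" "\<And>t. dist t t0 < \<delta>0 \<Longrightarrow>
      (x1 t \<in> ball y0 r0 \<and> x2 t \<in> ball y0 r0) \<and>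
      (x1 has_vector_derivative X (x1 t)) (at t) \<and> (x2 has_vector_derivative X (x2 t)) (at t)"
    unfolding eventually_nhds_metric by blast
  \<comment> \<open>Half of \<open>\<delta>0\<close> keeps the closed interval inside the open one;
    the other bound yields \<open>L * \<delta> \<le> 1 / 2\<close>.\<close>
  define \<delta> where "\<delta> = min (\<delta>0 / 2) (1 / (2 * L))"
  have \<delta>: "\<delta> > 0" "\<delta> < \<delta>0" "L * \<delta> \<le> 1 / 2"
    using \<delta>0(1) L by (auto simp: \<delta>_def min_def field_simps)
  define g where "g t = x1 t - x2 t" for t
  let ?I = "cball t0 \<delta>"
  have I: "(x1 t \<in> ball y0 r0 \<and> x2 t \<in> ball y0 r0) \<and>
      (x1 has_vector_derivative X (x1 t)) (at t) \<and> (x2 has_vector_derivative X (x2 t)) (at t)"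
    if "t \<in> ?I" for t using \<delta>0(2)[of t] that \<delta>(2) by (simp add: dist_commute)
  have dg: "(g has_vector_derivative X (x1 t) - X (x2 t)) (at t)" if "t \<in> ?I" for t
    unfolding g_def using I[OF that] by (intro has_vector_derivative_diff) auto
  have "continuous_on ?I (\<lambda>t. norm (g t))"
    using dg has_vector_derivative_continuous
    by (intro continuous_on_norm continuous_at_imp_continuous_on ballI) blast
  \<comment> \<open>Looking at the maximum of \<open>norm (g t)\<close> takes the place of
    Gronwall's inequality: the mean value estimate from \<open>t0\<close> to \<open>u\<close> bounds
    this maximum by half of itself.\<close>
  then obtain u where u: "u \<in> ?I" "\<And>t. t \<in> ?I \<Longrightarrow> norm (g t) \<le> norm (g u)"
    using continuous_attains_sup[of ?I "\<lambda>t. norm (g t)"] \<delta>(1) by force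
  have "norm (g u - g t0) \<le> (L * norm (g u)) * norm (u - t0)"
  proof (rule differentiable_bound[OF convex_cball _ _ u(1)])
    fix t assume t: "t \<in> ?I"
    show "(g has_derivative (\<lambda>h. h *\<^sub>R (X (x1 t) - X (x2 t)))) (at t within ?I)"
      using dg[OF t] unfolding has_vector_derivative_def by (rule has_derivative_at_withinI)
    have "norm (X (x1 t) - X (x2 t)) \<le> L * norm (g t)"
      unfolding g_def using I[OF t] by (intro Lip) auto
    also have "\<dots> \<le> L * norm (g u)" using u(2)[OF t] L by (intro mult_left_mono) auto
    finally have "norm (h *\<^sub>R (X (x1 t) - X (x2 t))) \<le> (L * norm (g u)) * norm h" for h :: real
      by (simp add: mult.commute mult_left_mono)
    then show "onorm (\<lambda>h. h *\<^sub>R (X (x1 t) - X (x2 t))) \<le> L * norm (g u)"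
      by (rule onorm_le)
  qed (use \<delta>(1) in auto)
  also have "\<dots> \<le> (L * norm (g u)) * \<delta>"
    using u(1) L by (intro mult_left_mono) (auto simp: dist_norm norm_minus_commute)
  also have "\<dots> = (L * \<delta>) * norm (g u)" by simp
  also have "\<dots> \<le> (1 / 2) * norm (g u)" using \<delta>(3) by (intro mult_right_mono) auto
  finally have "norm (g u) \<le> 0" using x0(2) by (simp add: g_def)
  then have "x1 t = x2 t" if "t \<in> ?I" for t using u(2)[OF that] by (simp add: g_def)
  then show ?thesis
    unfolding eventually_nhds_metric using \<delta>(1) by (metis dist_commute less_imp_le mem_cball)
qed

text \<open>The equation is posed in every chart around the point, with \<open>T\<close> carried
  over from the selected chart by the Jacobian; local ODE uniqueness applies to this form directly.
  Besides it only continuity is demanded, which passes readily to time shifts and to images under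
  \<open>f\<close>.\<close>

definition integral_curve ::
  "('m::topological_space, 'e::euclidean_space) chart set \<Rightarrow> ('m \<Rightarrow> 'e) \<Rightarrow> (real \<Rightarrow> 'm) \<Rightarrow> bool" where
  "integral_curve A T \<gamma> \<longleftrightarrow> continuous_on UNIV \<gamma> \<and>
     (\<forall>t. \<forall>c\<in>A. \<gamma> t \<in> fst c \<longrightarrow> ((\<lambda>s. snd c (\<gamma> s)) has_vector_derivative
        chart_deriv (chart_at A (\<gamma> t)) c (\<lambda>x. x) (\<gamma> t) (T (\<gamma> t))) (at t))"

lemma integral_curve_flow:
  assumes A: "smooth_manifold euclidean A" and flow: "is_flow A T a"
  shows "integral_curve A T (\<lambda>t. a t p)"
  unfolding integral_curve_def
proof (intro conjI allI ballI impI)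
  let ?\<gamma> = "\<lambda>t. a t p"
  have s: "smooth_map euclidean euclidean_atlas euclidean A ?\<gamma>" and v: "\<And>t. velocity A ?\<gamma> t = T (a t p)"
    using flow unfolding is_flow_def by auto
  show "continuous_on UNIV ?\<gamma>" using s by (simp add: smooth_map_def)
  fix t c assume c: "c \<in> A" "a t p \<in> fst c"
  have "chart_deriv (UNIV, id) c ?\<gamma> t 1 =
      chart_deriv (chart_at A (a t p)) c (\<lambda>x. x) (a t p) (chart_deriv (UNIV, id) (chart_at A (a t p)) ?\<gamma> t 1)"
    by (rule chart_deriv_change[OF A]) (use s c chart_at[OF c] in auto)
  also have "chart_deriv (UNIV, id) (chart_at A (a t p)) ?\<gamma> t 1 = T (a t p)"
    using velocity_eq[OF s c] v by simp
  finally show "((\<lambda>s. snd c (a s p)) has_vector_derivative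
      chart_deriv (chart_at A (a t p)) c (\<lambda>x. x) (a t p) (T (a t p))) (at t)"
    using smooth_curve_has_vector_derivative[OF s c] by (simp only:)
qed

lemma integral_curve_shift:
  assumes "integral_curve A T \<gamma>"
  shows "integral_curve A T (\<lambda>t. \<gamma> (t + s))"
  unfolding integral_curve_def
proof (intro conjI allI ballI impI)
  have "continuous_on UNIV \<gamma>" using assms by (simp add: integral_curve_def)
  then show "continuous_on UNIV (\<lambda>t. \<gamma> (t + s))"
    by (rule continuous_on_compose2) (auto intro: continuous_intros)
  fix t c assume "c \<in> A" "\<gamma> (t + s) \<in> fst c"
  then have "((\<lambda>s. snd c (\<gamma> s)) has_vector_derivative
      chart_deriv (chart_at A (\<gamma> (t + s))) c (\<lambda>x. x) (\<gamma> (t + s)) (T (\<gamma> (t + s)))) (at (t + s))"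
    using assms by (simp add: integral_curve_def)
  then show "((\<lambda>t. snd c (\<gamma> (t + s))) has_vector_derivative
      chart_deriv (chart_at A (\<gamma> (t + s))) c (\<lambda>x. x) (\<gamma> (t + s)) (T (\<gamma> (t + s)))) (at t)"
    using vector_diff_chain_at[of "\<lambda>t. t + s" 1 t "\<lambda>s. snd c (\<gamma> s)"]
    by (simp add: o_def has_vector_derivative_add_const)
qed

lemma integral_curve_map:
  assumes A: "smooth_manifold euclidean A" and f: "smooth_map euclidean A euclidean A f"
    and f_T: "\<And>p. blinfun_apply (tangent_map A A f p) (T p) = T (f p)"
    and \<gamma>: "integral_curve A T \<gamma>"
  shows "integral_curve A T (\<lambda>t. f (\<gamma> t))"
  unfolding integral_curve_def
proof (intro conjI allI ballI impI)
  have cont: "continuous_on UNIV \<gamma>" using \<gamma> by (simp add: integral_curve_def)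
  have contf: "continuous_on UNIV f" using f by (simp add: smooth_map_def)
  show "continuous_on UNIV (\<lambda>t. f (\<gamma> t))"
    by (rule continuous_on_compose2[OF contf cont]) simp
  fix t c assume c: "c \<in> A" "f (\<gamma> t) \<in> fst c"
  let ?p = "\<gamma> t"
  define d where "d = chart_at A ?p"
  define e where "e = chart_at A (f ?p)"
  obtain d0 where "d0 \<in> A" "?p \<in> fst d0" using smooth_manifold_chart[OF A, of ?p] by auto
  then have d: "d \<in> A" "?p \<in> fst d" unfolding d_def by (rule chart_at)+
  have e: "e \<in> A" "f ?p \<in> fst e" unfolding e_def using c by (rule chart_at)+
  note inj = smooth_manifold_inj_on[OF A d(1)]
  have "((\<lambda>s. snd d (\<gamma> s)) has_vector_derivative T ?p) (at t)"
    using \<gamma> d chart_deriv_id[OF smooth_manifold_is_chart[OF A d(1)] d(2)]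
    unfolding integral_curve_def d_def by metis
  then have "((\<lambda>s. snd d (\<gamma> s)) has_derivative (\<lambda>h. h *\<^sub>R T ?p)) (at t)"
    by (simp add: has_vector_derivative_def)
  from has_derivative_compose[OF this smooth_map_has_derivative[OF f d(1) c(1) d(2) c(2)]]
  have "((\<lambda>s. (snd c \<circ> f \<circ> chart_inv d) (snd d (\<gamma> s))) has_derivative
      (\<lambda>h. chart_deriv d c f ?p (h *\<^sub>R T ?p))) (at t)" .
  then have "((\<lambda>s. snd c (f (\<gamma> s))) has_derivative (\<lambda>h. chart_deriv d c f ?p (h *\<^sub>R T ?p))) (at t)"
  proof (rule has_derivative_transform_within_open)
    have "open (fst d)" using smooth_manifold_is_chart[OF A d(1)] by (simp add: is_chart_def)
    then show "open (\<gamma> -` fst d)" using cont by (simp add: open_vimage)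
  qed (use d inj in auto)
  moreover have "chart_deriv d c f ?p (h *\<^sub>R T ?p) = h *\<^sub>R chart_deriv e c (\<lambda>x. x) (f ?p) (T (f ?p))" for h
  proof -
    have "chart_deriv d c f ?p (h *\<^sub>R T ?p) = h *\<^sub>R chart_deriv d c f ?p (T ?p)"
      using smooth_map_bounded_linear[OF f d(1) c(1) d(2) c(2)] by (simp add: bounded_linear.linear linear_scale)
    also have "chart_deriv d c f ?p (T ?p) = chart_deriv e c (\<lambda>x. x) (f ?p) (chart_deriv d e f ?p (T ?p))"
      by (rule chart_deriv_change[OF A e(1) c(1) f d(1) inj d(2) e(2) c(2)])
    also have "chart_deriv d e f ?p (T ?p) = T (f ?p)"
      using f_T[of ?p] tangent_map_apply[OF f d e] by (simp add: d_def e_def)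
    finally show ?thesis .
  qed
  ultimately show "((\<lambda>s. snd c (f (\<gamma> s))) has_vector_derivative
      chart_deriv (chart_at A (f ?p)) c (\<lambda>x. x) (f ?p) (T (f ?p))) (at t)"
    by (simp add: has_vector_derivative_def e_def)
qed

text \<open>The coincidence set is closed because the manifold is Hausdorff, open by local
  uniqueness in a chart, and nonempty; the real line is connected.\<close>

lemma integral_curve_unique:
  assumes A: "smooth_manifold euclidean A" and T: "smooth_vector_field A T"
    and \<gamma>: "integral_curve A T \<gamma>1" "integral_curve A T \<gamma>2" "\<gamma>1 0 = \<gamma>2 0"
  shows "\<gamma>1 t = \<gamma>2 t"
proof -
  have cont: "continuous_on UNIV \<gamma>1" "continuous_on UNIV \<gamma>2"
    using \<gamma> by (auto simp: integral_curve_def)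
  define E where "E = {t. \<gamma>1 t = \<gamma>2 t}"
  have "closedin euclidean {t \<in> topspace euclidean. \<gamma>1 t = \<gamma>2 t}"
    by (rule closedin_continuous_maps_eq[where Y = euclidean])
       (use A cont in \<open>auto simp: smooth_manifold_def\<close>)
  then have "closed E" by (simp add: E_def)
  moreover have "open E"
    unfolding open_subopen[of E]
  proof
    fix t0 assume "t0 \<in> E"
    then have eq: "\<gamma>1 t0 = \<gamma>2 t0" by (simp add: E_def)
    obtain c where c: "c \<in> A" "\<gamma>1 t0 \<in> fst c" using smooth_manifold_chart[OF A, of "\<gamma>1 t0"] by auto
    note inj = smooth_manifold_inj_on[OF A c(1)]
    let ?X = "\<lambda>x. let p = chart_inv c x in blinfun_apply (tangent_map A euclidean_atlas (snd c) p) (T p)"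
    \<comment> \<open>The coordinate field of \<open>smooth_vector_field\<close> is the right-hand
      side in \<open>integral_curve\<close>: both apply the derivative of \<open>snd c\<close> to
      \<open>T p\<close>.\<close>
    have X: "?X (snd c p) = chart_deriv (chart_at A p) c (\<lambda>x. x) p (T p)" if "p \<in> fst c" for p
    proof -
      have "bounded_linear (chart_deriv (chart_at A p) c (\<lambda>x. x) p)"
        using chart_at[OF c(1) that] c(1) that by (intro smooth_map_bounded_linear[OF smooth_map_id[OF A]])
      then show ?thesis using inj that
        by (simp add: tangent_map_def chart_at_euclidean_atlas chart_deriv_def o_def bounded_linear_Blinfun_apply)
    qed
    have "open (fst c)" using smooth_manifold_is_chart[OF A c(1)] by (simp add: is_chart_def)
    have near: "\<forall>\<^sub>F t in nhds t0. \<gamma> t \<in> fst c" if "continuous_on UNIV \<gamma>" "\<gamma> t0 \<in> fst c" for \<gamma>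
    proof -
      have "open (\<gamma> -` fst c)" using that(1) \<open>open (fst c)\<close> by (simp add: open_vimage)
      then show ?thesis using that(2) by (auto simp: eventually_nhds intro: exI[of _ "\<gamma> -` fst c"])
    qed
    have der: "\<forall>\<^sub>F t in nhds t0. ((\<lambda>s. snd c (\<gamma> s)) has_vector_derivative ?X (snd c (\<gamma> t))) (at t)"
      if "integral_curve A T \<gamma>" "\<gamma> t0 \<in> fst c" for \<gamma>
    proof -
      have "\<forall>\<^sub>F t in nhds t0. \<gamma> t \<in> fst c" using near that by (simp add: integral_curve_def)
      then show ?thesis
      proof eventually_elim
        case (elim t)
        then show ?case using that(1) c(1) unfolding X[OF elim] integral_curve_def by blast
      qed
    qed
    have "\<forall>\<^sub>F t in nhds t0. snd c (\<gamma>1 t) = snd c (\<gamma>2 t)"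
    proof (rule ode_unique_local[where X = ?X])
      show "smooth_on (snd c ` fst c) ?X" using T c(1) by (simp add: smooth_vector_field_def)
      show "snd c (\<gamma>1 t0) \<in> snd c ` fst c" using c by simp
      show "snd c (\<gamma>1 t0) = snd c (\<gamma>2 t0)" using eq by simp
    qed (use der[OF \<gamma>(1)] der[OF \<gamma>(2)] c eq in auto)
    with near[OF cont(1) c(2)] near[OF cont(2)] c(2) eq
    have "\<forall>\<^sub>F t in nhds t0. \<gamma>1 t \<in> fst c \<and> \<gamma>2 t \<in> fst c \<and> snd c (\<gamma>1 t) = snd c (\<gamma>2 t)"
      by (simp add: eventually_conj)
    then have "\<forall>\<^sub>F t in nhds t0. t \<in> E"
      by eventually_elim (use inj_onD[OF inj] in \<open>auto simp: E_def\<close>)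
    then show "\<exists>U. open U \<and> t0 \<in> U \<and> U \<subseteq> E" by (auto simp: eventually_nhds)
  qed
  ultimately have "E = {} \<or> E = UNIV"
    using connected_UNIV[where 'a = real] unfolding connected_clopen by auto
  moreover have "0 \<in> E" using \<gamma>(3) by (simp add: E_def)
  ultimately show ?thesis by (auto simp: E_def)
qed

section \<open>The closure of the flow in the compact-open topology\<close>

lemma topspace_compact_open: "topspace compact_open = {h. continuous_on UNIV h}"
proof -
  \<comment> \<open>Empty \<open>K\<close> and \<open>U\<close> impose no constraint, so this
    subbasic set consists of all continuous maps.\<close>
  have "openin compact_open {h :: 'a \<Rightarrow> 'a. continuous_on UNIV h \<and> h ` {} \<subseteq> {}}"
    unfolding compact_open_def
    by (intro topology_generated_by_Basis CollectI exI[of _ "{}"]) simp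
  then have "{h :: 'a \<Rightarrow> 'a. continuous_on UNIV h} \<subseteq> topspace compact_open"
    using openin_subset by fastforce
  then show ?thesis by (auto simp: compact_open_def)
qed

text \<open>Points are compact, so evaluation at a point pulls open sets back to subbasic
  ones.\<close>

lemma continuous_map_evaluation: "continuous_map compact_open euclidean (\<lambda>h. h p)"
  unfolding continuous_map_def
proof (intro conjI allI impI)
  fix U :: "'a set" assume "openin euclidean U"
  then have "openin compact_open {h. continuous_on UNIV h \<and> h ` {p} \<subseteq> U}"
    unfolding compact_open_def
    by (intro topology_generated_by_Basis CollectI exI[of _ "{p}"] exI[of _ U]) simp
  moreover have "{h \<in> topspace compact_open. h p \<in> U} = {h. continuous_on UNIV h \<and> h ` {p} \<subseteq> U}"
    by (auto simp: topspace_compact_open)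
  ultimately show "openin compact_open {h \<in> topspace compact_open. h p \<in> U}" by simp
qed simp

lemma flow_closure_subset: "flow_closure A g a \<subseteq> isometries A g"
  unfolding flow_closure_def using closure_of_subset_topspace by fastforce

lemma isometries_continuous: "h \<in> isometries A g \<Longrightarrow> continuous_on UNIV h"
  by (simp add: isometries_def smooth_map_def)

lemma flow_in_flow_closure:
  assumes "\<And>t. a t \<in> isometries A g"
  shows "a t \<in> flow_closure A g a"
proof -
  have "range a \<subseteq> topspace (transformation_topology (isometries A g))"
    using assms isometries_continuous[OF assms] by (auto simp: topspace_compact_open)
  then show ?thesis unfolding flow_closure_def using closure_of_subset by blast
qed

text \<open>For fixed \<open>p\<close> both sides are continuous in \<open>h\<close> with values in
  a Hausdorff space, so the maps \<open>h\<close> satisfying the equation form a closed set, and it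
  contains the flow.\<close>

lemma flow_closure_commute:
  fixes A :: "('m::topological_space, 'e::euclidean_space) chart set"
  assumes haus: "Hausdorff_space (euclidean :: 'm topology)" and k: "continuous_on UNIV k"
    and comm: "\<And>t p. k (a t p) = a t (k p)" and iso: "\<And>t. a t \<in> isometries A g"
    and h: "h \<in> flow_closure A g a"
  shows "k (h p) = h (k p)"
proof -
  let ?X = "transformation_topology (isometries A g)"
  have ev: "continuous_map ?X euclidean (\<lambda>h. h q)" for q
    by (rule continuous_map_from_subtopology[OF continuous_map_evaluation])
  have "continuous_map ?X euclidean (\<lambda>h. k (h p))"
    using continuous_map_compose[OF ev, of euclidean k p] k by (simp add: o_def)
  then have "closedin ?X {h \<in> topspace ?X. k (h p) = h (k p)}"
    by (rule closedin_continuous_maps_eq[OF haus _ ev])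
  moreover have "range a \<subseteq> {h \<in> topspace ?X. k (h p) = h (k p)}"
    using comm iso isometries_continuous[OF iso] by (auto simp: topspace_compact_open)
  ultimately have "flow_closure A g a \<subseteq> {h \<in> topspace ?X. k (h p) = h (k p)}"
    unfolding flow_closure_def by (rule closure_of_minimal[rotated])
  then show ?thesis using h by blast
qed

subsection \<open>Tangent spaces of orbits\<close>

text \<open>Otherwise the complements of the sets \<open>K \<inter> J\<close> are countably many
  dense open sets. Their intersection is dense by Baire, yet it lies in the complement of
  \<open>J\<close>, which misses the interior of \<open>J\<close>.\<close>

lemma countable_closed_cover_interior:
  fixes \<K> :: "'a::{real_normed_vector,heine_borel} set set"
  assumes "countable \<K>" "\<And>K. K \<in> \<K> \<Longrightarrow> closed K" "J \<subseteq> \<Union>\<K>" "interior J \<noteq> {}" "closed J"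
  obtains K where "K \<in> \<K>" "interior (K \<inter> J) \<noteq> {}"
proof (rule ccontr)
  assume "\<not> thesis"
  then have empty: "\<And>K. K \<in> \<K> \<Longrightarrow> interior (K \<inter> J) = {}" using that by blast
  have "UNIV \<subseteq> closure (\<Inter> ((\<lambda>K. - (K \<inter> J)) ` \<K>))"
  proof (rule Baire)
    fix T assume "T \<in> (\<lambda>K. - (K \<inter> J)) ` \<K>"
    then obtain K where K: "K \<in> \<K>" "T = - (K \<inter> J)" by blast
    have "closed (K \<inter> J)" using assms K by blast
    then have "open T" unfolding K(2) by (rule open_Compl)
    moreover have "closure T = UNIV" unfolding K(2) closure_complement empty[OF K(1)] by simp
    ultimately show "openin (top_of_set UNIV) T \<and> UNIV \<subseteq> closure T" by simp
  qed (use assms(1) in auto)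
  moreover have "\<Inter> ((\<lambda>K. - (K \<inter> J)) ` \<K>) \<subseteq> - J" using assms(3) by blast
  ultimately have "closure (- J) = UNIV" using closure_mono by blast
  then have "- interior J = UNIV" by (simp add: closure_complement)
  then show False using assms(4) by blast
qed

lemma range_surj_compose: "(\<And>v. F v = H (K v)) \<Longrightarrow> surj K \<Longrightarrow> range F = range H"
  using image_image[of H K UNIV] by simp

lemma smooth_manifold_real: "smooth_manifold (euclidean :: real topology) euclidean_atlas"
proof -
  have "second_countable (euclidean :: real topology)"
  proof -
    obtain \<B> :: "real set set" where "countable \<B>" "\<And>C. C \<in> \<B> \<Longrightarrow> open C"
      and union: "\<And>S. open S \<Longrightarrow> \<exists>U. U \<subseteq> \<B> \<and> S = \<Union>U"
      using univ_second_countable by blast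
    moreover have "\<exists>U\<in>\<B>. x \<in> U \<and> U \<subseteq> S" if "open S" "x \<in> S" for S x using union[OF that(1)] that(2) by blast
    ultimately show ?thesis unfolding second_countable_def by (intro exI[of _ \<B>]) auto
  qed
  moreover have "homeomorphic_map (euclidean :: real topology) euclidean id" by (simp add: homeomorphic_map_id)
  ultimately show ?thesis
    by (auto simp: smooth_manifold_def euclidean_atlas_def is_chart_def o_def intro!: smooth_on_id)
qed

section \<open>Smooth actions of a Lie transformation group\<close>

locale lie_action =
  fixes A :: "('m::topological_space, 'e::euclidean_space) chart set"
    and G :: "('m \<Rightarrow> 'm) set"
    and \<Gamma> :: "('m \<Rightarrow> 'm, 'k::euclidean_space) chart set"
  assumes manifold: "smooth_manifold euclidean A"
    and lie: "lie_transformation_group A G \<Gamma>"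
    and continuous: "\<And>g. g \<in> G \<Longrightarrow> continuous_on UNIV g"
    and bijective: "\<And>g. g \<in> G \<Longrightarrow> bij g"
    and identity: "id \<in> G"
begin

abbreviation TG where "TG \<equiv> transformation_topology G"

abbreviation orbit where "orbit p \<equiv> {g p | g. g \<in> G}"

lemma topspace_TG: "topspace TG = G"
  using continuous by (auto simp: topspace_compact_open)

lemma group_manifold: "smooth_manifold TG \<Gamma>"
  and smooth_mult: "smooth_map (prod_topology TG TG) (prod_atlas \<Gamma> \<Gamma>) TG \<Gamma> (\<lambda>(g, h). g \<circ> h)"
  and smooth_inv: "smooth_map TG \<Gamma> TG \<Gamma> inv"
  and smooth_action: "smooth_map (prod_topology euclidean TG) (prod_atlas A \<Gamma>) euclidean A (\<lambda>(p, g). g p)"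
  using lie by (auto simp: lie_transformation_group_def)

text \<open>Closure under the group operations is contained in their continuity as maps into
  \<open>TG\<close>, since a continuous map sends topspace to topspace.\<close>

lemma inv_closed: "g \<in> G \<Longrightarrow> inv g \<in> G"
  using smooth_inv topspace_TG unfolding smooth_map_def continuous_map_def by blast

lemma comp_closed: "g \<in> G \<Longrightarrow> h \<in> G \<Longrightarrow> g \<circ> h \<in> G"
  using smooth_mult topspace_TG unfolding smooth_map_def continuous_map_def
  by (metis (no_types, lifting) PiE SigmaI case_prod_conv topspace_prod_topology)

lemma inv_apply: "g \<in> G \<Longrightarrow> g (inv g p) = p" "g \<in> G \<Longrightarrow> inv g (g p) = p"
  using bijective by (simp_all add: bij_def surj_f_inv_f)

lemma smooth_left_mult: "h \<in> G \<Longrightarrow> smooth_map TG \<Gamma> TG \<Gamma> (\<lambda>g. h \<circ> g)"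
  and smooth_right_mult: "h \<in> G \<Longrightarrow> smooth_map TG \<Gamma> TG \<Gamma> (\<lambda>g. g \<circ> h)"
  using smooth_map_partial[OF group_manifold group_manifold smooth_mult, of h]
  by (simp_all add: topspace_TG del: topspace_subtopology)

lemma smooth_evaluation: "smooth_map TG \<Gamma> euclidean A (\<lambda>g. g p)"
  and smooth_element: "g \<in> G \<Longrightarrow> smooth_map euclidean A euclidean A g"
  using smooth_map_partial[OF manifold group_manifold smooth_action]
  by (simp_all add: topspace_TG del: topspace_subtopology)

lemma chart_in_group: "d \<in> \<Gamma> \<Longrightarrow> g \<in> fst d \<Longrightarrow> g \<in> G"
  using smooth_manifold_subset[OF group_manifold] topspace_TG by blast

lemma group_chart:
  assumes "g \<in> G" obtains d where "d \<in> \<Gamma>" "g \<in> fst d"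
  using smooth_manifold_chart[OF group_manifold] assms topspace_TG by metis

lemma manifold_chart: obtains c where "c \<in> A" "p \<in> fst c"
  using smooth_manifold_chart[OF manifold, of p] by auto

lemmas inj_charts = smooth_manifold_inj_on[OF manifold] smooth_manifold_inj_on[OF group_manifold]

lemma chart_deriv_element_inverse:
  assumes "g \<in> G" "c \<in> A" "p \<in> fst c" "d \<in> A" "g p \<in> fst d"
  shows "chart_deriv d c (inv g) (g p) (chart_deriv c d g p v) = v"
  using chart_deriv_inverse[OF manifold manifold smooth_element[OF inv_closed[OF assms(1)]]
      smooth_element[OF assms(1)] _ assms(4,5,2,3)] inv_apply[OF assms(1)] by simp

text \<open>Because \<open>g (h p) = (g \<circ> h) p\<close>, moving the base point along the orbit
  amounts to right translation in the group.\<close>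

lemma chart_deriv_evaluation_right:
  assumes h: "h \<in> G" and d': "d' \<in> \<Gamma>" "g \<in> fst d'" and d: "d \<in> \<Gamma>" "g \<circ> h \<in> fst d"
    and c: "c \<in> A" "g (h p) \<in> fst c"
  shows "chart_deriv d' c (\<lambda>g. g (h p)) g v =
    chart_deriv d c (\<lambda>g. g p) (g \<circ> h) (chart_deriv d' d (\<lambda>g. g \<circ> h) g v)"
  by (subst chart_deriv_compose[where h = "\<lambda>g. g \<circ> h" and k = "\<lambda>g. g p" and p = g, OF inj_charts(2)[OF d'(1)] inj_charts(2)[OF d(1)]
        smooth_right_mult[OF h] d'(1) d(1) d'(2) d(2) smooth_evaluation[of p] c(1)])
     (use c in auto)

text \<open>Equivariance of the orbit map: the derivative of \<open>\<lambda>g. h (g p)\<close> is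
  computed once through left translation in the group and once through \<open>h\<close> acting on
  the manifold.\<close>

lemma chart_deriv_evaluation_left:
  assumes h: "h \<in> G" and d': "d' \<in> \<Gamma>" "g \<in> fst d'" and d: "d \<in> \<Gamma>" "h \<circ> g \<in> fst d"
    and c': "c' \<in> A" "g p \<in> fst c'" and c: "c \<in> A" "h (g p) \<in> fst c"
  shows "chart_deriv d c (\<lambda>g. g p) (h \<circ> g) (chart_deriv d' d (\<lambda>g. h \<circ> g) g v) =
    chart_deriv c' c h (g p) (chart_deriv d' c' (\<lambda>g. g p) g v)"
proof -
  have "chart_deriv d' c (\<lambda>g. h (g p)) g v =
      chart_deriv d c (\<lambda>g. g p) (h \<circ> g) (chart_deriv d' d (\<lambda>g. h \<circ> g) g v)"
    by (subst chart_deriv_compose[where h = "\<lambda>g. h \<circ> g" and k = "\<lambda>g. g p" and p = g, OF inj_charts(2)[OF d'(1)] inj_charts(2)[OF d(1)]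
        smooth_left_mult[OF h] d'(1) d(1) d'(2) d(2) smooth_evaluation[of p] c(1)])
       (use c in auto)
  moreover have "chart_deriv d' c (\<lambda>g. h (g p)) g v =
      chart_deriv c' c h (g p) (chart_deriv d' c' (\<lambda>g. g p) g v)"
    by (subst chart_deriv_compose[where h = "\<lambda>g. g p" and k = h and p = g, OF inj_charts(2)[OF d'(1)] inj_charts(1)[OF c'(1)]
        smooth_evaluation[of p] d'(1) c'(1) d'(2) c'(2) smooth_element[OF h] c])
       auto
  ultimately show ?thesis by simp
qed

lemma surj_left_mult:
  assumes h: "h \<in> G" and d: "d \<in> \<Gamma>" "g \<in> fst d" and d': "d' \<in> \<Gamma>" "h \<circ> g \<in> fst d'"
  shows "surj (chart_deriv d d' (\<lambda>g. h \<circ> g) g)"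
proof (rule surjI)
  have 1: "inv h \<circ> (h \<circ> g) = g" using inv_apply[OF h] by auto
  have "chart_deriv d d' (\<lambda>g. h \<circ> g) (inv h \<circ> (h \<circ> g)) (chart_deriv d' d (\<lambda>g. inv h \<circ> g) (h \<circ> g) v) = v" for v
    by (rule chart_deriv_inverse[where h = "\<lambda>g. h \<circ> g" and k = "\<lambda>g. inv h \<circ> g" and y = "h \<circ> g", OF group_manifold group_manifold
        smooth_left_mult[OF h] smooth_left_mult[OF inv_closed[OF h]] _ d(1) _ d'])
       (use d in \<open>simp_all add: 1 inv_apply[OF h] fun_eq_iff\<close>)
  then show "chart_deriv d d' (\<lambda>g. h \<circ> g) g (chart_deriv d' d (\<lambda>g. inv h \<circ> g) (h \<circ> g) v) = v" for v
    unfolding 1 .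
qed

lemma surj_right_mult:
  assumes h: "h \<in> G" and d: "d \<in> \<Gamma>" "g \<in> fst d" and d': "d' \<in> \<Gamma>" "g \<circ> h \<in> fst d'"
  shows "surj (chart_deriv d d' (\<lambda>g. g \<circ> h) g)"
proof (rule surjI)
  have 1: "g \<circ> h \<circ> inv h = g" using inv_apply[OF h] by auto
  have "chart_deriv d d' (\<lambda>g. g \<circ> h) (g \<circ> h \<circ> inv h) (chart_deriv d' d (\<lambda>g. g \<circ> inv h) (g \<circ> h) v) = v" for v
    by (rule chart_deriv_inverse[where h = "\<lambda>g. g \<circ> h" and k = "\<lambda>g. g \<circ> inv h" and y = "g \<circ> h", OF group_manifold group_manifold
        smooth_right_mult[OF h] smooth_right_mult[OF inv_closed[OF h]] _ d(1) _ d'])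
       (use d in \<open>simp_all add: 1 inv_apply[OF h] fun_eq_iff\<close>)
  then show "chart_deriv d d' (\<lambda>g. g \<circ> h) g (chart_deriv d' d (\<lambda>g. g \<circ> inv h) (g \<circ> h) v) = v" for v
    unfolding 1 .
qed

text \<open>Right translations have surjective derivatives, so the group directions at
  \<open>h p\<close> are the same whether seen from \<open>id\<close> at \<open>h p\<close> or from
  \<open>h\<close> at \<open>p\<close>.\<close>

lemma range_evaluation_right:
  assumes h: "h \<in> G" and d': "d' \<in> \<Gamma>" "id \<in> fst d'" and d: "d \<in> \<Gamma>" "h \<in> fst d" and c: "c \<in> A" "h p \<in> fst c"
  shows "range (chart_deriv d' c (\<lambda>g. g (h p)) id) = range (chart_deriv d c (\<lambda>g. g p) h)"
proof -
  have "chart_deriv d' c (\<lambda>g. g (h p)) id v = chart_deriv d c (\<lambda>g. g p) h (chart_deriv d' d (\<lambda>g. g \<circ> h) id v)" for v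
    using chart_deriv_evaluation_right[OF h d', of d c p] d c by simp
  moreover have "surj (chart_deriv d' d (\<lambda>g. g \<circ> h) id)"
    by (rule surj_right_mult[OF h d' d(1)]) (use d in simp)
  ultimately show ?thesis by (rule range_surj_compose)
qed

text \<open>The diffeomorphism \<open>h\<close> intertwines the orbit map near \<open>id\<close>
  with the orbit map near \<open>h\<close>, so the rank does not depend on the group element. This
  supplies the rank hypothesis of \<open>constant_rank_curve\<close>.\<close>

lemma dim_range_evaluation:
  assumes h: "h \<in> G" and d: "d \<in> \<Gamma>" "h \<in> fst d" and c: "c \<in> A" "h p \<in> fst c"
    and d': "d' \<in> \<Gamma>" "id \<in> fst d'" and c': "c' \<in> A" "p \<in> fst c'"
  shows "dim (range (chart_deriv d c (\<lambda>g. g p) h)) = dim (range (chart_deriv d' c' (\<lambda>g. g p) id))"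
proof -
  let ?D = "chart_deriv d' c' (\<lambda>g. g p) id"
  have eq: "chart_deriv d c (\<lambda>g. g p) h (chart_deriv d' d (\<lambda>g. h \<circ> g) id v) = chart_deriv c' c h p (?D v)" for v
    using chart_deriv_evaluation_left[OF h d', of d c' p c] d c c' by simp
  have "surj (chart_deriv d' d (\<lambda>g. h \<circ> g) id)"
    by (rule surj_left_mult[OF h d' d(1)]) (use d in simp)
  then have "range (\<lambda>v. chart_deriv c' c h p (?D v)) = range (chart_deriv d c (\<lambda>g. g p) h)"
    by (rule range_surj_compose[where K = "chart_deriv d' d (\<lambda>g. h \<circ> g) id", rotated]) (rule eq[symmetric])
  then have range: "range (chart_deriv d c (\<lambda>g. g p) h) = chart_deriv c' c h p ` range ?D"
    by (simp add: image_image)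
  have lin: "linear (chart_deriv c' c h p)"
    using smooth_map_bounded_linear[OF smooth_element[OF h] c'(1) c(1) c'(2) c(2)] by (rule bounded_linear.linear)
  have "inj (chart_deriv c' c h p)"
    using chart_deriv_element_inverse[OF h c' c] by (rule inj_on_inverseI)
  then have "inj_on (chart_deriv c' c h p) (span (range ?D))" by (rule inj_on_subset) simp
  then show ?thesis unfolding range by (rule dim_image_eq[OF lin])
qed

text \<open>The test curve is a sine oscillation around \<open>id\<close> in a chart of the group,
  evaluated at \<open>p\<close>. It realizes only a positive multiple of the group direction, which
  is enough for computing an annihilator.\<close>

lemma orbit_tangent_supset:
  assumes d: "d \<in> \<Gamma>" "id \<in> fst d"
  obtains \<epsilon> where "\<epsilon> > 0"
    "\<epsilon> *\<^sub>R chart_deriv d (chart_at A p) (\<lambda>g. g p) id w \<in> submanifold_tangent euclidean A (orbit p) p"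
proof -
  obtain c0 where "c0 \<in> A" "p \<in> fst c0" by (rule manifold_chart)
  then have c: "chart_at A p \<in> A" "p \<in> fst (chart_at A p)" by (rule chart_at)+
  note injd = inj_charts(2)[OF d(1)]
  let ?x0 = "snd d id"
  obtain r where r: "r > 0" "cball ?x0 r \<subseteq> snd d ` fst d"
    using smooth_manifold_open[OF group_manifold d(1)] d(2) open_contains_cball by blast
  \<comment> \<open>Gives \<open>\<epsilon> * norm w \<le> r\<close>, so the oscillation never
    leaves the chart; the added 1 covers \<open>w = 0\<close>.\<close>
  define \<epsilon> where "\<epsilon> = r / (norm w + 1)"
  have pos: "norm w + 1 > 0" by (simp add: add_nonneg_pos)
  then have \<epsilon>: "\<epsilon> > 0" "\<epsilon> * norm w \<le> r"
    using r(1) by (simp_all add: \<epsilon>_def pos_divide_le_eq)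
  define s where "s t = ?x0 + (\<epsilon> * sin t) *\<^sub>R w" for t
  have s_in: "s t \<in> snd d ` fst d" for t
  proof -
    have "\<bar>sin t\<bar> * (\<epsilon> * norm w) \<le> 1 * r"
      using \<epsilon> abs_sin_le_one[of t] by (intro mult_mono) auto
    then have "dist ?x0 (s t) \<le> r" using \<epsilon>(1) by (simp add: s_def dist_norm abs_mult ac_simps)
    then show ?thesis using r(2) by auto
  qed
  define \<sigma> where "\<sigma> t = chart_inv d (s t)" for t
  have \<sigma>: "smooth_map euclidean euclidean_atlas TG \<Gamma> \<sigma>"
    unfolding \<sigma>_def by (rule smooth_map_chart_inv[OF group_manifold d(1)]) (use s_in in \<open>auto simp: s_def smooth_on_sin\<close>)
  have \<sigma>_in: "\<sigma> t \<in> fst d" for t unfolding \<sigma>_def using s_in by (rule chart_inv_in)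
  have \<sigma>0: "\<sigma> 0 = id" using injd d(2) by (simp add: \<sigma>_def s_def)
  define \<gamma> where "\<gamma> t = \<sigma> t p" for t
  have \<gamma>: "smooth_map euclidean euclidean_atlas euclidean A \<gamma>"
    unfolding \<gamma>_def
  proof (rule smooth_map_compose[OF _ inj_charts(2) _ \<sigma> smooth_evaluation])
    show "smooth_manifold (euclidean :: real topology) euclidean_atlas" by (rule smooth_manifold_real)
    show "topspace TG \<subseteq> (\<Union>d\<in>\<Gamma>. fst d)" unfolding topspace_TG using group_chart by blast
  qed
  have "range \<gamma> \<subseteq> orbit p" using \<sigma>_in chart_in_group[OF d(1)] by (auto simp: \<gamma>_def)
  moreover have \<gamma>0: "\<gamma> 0 = p" by (simp add: \<gamma>_def \<sigma>0)
  moreover have "velocity A \<gamma> 0 = \<epsilon> *\<^sub>R chart_deriv d (chart_at A p) (\<lambda>g. g p) id w"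
  proof -
    have "chart_deriv (UNIV, id) d \<sigma> 0 = (\<lambda>h. (h * \<epsilon>) *\<^sub>R w)"
    proof (rule chart_deriv_unique)
      have "snd d \<circ> \<sigma> \<circ> chart_inv (UNIV, id) = s"
        using chart_inv_right[OF s_in] by (auto simp: \<sigma>_def)
      moreover have "(s has_derivative (\<lambda>h. (h * \<epsilon>) *\<^sub>R w)) (at 0)"
        unfolding s_def by (auto intro!: derivative_eq_intros)
      ultimately show "((snd d \<circ> \<sigma> \<circ> chart_inv (UNIV, id)) has_derivative (\<lambda>h. (h * \<epsilon>) *\<^sub>R w)) (at (snd (UNIV, id) 0))"
        by simp
    qed
    moreover have "velocity A \<gamma> 0 = chart_deriv (UNIV, id) (chart_at A p) \<gamma> 0 1"
      using velocity_eq[OF \<gamma>, of "chart_at A p" 0] c \<gamma>0 by simp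
    moreover have "chart_deriv (UNIV, id) (chart_at A p) \<gamma> 0 =
        (\<lambda>v. chart_deriv d (chart_at A p) (\<lambda>g. g p) (\<sigma> 0) (chart_deriv (UNIV, id) d \<sigma> 0 v))"
      by (rule chart_deriv_compose[OF _ injd \<sigma> euclidean_chart_simps(1) d(1) _ \<sigma>_in smooth_evaluation c(1)])
         (use c \<sigma>0 in \<open>auto simp: \<gamma>_def\<close>)
    moreover have "linear (chart_deriv d (chart_at A p) (\<lambda>g. g p) id)"
      by (rule bounded_linear.linear, rule smooth_map_bounded_linear[OF smooth_evaluation d(1) c(1) d(2)]) (use c in simp)
    ultimately show ?thesis by (simp add: \<sigma>0 linear_scale)
  qed
  ultimately have "\<epsilon> *\<^sub>R chart_deriv d (chart_at A p) (\<lambda>g. g p) id w \<in> submanifold_tangent euclidean A (orbit p) p"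
    unfolding submanifold_tangent_def using \<gamma> by (metis (mono_tags, lifting) mem_Collect_eq)
  then show thesis using that \<epsilon>(1) by blast
qed

text \<open>The slice \<open>K\<close> is the image of a closed ball in a group chart: compact,
  hence closed as Baire's theorem demands, and small enough for \<open>constant_rank_curve\<close>.
  It contains the image of a neighbourhood \<open>N\<close> of \<open>h\<close>, so that countably
  many slices can exhaust the orbit. Tangency is expressed from \<open>id\<close> at the base point
  \<open>\<gamma> t\<close>, in a form common to all slices.\<close>

lemma orbit_slice:
  fixes \<gamma> :: "real \<Rightarrow> 'm"
  assumes h: "h \<in> G" and \<gamma>: "smooth_map euclidean euclidean_atlas euclidean A \<gamma>"
    and d': "d' \<in> \<Gamma>" "id \<in> fst d'"
  obtains N K where "openin TG N" "h \<in> N" "closed K" "(\<lambda>g. g p) ` N \<subseteq> K"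
    "\<And>t c. \<forall>\<^sub>F s in nhds t. \<gamma> s \<in> K \<Longrightarrow> c \<in> A \<Longrightarrow> \<gamma> t \<in> fst c \<Longrightarrow>
      chart_deriv (UNIV, id) c \<gamma> t 1 \<in> range (chart_deriv d' c (\<lambda>g. g (\<gamma> t)) id)"
proof -
  obtain d where d: "d \<in> \<Gamma>" "h \<in> fst d" using group_chart[OF h] .
  obtain c where c: "c \<in> A" "h p \<in> fst c" by (rule manifold_chart)
  obtain c' where c': "c' \<in> A" "p \<in> fst c'" by (rule manifold_chart)
  note injd = inj_charts(2)[OF d(1)] and injc = inj_charts(1)[OF c(1)]
  let ?S = "snd d ` {g \<in> fst d. g p \<in> fst c}"
  let ?E = "snd c \<circ> (\<lambda>g. g p) \<circ> chart_inv d"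
  have sE: "smooth_on ?S ?E"
    using smooth_evaluation[of p] c(1) d(1) unfolding smooth_map_def by blast
  obtain E' where E': "\<And>x. x \<in> ?S \<Longrightarrow> (?E has_derivative blinfun_apply (E' x)) (at x)"
    "\<And>x. x \<in> ?S \<Longrightarrow> blinfun_apply (E' x) = frechet_derivative ?E (at x)" "continuous_on ?S E'"
    by (rule smooth_on_continuous_derivative[OF sE]) blast
  have E'_eq: "blinfun_apply (E' (snd d g)) = chart_deriv d c (\<lambda>g. g p) g" if "g \<in> fst d" "g p \<in> fst c" for g
    unfolding chart_deriv_def by (rule E'(2)) (use that in blast)
  have rank: "dim (range (E' x)) = dim (range (E' (snd d h)))" if x: "x \<in> ?S" for x
  proof -
    obtain g where g: "x = snd d g" "g \<in> fst d" "g p \<in> fst c" using x by blast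
    show ?thesis
      unfolding g(1) E'_eq[OF g(2,3)] E'_eq[OF d(2) c(2)]
        dim_range_evaluation[OF chart_in_group[OF d(1) g(2)] d(1) g(2) c(1) g(3) d' c']
        dim_range_evaluation[OF h d c d' c'] ..
  qed
  have "open ?S" using sE by (simp add: smooth_on_def)
  have "snd d h \<in> ?S" using c d by blast
  obtain \<delta> where \<delta>: "\<delta> > 0" "cball (snd d h) \<delta> \<subseteq> ?S"
    and curve: "\<And>u u' t0. (u has_vector_derivative u') (at t0) \<Longrightarrow>
      \<forall>\<^sub>F t in nhds t0. u t \<in> ?E ` cball (snd d h) \<delta> \<Longrightarrow> \<exists>x\<in>?S. u t0 = ?E x \<and> u' \<in> range (E' x)"
    by (rule constant_rank_curve[OF \<open>open ?S\<close> \<open>snd d h \<in> ?S\<close> E'(1,3) rank]) (assumption, assumption, rule that)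
  have \<delta>_chart: "cball (snd d h) \<delta> \<subseteq> snd d ` fst d" using \<delta>(2) by blast
  define N where "N = {g \<in> topspace (subtopology TG (fst d)). snd d g \<in> ball (snd d h) \<delta>}"
  define K where "K = (\<lambda>x. chart_inv d x p) ` cball (snd d h) \<delta>"
  have isd: "is_chart TG d" by (rule smooth_manifold_is_chart[OF group_manifold d(1)])
  have "openin (subtopology TG (fst d)) N"
    unfolding N_def by (rule openin_continuous_map_preimage[OF chart_continuous[OF isd]]) simp
  then have "openin TG N" using isd openin_open_subtopology by (auto simp: is_chart_def)
  moreover have N_iff: "g \<in> N \<longleftrightarrow> g \<in> fst d \<and> snd d g \<in> ball (snd d h) \<delta>" for g
    using chart_subset[OF isd] by (auto simp: N_def)
  then have "h \<in> N" using d(2) \<delta>(1) by simp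
  moreover have "closed K"
  proof -
    have "continuous_map (top_of_set (snd d ` fst d)) euclidean (\<lambda>x. chart_inv d x p)"
      using continuous_map_compose[OF chart_inv_continuous[OF isd], of euclidean "\<lambda>g. g p"] smooth_evaluation[of p]
      by (simp add: smooth_map_def o_def)
    then have "continuous_on (cball (snd d h) \<delta>) (\<lambda>x. chart_inv d x p)"
      using continuous_on_subset \<delta>_chart by auto
    then have "compact K" unfolding K_def by (rule compact_continuous_image) simp
    then have "compactin euclidean K" by simp
    moreover have "Hausdorff_space (euclidean :: 'm topology)" using manifold by (simp add: smooth_manifold_def)
    ultimately show ?thesis using compactin_imp_closedin[of euclidean K] by simp
  qed
  moreover have "(\<lambda>g. g p) ` N \<subseteq> K"
  proof (rule image_subsetI)
    fix g assume "g \<in> N"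
    then have "snd d g \<in> cball (snd d h) \<delta>" "g = chart_inv d (snd d g)" using injd by (auto simp: N_iff)
    then show "g p \<in> K" unfolding K_def by (metis (mono_tags, lifting) imageI)
  qed
  moreover have "chart_deriv (UNIV, id) c2 \<gamma> t 1 \<in> range (chart_deriv d' c2 (\<lambda>g. g (\<gamma> t)) id)"
    if ev: "\<forall>\<^sub>F s in nhds t. \<gamma> s \<in> K" and c2: "c2 \<in> A" "\<gamma> t \<in> fst c2" for t c2
  proof -
    have K_eq: "y \<in> fst c \<and> snd c y \<in> ?E ` cball (snd d h) \<delta>" if yK: "y \<in> K" for y
    proof -
      obtain x where x: "x \<in> cball (snd d h) \<delta>" "y = chart_inv d x p" using yK by (auto simp: K_def)
      then obtain g where g: "x = snd d g" "g \<in> fst d" "g p \<in> fst c" using \<delta>(2) by blast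
      then have "y \<in> fst c" using x(2) injd by simp
      moreover have "snd c y = ?E x" by (simp add: x(2))
      ultimately show ?thesis using x(1) by blast
    qed
    have \<gamma>t: "\<gamma> t \<in> fst c" using K_eq eventually_nhds_x_imp_x[OF ev] by blast
    have der: "((\<lambda>s. snd c (\<gamma> s)) has_vector_derivative chart_deriv (UNIV, id) c \<gamma> t 1) (at t)"
      by (rule smooth_curve_has_vector_derivative[OF \<gamma> c(1) \<gamma>t])
    have "\<forall>\<^sub>F s in nhds t. snd c (\<gamma> s) \<in> ?E ` cball (snd d h) \<delta>"
      using ev by eventually_elim (use K_eq in blast)
    from curve[OF der this] obtain g where g: "g \<in> fst d" "g p \<in> fst c"
      "snd c (\<gamma> t) = ?E (snd d g)" "chart_deriv (UNIV, id) c \<gamma> t 1 \<in> range (E' (snd d g))"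
      by blast
    have "snd c (\<gamma> t) = snd c (g p)" using g(3) injd g(1) by simp
    then have \<gamma>_g: "\<gamma> t = g p" using inj_onD[OF injc _ \<gamma>t g(2)] by blast
    then have gp: "g p \<in> fst c2" using c2 by simp
    obtain w where w: "chart_deriv (UNIV, id) c \<gamma> t 1 = chart_deriv d c (\<lambda>g. g p) g w"
      using g(4) unfolding E'_eq[OF g(1,2)] by blast
    have "chart_deriv (UNIV, id) c2 \<gamma> t 1 = chart_deriv c c2 (\<lambda>x. x) (\<gamma> t) (chart_deriv (UNIV, id) c \<gamma> t 1)"
      by (rule chart_deriv_change[OF manifold c(1) c2(1) \<gamma>]) (use \<gamma>t c2 in auto)
    also have "\<dots> = chart_deriv d c2 (\<lambda>g. g p) g w"
      unfolding w unfolding \<gamma>_g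
      by (rule chart_deriv_change[where h = "\<lambda>g. g p" and p = g, OF manifold c(1) c2(1) smooth_evaluation d(1) injd g(1,2) gp, symmetric])
    finally show ?thesis
      unfolding \<gamma>_g range_evaluation_right[OF chart_in_group[OF d(1) g(1)] d' d(1) g(1) c2(1) gp] by blast
  qed
  ultimately show thesis by (rule that)
qed

text \<open>If the velocity at time 0 were not tangent to the group directions, then, since the rank of
  the evaluation is constant along the orbit and the rank is lower semicontinuous, the same would
  hold at all small times. But countably many compact slices cover the orbit, so by Baire the curve
  stays in one of them for some small time interval, where its velocity is tangent.\<close>

lemma orbit_tangent_subset:
  assumes d: "d \<in> \<Gamma>" "id \<in> fst d" and v: "v \<in> submanifold_tangent euclidean A (orbit p) p"
  shows "v \<in> range (chart_deriv d (chart_at A p) (\<lambda>g. g p) id)"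
proof (rule ccontr)
  assume not: "v \<notin> range (chart_deriv d (chart_at A p) (\<lambda>g. g p) id)"
  define c where "c = chart_at A p"
  obtain c0 where "c0 \<in> A" "p \<in> fst c0" by (rule manifold_chart)
  then have c: "c \<in> A" "p \<in> fst c" unfolding c_def by (rule chart_at)+
  obtain \<gamma> where \<gamma>: "smooth_map euclidean euclidean_atlas euclidean A \<gamma>" "range \<gamma> \<subseteq> orbit p" "\<gamma> 0 = p"
    and v_eq: "v = velocity A \<gamma> 0" using v unfolding submanifold_tangent_def by blast
  have cont: "continuous_on UNIV \<gamma>" using \<gamma>(1) by (simp add: smooth_map_def)
  define vel where "vel t = chart_deriv (UNIV, id) c \<gamma> t 1" for t
  define D where "D t = chart_deriv d c (\<lambda>g. g (\<gamma> t)) id" for t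
  have v0: "vel 0 \<notin> range (D 0)"
    using not velocity_eq[OF \<gamma>(1), of c 0] c \<gamma>(3) by (simp add: v_eq vel_def D_def c_def)
  have "open (fst c)" using smooth_manifold_is_chart[OF manifold c(1)] by (simp add: is_chart_def)
  define I where "I = \<gamma> -` fst c"
  have I: "open I" "0 \<in> I" unfolding I_def using cont \<open>open (fst c)\<close> c \<gamma>(3) by (auto intro: open_vimage)
  have inI: "\<gamma> t \<in> fst c" if "t \<in> I" for t using that by (simp add: I_def)
  have lin: "bounded_linear (D t)" if "t \<in> I" for t
    unfolding D_def by (rule smooth_map_bounded_linear[OF smooth_evaluation d(1) c(1) d(2)]) (use inI[OF that] in simp)
  have dimD: "dim (range (D t)) = dim (range (D 0))" if "t \<in> I" for t
  proof -
    obtain h where h: "h \<in> G" "\<gamma> t = h p" using \<gamma>(2) by blast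
    obtain d1 where d1: "d1 \<in> \<Gamma>" "h \<in> fst d1" using group_chart[OF h(1)] .
    have hp: "h p \<in> fst c" using inI[OF that] h(2) by simp
    have "dim (range (D t)) = dim (range (chart_deriv d1 c (\<lambda>g. g p) h))"
      unfolding D_def h(2) range_evaluation_right[OF h(1) d d1 c(1) hp] ..
    also have "\<dots> = dim (range (chart_deriv d c (\<lambda>g. g p) id))"
      by (rule dim_range_evaluation[OF h(1) d1 c(1) hp d c])
    finally show ?thesis by (simp add: D_def \<gamma>(3))
  qed
  \<comment> \<open>The derivative in a group direction is a partial derivative of the whole action,
    read in one fixed product chart; this gives continuity in the base point
    \<open>\<gamma> t\<close>.\<close>
  have contD: "continuous_on I (\<lambda>t. D t u)" for u
  proof -
    let ?cd = "prod_chart c d" and ?act = "\<lambda>(p, g). g p"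
    let ?W = "snd ?cd ` {x \<in> fst ?cd. ?act x \<in> fst c}" and ?F = "snd c \<circ> ?act \<circ> chart_inv ?cd"
    have cd: "?cd \<in> prod_atlas A \<Gamma>" using c d by (auto simp: prod_atlas_iff)
    have "smooth_on ?W ?F" using smooth_action cd c(1) unfolding smooth_map_def by blast
    from smooth_on_continuous_frechet[OF this, of "(0, u)"]
    have contF: "continuous_on ?W (\<lambda>x. frechet_derivative ?F (at x) (0, u))" .
    have "continuous_on I (\<lambda>t. snd c (\<gamma> t))"
      using smooth_curve_has_vector_derivative[OF \<gamma>(1) c(1)] inI has_vector_derivative_continuous
      by (intro continuous_at_imp_continuous_on ballI) blast
    then have "continuous_on I (\<lambda>t. (snd c (\<gamma> t), snd d id))" by (intro continuous_intros)
    moreover have "(\<lambda>t. (snd c (\<gamma> t), snd d id)) ` I \<subseteq> ?W"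
    proof (rule image_subsetI)
      fix t assume t: "t \<in> I"
      have "(\<gamma> t, id) \<in> {x \<in> fst ?cd. ?act x \<in> fst c}" using inI[OF t] d(2) by simp
      then have "snd ?cd (\<gamma> t, id) \<in> ?W" by (rule imageI)
      then show "(snd c (\<gamma> t), snd d id) \<in> ?W" by simp
    qed
    ultimately have "continuous_on I (\<lambda>t. frechet_derivative ?F (at (snd c (\<gamma> t), snd d id)) (0, u))"
      by (rule continuous_on_compose2[OF contF])
    moreover have "D t u = frechet_derivative ?F (at (snd c (\<gamma> t), snd d id)) (0, u)" if "t \<in> I" for t
      using chart_deriv_partial(1)[OF manifold group_manifold smooth_action c(1) inI[OF that] d c(1), of u] inI[OF that]
      by (simp add: D_def chart_deriv_def)
    ultimately show ?thesis by (simp cong: continuous_on_cong)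
  qed
  have contv: "continuous_on I vel"
  proof -
    have "smooth_on I (snd c \<circ> \<gamma> \<circ> chart_inv (UNIV, id :: real \<Rightarrow> real))"
      using bspec[OF bspec[OF conjunct2[OF \<gamma>(1)[unfolded smooth_map_def]] euclidean_chart_simps(1)] c(1)]
      by (simp add: I_def vimage_def)
    from smooth_on_continuous_frechet[OF this, of 1] show ?thesis
      by (simp add: vel_def chart_deriv_def cong: continuous_on_cong)
  qed
  \<comment> \<open>\<open>M t\<close> adjoins the velocity to \<open>D t\<close> as one more
    column, so its rank exceeds that of \<open>D t\<close> exactly when the velocity is not in the
    range of \<open>D t\<close>.\<close>
  define M where "M t = Blinfun (\<lambda>x. D t (fst x) + snd x *\<^sub>R vel t)" for t
  have M: "blinfun_apply (M t) (u, s) = D t u + s *\<^sub>R vel t" if "t \<in> I" for t u s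
  proof -
    have "bounded_linear (\<lambda>x. D t (fst x) + snd x *\<^sub>R vel t)"
      by (intro bounded_linear_add bounded_linear_compose[OF lin[OF that]] bounded_linear_scaleR_const
          bounded_linear_fst bounded_linear_snd)
    then show ?thesis unfolding M_def by (simp add: bounded_linear_Blinfun_apply)
  qed
  have "continuous_on I M"
  proof (rule continuous_on_blinfun_componentwise)
    fix i :: "'k \<times> real"
    have "continuous_on I (\<lambda>t. D t (fst i) + snd i *\<^sub>R vel t)" by (intro continuous_intros contD contv)
    then show "continuous_on I (\<lambda>t. M t i)"
      using M[of _ "fst i" "snd i"] by (simp cong: continuous_on_cong)
  qed
  then have contM: "isCont M 0" using I by (simp add: continuous_on_eq_continuous_at)
  obtain \<epsilon> where \<epsilon>: "\<epsilon> > 0" "\<And>L. norm (L - M 0) < \<epsilon> \<Longrightarrow> dim (range (M 0)) \<le> dim (range L)"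
    using rank_lower_semicontinuous[of "M 0"] by metis
  have "\<forall>\<^sub>F t in nhds 0. dist (M t) (M 0) < \<epsilon>"
    using tendstoD[OF contM[unfolded continuous_at tendsto_at_iff_tendsto_nhds] \<epsilon>(1)] .
  moreover have "\<forall>\<^sub>F t in nhds 0. t \<in> I" using I by (auto simp: eventually_nhds)
  ultimately have "\<forall>\<^sub>F t in nhds 0. dist (M t) (M 0) < \<epsilon> \<and> t \<in> I" by (rule eventually_conj)
  then obtain r where r: "r > 0" "\<And>t. dist t 0 < r \<Longrightarrow> dist (M t) (M 0) < \<epsilon> \<and> t \<in> I"
    unfolding eventually_nhds_metric by blast
  have vel_not: "vel t \<notin> range (D t)" if t: "dist t 0 < r" for t
  proof
    assume "vel t \<in> range (D t)"
    have tI: "t \<in> I" and dM: "dist (M t) (M 0) < \<epsilon>" using r(2)[OF t] by auto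
    have subspace: "subspace (range (D t))"
      using lin[OF tI] by (intro linear_subspace_image) (auto simp: bounded_linear.linear)
    have span0: "span (range (D 0)) = range (D 0)"
      using lin[OF I(2)] by (simp add: span_eq_iff linear_subspace_image bounded_linear.linear)
    have "range (M t) \<subseteq> range (D t)"
    proof (rule image_subsetI)
      fix x show "M t x \<in> range (D t)"
        using M[OF tI, of "fst x" "snd x"] subspace_add[OF subspace rangeI subspace_scale[OF subspace \<open>vel t \<in> range (D t)\<close>]]
        by simp
    qed
    then have "dim (range (M t)) \<le> dim (range (D 0))" using dim_subset dimD[OF tI] by metis
    moreover have "insert (vel 0) (range (D 0)) \<subseteq> range (M 0)"
    proof -
      have "vel 0 = M 0 (0, 1)"
        using M[OF I(2), of 0 1] linear_0[OF bounded_linear.linear[OF lin[OF I(2)]]] by simp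
      moreover have "D 0 u = M 0 (u, 0)" for u using M[OF I(2), of u 0] by simp
      ultimately show ?thesis by auto
    qed
    then have "dim (range (D 0)) + 1 \<le> dim (range (M 0))"
      using dim_subset[of "insert (vel 0) (range (D 0))" "range (M 0)"] v0 span0 by (simp add: dim_insert)
    moreover have "dim (range (M 0)) \<le> dim (range (M t))"
      using \<epsilon>(2)[of "M t"] dM by (simp add: dist_norm)
    ultimately show False by linarith
  qed
  define tangent_in where "tangent_in K \<longleftrightarrow> (\<forall>t c. (\<forall>\<^sub>F s in nhds t. \<gamma> s \<in> K) \<longrightarrow> c \<in> A \<longrightarrow> \<gamma> t \<in> fst c \<longrightarrow>
      chart_deriv (UNIV, id) c \<gamma> t 1 \<in> range (chart_deriv d c (\<lambda>g. g (\<gamma> t)) id))" for K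
  have "\<exists>N K. openin TG N \<and> h \<in> N \<and> closed K \<and> (\<lambda>g. g p) ` N \<subseteq> K \<and> tangent_in K" if h: "h \<in> G" for h
  proof -
    obtain N K where "openin TG N" "h \<in> N" "closed K" "(\<lambda>g. g p) ` N \<subseteq> K" "tangent_in K"
      using orbit_slice[OF h \<gamma>(1) d] unfolding tangent_in_def by metis
    then show ?thesis by blast
  qed
  then obtain N K where NK: "\<And>h. h \<in> G \<Longrightarrow> openin TG (N h) \<and> h \<in> N h \<and> closed (K h) \<and> (\<lambda>g. g p) ` N h \<subseteq> K h \<and> tangent_in (K h)"
    by metis
  \<comment> \<open>Second countability of the group thins the cover by the sets \<open>N h\<close>
    to a countable one, as Baire's theorem demands.\<close>
  have "Lindelof_space TG"
    using group_manifold second_countable_imp_Lindelof_space by (auto simp: smooth_manifold_def)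
  moreover have "openin TG U" if "U \<in> N ` G" for U using that NK by blast
  moreover have "\<Union>(N ` G) = topspace TG"
    unfolding topspace_TG using NK openin_subset[of TG] topspace_TG by blast
  ultimately have "\<exists>\<V>. countable \<V> \<and> \<V> \<subseteq> N ` G \<and> \<Union>\<V> = topspace TG"
    by (rule Lindelof_spaceD)
  then obtain \<V> where \<V>: "countable \<V>" "\<V> \<subseteq> N ` G" "\<Union>\<V> = topspace TG"
    by (elim exE conjE)
  obtain C where C: "countable C" "C \<subseteq> G" "\<V> = N ` C" using countable_subset_image[of \<V> N G] \<V> by blast
  have coverN: "(\<Union>h\<in>C. N h) = G" using \<V>(3) C(3) topspace_TG by simp
  \<comment> \<open>The radius \<open>r / 2\<close> keeps this closed interval within the times at
    which \<open>vel_not\<close> holds.\<close>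
  let ?J = "cball 0 (r / 2) :: real set"
  have cover: "?J \<subseteq> \<Union> ((\<lambda>h. \<gamma> -` K h) ` C)"
  proof
    fix t
    obtain h where h: "h \<in> G" "\<gamma> t = h p" using \<gamma>(2) by blast
    then obtain h' where "h' \<in> C" "h \<in> N h'" using coverN by blast
    then show "t \<in> \<Union> ((\<lambda>h. \<gamma> -` K h) ` C)" using NK[of h'] C(2) h(2) by auto
  qed
  have cl: "closed K'" if "K' \<in> (\<lambda>h. \<gamma> -` K h) ` C" for K'
    using that NK C(2) cont by (auto intro!: closed_vimage)
  have int: "interior ?J \<noteq> {}" using r(1) by (simp add: interior_cball)
  obtain K' where K': "K' \<in> (\<lambda>h. \<gamma> -` K h) ` C" "interior (K' \<inter> ?J) \<noteq> {}"
    by (rule countable_closed_cover_interior[OF countable_image[OF C(1)] cl cover int closed_cball]) assumption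
  from K'(1) obtain h where h: "K' = \<gamma> -` K h" "h \<in> C" by (rule imageE)
  \<comment> \<open>At an interior point the curve remains in the slice for all nearby times, which
    is the premise in \<open>tangent_in\<close>.\<close>
  obtain t where t: "t \<in> interior (\<gamma> -` K h \<inter> ?J)" using K'(2) unfolding h(1) by blast
  have "\<forall>\<^sub>F s in nhds t. s \<in> interior (\<gamma> -` K h \<inter> ?J)" by (rule eventually_nhds_in_open[OF open_interior t])
  then have "\<forall>\<^sub>F s in nhds t. \<gamma> s \<in> K h"
    by eventually_elim (drule subsetD[OF interior_subset], simp)
  moreover have tr: "dist t 0 < r" using t interior_subset[of "\<gamma> -` K h \<inter> ?J"] r(1) by (auto simp: dist_commute)
  moreover have "\<gamma> t \<in> fst c" using r(2)[OF tr] inI by blast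
  ultimately have "vel t \<in> range (D t)"
    using NK[of h] h(2) C(2) c(1) unfolding tangent_in_def vel_def D_def by blast
  then show False using vel_not[OF tr] by blast
qed

text \<open>An annihilator is insensitive to nonzero factors, so the inclusion up to positive
  multiples and the inclusion of velocities in the range together determine the fiber.\<close>

lemma conormal_fiber_orbit:
  assumes d: "d \<in> \<Gamma>" "id \<in> fst d"
  shows "\<xi> \<in> conormal_fiber euclidean A (orbit p) p \<longleftrightarrow>
    (\<forall>w. blinfun_apply \<xi> (chart_deriv d (chart_at A p) (\<lambda>g. g p) id w) = 0)"
proof
  assume \<xi>: "\<xi> \<in> conormal_fiber euclidean A (orbit p) p"
  show "\<forall>w. blinfun_apply \<xi> (chart_deriv d (chart_at A p) (\<lambda>g. g p) id w) = 0"
  proof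
    fix w
    obtain \<epsilon> where "\<epsilon> > 0"
      "\<epsilon> *\<^sub>R chart_deriv d (chart_at A p) (\<lambda>g. g p) id w \<in> submanifold_tangent euclidean A (orbit p) p"
      by (rule orbit_tangent_supset[OF d])
    then show "blinfun_apply \<xi> (chart_deriv d (chart_at A p) (\<lambda>g. g p) id w) = 0"
      using \<xi> by (auto simp: conormal_fiber_def blinfun.scaleR_right)
  qed
next
  assume "\<forall>w. blinfun_apply \<xi> (chart_deriv d (chart_at A p) (\<lambda>g. g p) id w) = 0"
  then show "\<xi> \<in> conormal_fiber euclidean A (orbit p) p"
    unfolding conormal_fiber_def using orbit_tangent_subset[OF d] by blast
qed

end

subsection \<open>The intersection of the conormal sets\<close>

lemma chart_deriv_source_change:
  assumes X: "smooth_manifold X A" and h: "smooth_map X A Y B h"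
    and c: "c \<in> A" "p \<in> fst c" and c': "c' \<in> A" "p \<in> fst c'" and d: "d \<in> B" "h p \<in> fst d"
  shows "chart_deriv c' d h p v = chart_deriv c d h p (chart_deriv c' c (\<lambda>x. x) p v)"
  using chart_deriv_compose[where h = "\<lambda>x. x" and k = h and m = h and p = p, OF smooth_manifold_inj_on[OF X c'(1)]
      smooth_manifold_inj_on[OF X c(1)] smooth_map_id[OF X] c'(1) c(1) c'(2) c(2) h d] by simp

text \<open>The factors of the chart selected at a point of a product need not be the charts
  selected at its components; at \<open>(q, q)\<close> they may even differ from each other.\<close>

lemma chart_at_prod_atlas:
  assumes "c \<in> A" "x \<in> fst c" "d \<in> B" "y \<in> fst d"
  obtains c' d' where "c' \<in> A" "x \<in> fst c'" "d' \<in> B" "y \<in> fst d'"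
    "chart_at (prod_atlas A B) (x, y) = prod_chart c' d'"
proof -
  have "prod_chart c d \<in> prod_atlas A B" "(x, y) \<in> fst (prod_chart c d)"
    using assms by (auto simp: prod_atlas_iff)
  note at = chart_at[OF this]
  obtain c' d' where "c' \<in> A" "d' \<in> B" "chart_at (prod_atlas A B) (x, y) = prod_chart c' d'"
    using at(1) unfolding prod_atlas_iff by blast
  then show thesis using at(2) that by simp
qed

lemma blinfun_eq_0_iff: "L = 0 \<longleftrightarrow> (\<forall>x. blinfun_apply L x = 0)"
  using blinfun_eqI[of L 0] by auto

lemma all_prod_iff: "(\<forall>z. P z) \<longleftrightarrow> (\<forall>u w. P (u, w))"
  by auto

context lie_action
begin

lemma chart_at_manifold [simp]: "chart_at A p \<in> A" "p \<in> fst (chart_at A p)"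
proof -
  obtain c where "c \<in> A" "p \<in> fst c" by (rule manifold_chart)
  then show "chart_at A p \<in> A" "p \<in> fst (chart_at A p)" by (rule chart_at)+
qed

lemma manifold_cover: "topspace euclidean \<subseteq> (\<Union>c\<in>A. fst c)"
  using chart_at_manifold by blast

lemma pullback_apply:
  assumes "smooth_map euclidean A euclidean A h"
  shows "blinfun_apply (pullback A A h p \<xi>) u =
    blinfun_apply \<xi> (chart_deriv (chart_at A p) (chart_at A (h p)) h p u)"
  using tangent_map_apply[OF assms chart_at_manifold(1)[of p] chart_at_manifold(2)[of p]
      chart_at_manifold(1)[of "h p"] chart_at_manifold(2)[of "h p"]]
  by (simp add: pullback_def)

lemma pullback_iota_diag_iff:
  assumes c: "c1 \<in> A" "c2 \<in> A" "q \<in> fst c1" "q \<in> fst c2"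
    and chart: "chart_at (prod_atlas A A) (q, q) = prod_chart c1 c2"
  shows "pullback A (prod_atlas A A) iota_diag q \<eta> = 0 \<longleftrightarrow>
    (\<forall>v. blinfun_apply \<eta> (chart_deriv (chart_at A q) c1 (\<lambda>x. x) q v, chart_deriv (chart_at A q) c2 (\<lambda>x. x) q v) = 0)"
proof -
  note id = smooth_map_id[OF manifold]
  have iota: "iota_diag = (\<lambda>p::'m. (p, p))" by (simp add: iota_diag_def fun_eq_iff)
  have smooth: "smooth_map euclidean A (prod_topology euclidean euclidean) (prod_atlas A A) iota_diag"
    unfolding iota by (rule smooth_map_Pair[OF id id inj_charts(1)])
  have "blinfun_apply (tangent_map A (prod_atlas A A) iota_diag q) =
      chart_deriv (chart_at A q) (prod_chart c1 c2) iota_diag q"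
    using tangent_map_apply[OF smooth chart_at_manifold(1)[of q] chart_at_manifold(2)[of q], of "prod_chart c1 c2"] c chart
    by (auto simp: prod_atlas_iff iota_diag_def)
  also have "\<dots> = (\<lambda>v. (chart_deriv (chart_at A q) c1 (\<lambda>x. x) q v, chart_deriv (chart_at A q) c2 (\<lambda>x. x) q v))"
    unfolding iota
    by (rule chart_deriv_Pair[OF id id chart_at_manifold(1) c(1,2) chart_at_manifold(2) c(3,4)])
  finally show ?thesis by (simp add: pullback_def blinfun_eq_0_iff)
qed

text \<open>The derivative of the action is the sum of the derivative of \<open>g\<close> at
  \<open>p\<close> and that of the orbit map at \<open>g\<close>, while the second component varies
  with the point only.\<close>

lemma pullback_iota_map_iff:
  assumes f: "smooth_map euclidean A euclidean A f"
    and c: "c1 \<in> A" "c2 \<in> A" "g p \<in> fst c1" "f p \<in> fst c2"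
    and chart: "chart_at (prod_atlas A A) (g p, f p) = prod_chart c1 c2"
    and c3: "c3 \<in> A" "p \<in> fst c3" and d3: "d3 \<in> \<Gamma>" "g \<in> fst d3"
    and chart': "chart_at (prod_atlas A \<Gamma>) (p, g) = prod_chart c3 d3"
  shows "pullback (prod_atlas A \<Gamma>) (prod_atlas A A) (iota_map f) (p, g) \<eta> = 0 \<longleftrightarrow>
    (\<forall>u w. blinfun_apply \<eta> (chart_deriv c3 c1 g p u + chart_deriv d3 c1 (\<lambda>g. g p) g w, chart_deriv c3 c2 f p u) = 0)"
proof -
  let ?act = "\<lambda>(p, g). g p" and ?X = "prod_topology euclidean TG" and ?P = "prod_atlas A \<Gamma>"
  have iota: "iota_map f = (\<lambda>x. (?act x, f (fst x)))" by (auto simp: iota_map_def)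
  note f_fst = smooth_map_comp_fst[OF manifold group_manifold f]
  have smooth: "smooth_map ?X ?P (prod_topology euclidean euclidean) (prod_atlas A A) (iota_map f)"
    unfolding iota by (rule smooth_map_Pair[OF smooth_action f_fst prod_atlas_inj_on[OF manifold group_manifold]])
  have P: "prod_chart c3 d3 \<in> ?P" "(p, g) \<in> fst (prod_chart c3 d3)" using c3 d3 by (auto simp: prod_atlas_iff)
  have Q: "prod_chart c1 c2 \<in> prod_atlas A A" "iota_map f (p, g) \<in> fst (prod_chart c1 c2)"
    using c by (auto simp: prod_atlas_iff iota_map_def)
  have "blinfun_apply (tangent_map ?P (prod_atlas A A) (iota_map f) (p, g)) =
      chart_deriv (prod_chart c3 d3) (prod_chart c1 c2) (iota_map f) (p, g)"
    using tangent_map_apply[OF smooth P Q] chart chart' by (simp add: iota_map_def)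
  also have "\<dots> = (\<lambda>z. (chart_deriv (prod_chart c3 d3) c1 ?act (p, g) z,
      chart_deriv (prod_chart c3 d3) c2 (\<lambda>x. f (fst x)) (p, g) z))"
    unfolding iota by (rule chart_deriv_Pair[OF smooth_action f_fst P(1) c(1,2) P(2)]) (use c in auto)
  finally have "blinfun_apply (tangent_map ?P (prod_atlas A A) (iota_map f) (p, g)) (u, w) =
      (chart_deriv c3 c1 g p u + chart_deriv d3 c1 (\<lambda>g. g p) g w, chart_deriv c3 c2 f p u)" for u w
    using chart_deriv_partial(3)[OF manifold group_manifold smooth_action c3 d3 c(1), of u w]
      chart_deriv_partial(3)[OF manifold group_manifold f_fst c3 d3 c(2), of u w] c
    by (simp add: chart_deriv_const)
  then show ?thesis by (simp add: pullback_def blinfun_eq_0_iff all_prod_iff)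
qed

text \<open>A change of source chart precomposes both derivatives with the same Jacobian.\<close>

lemma chart_deriv_eq_source_independent:
  assumes h: "smooth_map euclidean A euclidean A h" and k: "smooth_map euclidean A euclidean A k"
    and c: "c \<in> A" "p \<in> fst c" and c': "c' \<in> A" "p \<in> fst c'" and d: "d \<in> A" "h p \<in> fst d" "k p \<in> fst d"
    and eq: "\<And>u. \<phi> (chart_deriv c d h p u) = \<phi> (chart_deriv c d k p u)"
  shows "\<phi> (chart_deriv c' d h p u) = \<phi> (chart_deriv c' d k p u)"
  using eq chart_deriv_source_change[OF manifold h c c' d(1,2)]
    chart_deriv_source_change[OF manifold k c c' d(1,3)] by simp

text \<open>This trades covectors on the product for covectors on the manifold itself. The two sides
  are existence statements because \<open>\<eta>\<close> and \<open>\<xi>\<close> correspond only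
  after coordinate changes. The last clause ranges over all charts around \<open>g\<close>, which
  keeps it free of a choice on the group.\<close>

lemma conormal_inter_iff:
  assumes f: "smooth_map euclidean A euclidean A f"
  shows "(\<exists>y \<eta>. (y, \<eta>) \<in>
        conormal_of_map (prod_topology euclidean TG) (prod_atlas A \<Gamma>) (prod_atlas A A) (iota_map f) \<inter>
        conormal_of_map euclidean A (prod_atlas A A) iota_diag \<and> \<eta> \<noteq> 0) \<longleftrightarrow>
    (\<exists>p. \<exists>g\<in>G. \<exists>\<xi> :: 'e \<Rightarrow>\<^sub>L real. \<xi> \<noteq> 0 \<and> g p = f p \<and>
      (\<forall>u. blinfun_apply \<xi> (chart_deriv (chart_at A p) (chart_at A (f p)) g p u) =
        blinfun_apply \<xi> (chart_deriv (chart_at A p) (chart_at A (f p)) f p u)) \<and>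
      (\<forall>d\<in>\<Gamma>. g \<in> fst d \<longrightarrow> (\<forall>w. blinfun_apply \<xi> (chart_deriv d (chart_at A (f p)) (\<lambda>g. g p) g w) = 0)))"
    (is "?L \<longleftrightarrow> (\<exists>p. \<exists>g\<in>G. \<exists>\<xi>. ?R p g \<xi>)")
proof -
  have mem: "(y, \<eta>) \<in>
        conormal_of_map (prod_topology euclidean TG) (prod_atlas A \<Gamma>) (prod_atlas A A) (iota_map f) \<inter>
        conormal_of_map euclidean A (prod_atlas A A) iota_diag \<longleftrightarrow>
      (\<exists>p. \<exists>g\<in>G. g p = f p \<and> y = (f p, f p) \<and>
        pullback (prod_atlas A \<Gamma>) (prod_atlas A A) (iota_map f) (p, g) \<eta> = 0 \<and>
        pullback A (prod_atlas A A) iota_diag (f p) \<eta> = 0)" for y \<eta>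
  proof -
    have top: "topspace (prod_topology euclidean TG) = UNIV \<times> G"
      by (simp only: topspace_prod_topology topspace_TG topspace_euclidean)
    show ?thesis
    proof
      assume "(y, \<eta>) \<in>
        conormal_of_map (prod_topology euclidean TG) (prod_atlas A \<Gamma>) (prod_atlas A A) (iota_map f) \<inter>
        conormal_of_map euclidean A (prod_atlas A A) iota_diag"
      then obtain p g q where *: "g \<in> G" "y = iota_map f (p, g)" "y = iota_diag q"
        "pullback (prod_atlas A \<Gamma>) (prod_atlas A A) (iota_map f) (p, g) \<eta> = 0"
        "pullback A (prod_atlas A A) iota_diag q \<eta> = 0"
        unfolding conormal_of_map_def top by blast
      then have "g p = f p" "q = f p" by (auto simp: iota_map_def iota_diag_def)
      then show "\<exists>p. \<exists>g\<in>G. g p = f p \<and> y = (f p, f p) \<and>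
        pullback (prod_atlas A \<Gamma>) (prod_atlas A A) (iota_map f) (p, g) \<eta> = 0 \<and>
        pullback A (prod_atlas A A) iota_diag (f p) \<eta> = 0"
        using * by (intro exI[of _ p] bexI[of _ g]) (simp_all add: iota_diag_def)
    next
      assume "\<exists>p. \<exists>g\<in>G. g p = f p \<and> y = (f p, f p) \<and>
        pullback (prod_atlas A \<Gamma>) (prod_atlas A A) (iota_map f) (p, g) \<eta> = 0 \<and>
        pullback A (prod_atlas A A) iota_diag (f p) \<eta> = 0"
      then obtain p g where *: "g \<in> G" "g p = f p" "y = (f p, f p)"
        "pullback (prod_atlas A \<Gamma>) (prod_atlas A A) (iota_map f) (p, g) \<eta> = 0"
        "pullback A (prod_atlas A A) iota_diag (f p) \<eta> = 0" by blast
      then have "y = iota_map f (p, g)" "y = iota_diag (f p)" "(p, g) \<in> UNIV \<times> G"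
        by (simp_all add: iota_map_def iota_diag_def)
      then show "(y, \<eta>) \<in>
        conormal_of_map (prod_topology euclidean TG) (prod_atlas A \<Gamma>) (prod_atlas A A) (iota_map f) \<inter>
        conormal_of_map euclidean A (prod_atlas A A) iota_diag"
        unfolding conormal_of_map_def top topspace_euclidean using *(4,5) by blast
    qed
  qed
  have key: "(\<exists>\<eta>. pullback (prod_atlas A \<Gamma>) (prod_atlas A A) (iota_map f) (p, g) \<eta> = 0 \<and>
        pullback A (prod_atlas A A) iota_diag (f p) \<eta> = 0 \<and> \<eta> \<noteq> 0) \<longleftrightarrow> (\<exists>\<xi>. ?R p g \<xi>)"
    if g: "g \<in> G" and gp: "g p = f p" for p g
  proof -
    define q where "q = f p"
    have gq: "g p = q" and fq: "f p = q" using gp by (simp_all add: q_def)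
    define cq where "cq = chart_at A q"
    have cq: "cq \<in> A" "q \<in> fst cq" by (simp_all add: cq_def)
    obtain c1 c2 where c1: "c1 \<in> A" "q \<in> fst c1" and c2: "c2 \<in> A" "q \<in> fst c2"
      and chart: "chart_at (prod_atlas A A) (q, q) = prod_chart c1 c2"
      using chart_at_prod_atlas[OF cq cq] by metis
    obtain d0 where d0: "d0 \<in> \<Gamma>" "g \<in> fst d0" using group_chart[OF g] .
    obtain c3 d3 where c3: "c3 \<in> A" "p \<in> fst c3" and d3: "d3 \<in> \<Gamma>" "g \<in> fst d3"
      and chart': "chart_at (prod_atlas A \<Gamma>) (p, g) = prod_chart c3 d3"
      using chart_at_prod_atlas[OF chart_at_manifold(1)[of p] chart_at_manifold(2)[of p] d0] by metis
    note sg = smooth_element[OF g] and id = smooth_map_id[OF manifold]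
    have gcq: "g p \<in> fst cq" "g p \<in> fst c1" and fcq: "f p \<in> fst cq" "f p \<in> fst c2"
      using cq c1 c2 gq fq by auto
    \<comment> \<open>\<open>\<eta>\<close> is read in \<open>prod_chart c1 c2\<close> and
      \<open>\<xi>\<close> in \<open>cq\<close>; the Jacobians \<open>\<tau>1\<close>,
      \<open>\<tau>2\<close> and their inverses \<open>\<sigma>1\<close>, \<open>\<sigma>2\<close>
      translate between them.\<close>
    define \<tau>1 where "\<tau>1 = chart_deriv cq c1 (\<lambda>x. x) q"
    define \<tau>2 where "\<tau>2 = chart_deriv cq c2 (\<lambda>x. x) q"
    define \<sigma>1 where "\<sigma>1 = chart_deriv c1 cq (\<lambda>x. x) q"
    define \<sigma>2 where "\<sigma>2 = chart_deriv c2 cq (\<lambda>x. x) q"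
    have lin: "bounded_linear \<tau>1" "bounded_linear \<tau>2" "bounded_linear \<sigma>1" "bounded_linear \<sigma>2"
      unfolding \<tau>1_def \<tau>2_def \<sigma>1_def \<sigma>2_def using cq c1 c2 by (auto intro: smooth_map_bounded_linear[OF id])
    have \<tau>\<sigma>: "\<tau>1 (\<sigma>1 x) = x" "\<sigma>1 (\<tau>1 x) = x" "\<tau>2 (\<sigma>2 x) = x" "\<sigma>2 (\<tau>2 x) = x" for x
      unfolding \<tau>1_def \<tau>2_def \<sigma>1_def \<sigma>2_def
      using chart_deriv_change_inverse[OF manifold] cq c1 c2 by auto
    define a where "a = chart_deriv c3 cq g p"
    define b where "b = chart_deriv d3 cq (\<lambda>g. g p) g"
    define c where "c = chart_deriv c3 cq f p"
    have lin': "linear a" "linear b" "linear c"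
      unfolding a_def b_def c_def
      using smooth_map_bounded_linear[OF sg c3(1) cq(1) c3(2) gcq(1)]
        smooth_map_bounded_linear[where h = "\<lambda>g. g p" and p = g, OF smooth_evaluation d3(1) cq(1) d3(2) gcq(1)]
        smooth_map_bounded_linear[OF f c3(1) cq(1) c3(2) fcq(1)]
      by (simp_all add: bounded_linear.linear)
    have a1: "chart_deriv c3 c1 g p u = \<tau>1 (a u)" for u
      using chart_deriv_change[OF manifold cq(1) c1(1) sg c3(1) inj_charts(1)[OF c3(1)] c3(2) gcq]
      by (simp add: a_def \<tau>1_def gq)
    have b1: "chart_deriv d3 c1 (\<lambda>g. g p) g w = \<tau>1 (b w)" for w
      using chart_deriv_change[where h = "\<lambda>g. g p" and p = g,
          OF manifold cq(1) c1(1) smooth_evaluation d3(1) inj_charts(2)[OF d3(1)] d3(2) gcq]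
      by (simp add: b_def \<tau>1_def gq)
    have c2': "chart_deriv c3 c2 f p u = \<tau>2 (c u)" for u
      using chart_deriv_change[OF manifold cq(1) c2(1) f c3(1) inj_charts(1)[OF c3(1)] c3(2) fcq]
      by (simp add: c_def \<tau>2_def fq)
    have diag: "pullback A (prod_atlas A A) iota_diag (f p) \<eta> = 0 \<longleftrightarrow> (\<forall>v. blinfun_apply \<eta> (\<tau>1 v, \<tau>2 v) = 0)" for \<eta>
      unfolding fq \<tau>1_def \<tau>2_def cq_def by (rule pullback_iota_diag_iff[OF c1(1) c2(1) c1(2) c2(2) chart])
    have iota: "pullback (prod_atlas A \<Gamma>) (prod_atlas A A) (iota_map f) (p, g) \<eta> = 0 \<longleftrightarrow>
        (\<forall>u w. blinfun_apply \<eta> (\<tau>1 (a u) + \<tau>1 (b w), \<tau>2 (c u)) = 0)" for \<eta>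
      using pullback_iota_map_iff[OF f c1(1) c2(1) gcq(2) fcq(2) _ c3 d3 chart', of \<eta>] chart
      by (simp add: a1 b1 c2' gq fq)
    have R: "?R p g \<xi> \<longleftrightarrow> \<xi> \<noteq> 0 \<and> (\<forall>u. blinfun_apply \<xi> (a u) = blinfun_apply \<xi> (c u)) \<and> (\<forall>w. blinfun_apply \<xi> (b w) = 0)" for \<xi>
    proof -
      have "(\<forall>u. blinfun_apply \<xi> (chart_deriv (chart_at A p) cq g p u) = blinfun_apply \<xi> (chart_deriv (chart_at A p) cq f p u)) \<longleftrightarrow>
          (\<forall>u. blinfun_apply \<xi> (a u) = blinfun_apply \<xi> (c u))"
        unfolding a_def c_def
        using chart_deriv_eq_source_independent[where \<phi> = "blinfun_apply \<xi>", OF sg f c3 chart_at_manifold cq(1) gcq(1) fcq(1)]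
          chart_deriv_eq_source_independent[where \<phi> = "blinfun_apply \<xi>", OF sg f chart_at_manifold c3 cq(1) gcq(1) fcq(1)]
        by blast
      moreover have "(\<forall>d\<in>\<Gamma>. g \<in> fst d \<longrightarrow> (\<forall>w. blinfun_apply \<xi> (chart_deriv d cq (\<lambda>g. g p) g w) = 0)) \<longleftrightarrow>
          (\<forall>w. blinfun_apply \<xi> (b w) = 0)"
      proof
        assume *: "\<forall>w. blinfun_apply \<xi> (b w) = 0"
        show "\<forall>d\<in>\<Gamma>. g \<in> fst d \<longrightarrow> (\<forall>w. blinfun_apply \<xi> (chart_deriv d cq (\<lambda>g. g p) g w) = 0)"
        proof (intro ballI impI allI)
          fix d w assume "d \<in> \<Gamma>" "g \<in> fst d"
          then show "blinfun_apply \<xi> (chart_deriv d cq (\<lambda>g. g p) g w) = 0"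
            using chart_deriv_source_change[where h = "\<lambda>g. g p" and p = g, OF group_manifold smooth_evaluation d3 _ _ cq(1) gcq(1), of d w] *
            by (simp add: b_def)
        qed
      qed (use d3 in \<open>simp add: b_def\<close>)
      ultimately show ?thesis using gp by (simp add: fq cq_def)
    qed
    show ?thesis
    proof
      assume "\<exists>\<eta>. pullback (prod_atlas A \<Gamma>) (prod_atlas A A) (iota_map f) (p, g) \<eta> = 0 \<and>
        pullback A (prod_atlas A A) iota_diag (f p) \<eta> = 0 \<and> \<eta> \<noteq> 0"
      then obtain \<eta> :: "('e \<times> 'e) \<Rightarrow>\<^sub>L real" where e: "(\<forall>u w. blinfun_apply \<eta> (\<tau>1 (a u) + \<tau>1 (b w), \<tau>2 (c u)) = 0) \<and>
          (\<forall>v. blinfun_apply \<eta> (\<tau>1 v, \<tau>2 v) = 0) \<and> \<eta> \<noteq> 0"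
        unfolding diag iota by (rule exE) (erule that)
      then have "\<eta> \<noteq> 0" by simp
      note e1 = e[THEN conjunct1, rule_format] and e2 = e[THEN conjunct2, THEN conjunct1, rule_format]
      have split: "blinfun_apply \<eta> (x, y) = blinfun_apply \<eta> (x, 0) + blinfun_apply \<eta> (0, y)" for x y
        using blinfun.add_right[of \<eta> "(x, 0)" "(0, y)"] by simp
      \<comment> \<open>The first component of \<open>\<eta>\<close> read in \<open>cq\<close>;
        since \<open>\<eta>\<close> vanishes on the diagonal, the second component is its
        negative.\<close>
      define \<xi> where "\<xi> = Blinfun (\<lambda>v. blinfun_apply \<eta> (\<tau>1 v, 0))"
      have \<xi>: "blinfun_apply \<xi> v = blinfun_apply \<eta> (\<tau>1 v, 0)" for v
      proof -
        have "bounded_linear (\<lambda>v. blinfun_apply \<eta> (\<tau>1 v, 0))"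
          by (intro bounded_linear_compose[OF blinfun.bounded_linear_right] bounded_linear_Pair lin(1) bounded_linear_zero)
        then show ?thesis by (simp add: \<xi>_def bounded_linear_Blinfun_apply)
      qed
      have \<xi>2: "blinfun_apply \<eta> (0, \<tau>2 v) = - blinfun_apply \<xi> v" for v
        using e2[of v] split[of "\<tau>1 v" "\<tau>2 v"] by (simp add: \<xi>)
      \<comment> \<open>One relation holds both conditions on \<open>\<xi>\<close>; setting
        \<open>w = 0\<close> and then \<open>u = 0\<close> separates them.\<close>
      have "blinfun_apply \<xi> (a u) + blinfun_apply \<xi> (b w) - blinfun_apply \<xi> (c u) = 0" for u w
      proof -
        have "\<tau>1 (a u) + \<tau>1 (b w) = \<tau>1 (a u + b w)"
          using lin(1) by (simp add: bounded_linear.linear linear_add)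
        then show ?thesis
          using e1[of u w] split[of "\<tau>1 (a u + b w)" "\<tau>2 (c u)"] \<xi>[of "a u + b w"] \<xi>2[of "c u"]
          by (simp add: blinfun.add_right)
      qed
      note eq = this
      have "blinfun_apply \<xi> (a u) = blinfun_apply \<xi> (c u)" for u
        using eq[of u 0] linear_0[OF lin'(2)] by simp
      moreover have "blinfun_apply \<xi> (b w) = 0" for w
        using eq[of 0 w] linear_0[OF lin'(1)] linear_0[OF lin'(3)] by simp
      moreover have "\<xi> \<noteq> 0"
      proof
        assume "\<xi> = 0"
        then have "blinfun_apply \<eta> (x, y) = 0" for x y
          using split[of x y] \<xi>[of "\<sigma>1 x"] \<xi>2[of "\<sigma>2 y"] by (simp add: \<tau>\<sigma>)
        then show False using \<open>\<eta> \<noteq> 0\<close> by (auto simp: blinfun_eq_0_iff)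
      qed
      ultimately show "\<exists>\<xi>. ?R p g \<xi>" unfolding R by blast
    next
      assume "\<exists>\<xi>. ?R p g \<xi>"
      then obtain \<xi> where R\<xi>: "?R p g \<xi>" by (rule exE) (erule that)
      then have \<xi>: "\<xi> \<noteq> 0" "\<And>u. blinfun_apply \<xi> (a u) = blinfun_apply \<xi> (c u)" "\<And>w. blinfun_apply \<xi> (b w) = 0"
        unfolding R by simp_all
      \<comment> \<open>The covector \<open>(\<xi>, - \<xi>)\<close> rewritten in the coordinates of
        \<open>prod_chart c1 c2\<close>.\<close>
      define \<eta> where "\<eta> = Blinfun (\<lambda>x. blinfun_apply \<xi> (\<sigma>1 (fst x)) - blinfun_apply \<xi> (\<sigma>2 (snd x)))"
      have \<eta>: "blinfun_apply \<eta> (x, y) = blinfun_apply \<xi> (\<sigma>1 x) - blinfun_apply \<xi> (\<sigma>2 y)" for x y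
      proof -
        have "bounded_linear (\<lambda>x. blinfun_apply \<xi> (\<sigma>1 (fst x)) - blinfun_apply \<xi> (\<sigma>2 (snd x)))"
          by (intro bounded_linear_sub bounded_linear_compose[OF blinfun.bounded_linear_right]
              bounded_linear_compose[OF lin(3)] bounded_linear_compose[OF lin(4)] bounded_linear_fst bounded_linear_snd)
        then show ?thesis by (simp add: \<eta>_def bounded_linear_Blinfun_apply)
      qed
      have "\<sigma>1 (\<tau>1 x + \<tau>1 y) = x + y" for x y
        using lin(3) by (simp add: bounded_linear.linear linear_add \<tau>\<sigma>)
      then have "pullback (prod_atlas A \<Gamma>) (prod_atlas A A) (iota_map f) (p, g) \<eta> = 0"
        unfolding iota by (simp add: \<eta> \<tau>\<sigma> blinfun.add_right \<xi>)
      moreover have "pullback A (prod_atlas A A) iota_diag (f p) \<eta> = 0"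
        unfolding diag by (simp add: \<eta> \<tau>\<sigma>)
      moreover have "\<eta> \<noteq> 0"
      proof
        assume "\<eta> = 0"
        then have "blinfun_apply \<xi> v = 0" for v
          using \<eta>[of "\<tau>1 v" 0] linear_0[OF bounded_linear.linear[OF lin(4)]] by (simp add: \<tau>\<sigma>)
        then show False using \<xi>(1) by (auto simp: blinfun_eq_0_iff)
      qed
      ultimately show "\<exists>\<eta>. pullback (prod_atlas A \<Gamma>) (prod_atlas A A) (iota_map f) (p, g) \<eta> = 0 \<and>
        pullback A (prod_atlas A A) iota_diag (f p) \<eta> = 0 \<and> \<eta> \<noteq> 0" by blast
    qed
  qed
  have "?L \<longleftrightarrow> (\<exists>p. \<exists>g\<in>G. g p = f p \<and> (\<exists>\<eta>. pullback (prod_atlas A \<Gamma>) (prod_atlas A A) (iota_map f) (p, g) \<eta> = 0 \<and>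
        pullback A (prod_atlas A A) iota_diag (f p) \<eta> = 0 \<and> \<eta> \<noteq> 0))"
    unfolding mem by blast
  also have "\<dots> \<longleftrightarrow> (\<exists>p. \<exists>g\<in>G. g p = f p \<and> (\<exists>\<xi>. ?R p g \<xi>))"
    using key by (intro ex_cong1 bex_cong refl conj_cong) auto
  also have "\<dots> \<longleftrightarrow> (\<exists>p. \<exists>g\<in>G. \<exists>\<xi>. ?R p g \<xi>)" by blast
  finally show ?thesis .
qed

text \<open>The pullback of \<open>\<xi>\<close> by \<open>g\<close> works: it is nonzero because
  \<open>g\<close> is a diffeomorphism, conormal by left equivariance of the orbit map, and fixed
  because \<open>g \<circ> (inv g \<circ> f) = f\<close>.\<close>

lemma pullback_fixed_conormal:
  fixes \<xi> :: "'e \<Rightarrow>\<^sub>L real"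
  assumes f: "smooth_map euclidean A euclidean A f" and g: "g \<in> G" and gp: "g p = f p"
    and \<xi>: "\<xi> \<noteq> 0"
    and eq: "\<And>u. blinfun_apply \<xi> (chart_deriv (chart_at A p) (chart_at A (f p)) g p u) =
        blinfun_apply \<xi> (chart_deriv (chart_at A p) (chart_at A (f p)) f p u)"
    and orb: "\<And>d w. d \<in> \<Gamma> \<Longrightarrow> g \<in> fst d \<Longrightarrow>
        blinfun_apply \<xi> (chart_deriv d (chart_at A (f p)) (\<lambda>g. g p) g w) = 0"
  obtains \<xi>' where "\<xi>' \<noteq> 0" "\<xi>' \<in> conormal_fiber euclidean A (orbit p) p"
    "pullback A A (inv g \<circ> f) p \<xi>' = \<xi>'"
proof -
  let ?cp = "chart_at A p" and ?cq = "chart_at A (f p)"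
  define \<xi>' where "\<xi>' = pullback A A g p \<xi>"
  note sg = smooth_element[OF g]
  have gcq: "g p \<in> fst ?cq" using gp by simp
  have \<xi>': "blinfun_apply \<xi>' u = blinfun_apply \<xi> (chart_deriv ?cp ?cq g p u)" for u
    unfolding \<xi>'_def pullback_apply[OF sg] gp ..
  have "\<xi>' \<noteq> 0"
  proof
    assume "\<xi>' = 0"
    have "chart_deriv ?cp ?cq g p (chart_deriv ?cq ?cp (inv g) (g p) v) = v" for v
    proof -
      have "inv (inv g) = g" using bijective[OF g] by (rule inv_inv_eq)
      then show ?thesis
        using chart_deriv_element_inverse[OF inv_closed[OF g], of ?cq "g p" ?cp v] gcq inv_apply[OF g] by simp
    qed
    then have "blinfun_apply \<xi> v = 0" for v
      using \<xi>'[of "chart_deriv ?cq ?cp (inv g) (g p) v"] \<open>\<xi>' = 0\<close> by simp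
    then show False using \<xi> by (auto simp: blinfun_eq_0_iff)
  qed
  moreover have "\<xi>' \<in> conormal_fiber euclidean A (orbit p) p"
  proof -
    obtain d where d: "d \<in> \<Gamma>" "id \<in> fst d" using group_chart[OF identity] .
    obtain d3 where d3: "d3 \<in> \<Gamma>" "g \<in> fst d3" using group_chart[OF g] .
    show ?thesis
      unfolding conormal_fiber_orbit[OF d]
    proof
      fix w
      have "chart_deriv ?cp ?cq g p (chart_deriv d ?cp (\<lambda>g. g p) id w) =
          chart_deriv d3 ?cq (\<lambda>g. g p) g (chart_deriv d d3 (\<lambda>h. g \<circ> h) id w)"
        using chart_deriv_evaluation_left[OF g d, of d3 ?cp p ?cq w] d3 gcq by simp
      then show "blinfun_apply \<xi>' (chart_deriv d ?cp (\<lambda>g. g p) id w) = 0"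
        unfolding \<xi>' using orb[OF d3] by simp
    qed
  qed
  moreover have "pullback A A (inv g \<circ> f) p \<xi>' = \<xi>'"
  proof (rule blinfun_eqI)
    fix u
    have s: "smooth_map euclidean A euclidean A (inv g \<circ> f)"
      unfolding o_def
      by (rule smooth_map_compose[OF manifold inj_charts(1) manifold_cover f smooth_element[OF inv_closed[OF g]]])
    have fix_p: "(inv g \<circ> f) p = p" using inv_apply(2)[OF g, of p] gp by simp
    have "chart_deriv ?cp ?cq f p =
        (\<lambda>v. chart_deriv ?cp ?cq g ((inv g \<circ> f) p) (chart_deriv ?cp ?cp (inv g \<circ> f) p v))"
      by (rule chart_deriv_compose[OF inj_charts(1) inj_charts(1) s _ _ _ _ sg])
         (use fix_p gcq inv_apply(1)[OF g] in auto)
    then have "chart_deriv ?cp ?cq g p (chart_deriv ?cp ?cp (inv g \<circ> f) p u) = chart_deriv ?cp ?cq f p u"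
      by (simp only: fix_p)
    then show "blinfun_apply (pullback A A (inv g \<circ> f) p \<xi>') u = blinfun_apply \<xi>' u"
      unfolding pullback_apply[OF s] fix_p \<xi>' by (simp only: eq)
  qed
  ultimately show thesis by (rule that)
qed

text \<open>Here \<open>g\<close> is the inverse of \<open>g0\<close>, and \<open>\<xi>'\<close> is
  the pullback of \<open>\<xi>\<close> by \<open>g0\<close> at \<open>f p\<close>. Both
  \<open>f\<close> and \<open>g\<close> pull \<open>\<xi>'\<close> back to \<open>\<xi>\<close>, the
  former by \<open>pull\<close> and the latter because \<open>g0 \<circ> g = id\<close>; in
  particular \<open>\<xi>'\<close> is nonzero.\<close>

lemma fixed_conormal_pushforward:
  assumes f: "smooth_map euclidean A euclidean A f" and g0: "g0 \<in> G" and g0p: "g0 (f p) = p"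
    and \<xi>: "\<xi> \<noteq> 0" "\<xi> \<in> conormal_fiber euclidean A (orbit p) p"
    and pull: "pullback A A (g0 \<circ> f) p \<xi> = \<xi>"
  obtains g and \<xi>' :: "'e \<Rightarrow>\<^sub>L real" where "g \<in> G" "\<xi>' \<noteq> 0" "g p = f p"
    "\<And>u. blinfun_apply \<xi>' (chart_deriv (chart_at A p) (chart_at A (f p)) g p u) =
        blinfun_apply \<xi>' (chart_deriv (chart_at A p) (chart_at A (f p)) f p u)"
    "\<And>d w. d \<in> \<Gamma> \<Longrightarrow> g \<in> fst d \<Longrightarrow>
        blinfun_apply \<xi>' (chart_deriv d (chart_at A (f p)) (\<lambda>g. g p) g w) = 0"
proof -
  let ?cp = "chart_at A p" and ?cq = "chart_at A (f p)"
  define g where "g = inv g0"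
  have g: "g \<in> G" unfolding g_def by (rule inv_closed[OF g0])
  have gp: "g p = f p" using inv_apply(2)[OF g0, of "f p"] g0p by (simp add: g_def)
  have g0g: "g0 \<circ> g = id" using inv_apply(1)[OF g0] by (auto simp: g_def)
  note s0 = smooth_element[OF g0]
  define \<xi>' where "\<xi>' = pullback A A g0 (f p) \<xi>"
  have \<xi>': "blinfun_apply \<xi>' u = blinfun_apply \<xi> (chart_deriv ?cq ?cp g0 (f p) u)" for u
    unfolding \<xi>'_def pullback_apply[OF s0] g0p ..
  have s: "smooth_map euclidean A euclidean A (g0 \<circ> f)"
    unfolding o_def by (rule smooth_map_compose[OF manifold inj_charts(1) manifold_cover f s0])
  have fix_p: "(g0 \<circ> f) p = p" using g0p by simp
  have 1: "blinfun_apply \<xi>' (chart_deriv ?cp ?cq f p u) = blinfun_apply \<xi> u" for u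
  proof -
    have "chart_deriv ?cp ?cp (g0 \<circ> f) p = (\<lambda>v. chart_deriv ?cq ?cp g0 (f p) (chart_deriv ?cp ?cq f p v))"
      by (rule chart_deriv_compose[OF inj_charts(1) inj_charts(1) f _ _ _ _ s0]) (use g0p in auto)
    then have "blinfun_apply \<xi>' (chart_deriv ?cp ?cq f p u) = blinfun_apply \<xi> (chart_deriv ?cp ?cp (g0 \<circ> f) p u)"
      by (simp add: \<xi>')
    also have "\<dots> = blinfun_apply (pullback A A (g0 \<circ> f) p \<xi>) u"
      unfolding pullback_apply[OF s] fix_p ..
    finally show ?thesis unfolding pull .
  qed
  have 2: "blinfun_apply \<xi>' (chart_deriv ?cp ?cq g p u) = blinfun_apply \<xi> u" for u
  proof -
    have "inv g = g0" unfolding g_def using bijective[OF g0] by (rule inv_inv_eq)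
    then show ?thesis
      using chart_deriv_element_inverse[OF g, of ?cp p ?cq u] gp by (simp add: \<xi>')
  qed
  have nonzero: "\<xi>' \<noteq> 0"
  proof
    assume "\<xi>' = 0"
    then have "blinfun_apply \<xi> u = 0" for u using 1[of u] by simp
    then show False using \<xi>(1) by (auto simp: blinfun_eq_0_iff)
  qed
  have orb: "blinfun_apply \<xi>' (chart_deriv d ?cq (\<lambda>g. g p) g w) = 0" if d: "d \<in> \<Gamma>" "g \<in> fst d" for d w
  proof -
    obtain d' where d': "d' \<in> \<Gamma>" "id \<in> fst d'" using group_chart[OF identity] .
    have "chart_deriv d' ?cp (\<lambda>g. g p) (g0 \<circ> g) (chart_deriv d d' (\<lambda>g. g0 \<circ> g) g w) =
        chart_deriv ?cq ?cp g0 (g p) (chart_deriv d ?cq (\<lambda>g. g p) g w)"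
      by (rule chart_deriv_evaluation_left[OF g0 d]) (use d' gp g0p in \<open>auto simp: g0g\<close>)
    then show ?thesis
      using \<xi>(2) unfolding conormal_fiber_orbit[OF d'] \<xi>' g0g gp by metis
  qed
  show thesis
  proof (rule that[of g \<xi>', OF g nonzero gp])
    show "blinfun_apply \<xi>' (chart_deriv ?cp ?cq g p u) = blinfun_apply \<xi>' (chart_deriv ?cp ?cq f p u)" for u
      by (simp only: 1 2)
  qed (rule orb)
qed

lemma orbit_self: "p \<in> orbit p"
  using identity by (auto intro!: exI[of _ id])

lemma orbit_eq: "p \<in> orbit p0 \<Longrightarrow> orbit p = orbit p0"
proof -
  assume "p \<in> orbit p0"
  then obtain h where h: "h \<in> G" "p = h p0" by blast
  have "\<exists>g'\<in>G. g p = g' p0" if "g \<in> G" for g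
    using comp_closed[OF that h(1)] h(2) by (intro bexI[of _ "g \<circ> h"]) auto
  moreover have "\<exists>g'\<in>G. g p0 = g' p" if "g \<in> G" for g
    using comp_closed[OF that inv_closed[OF h(1)]] h(2) inv_apply(2)[OF h(1)]
    by (intro bexI[of _ "g \<circ> inv h"]) auto
  ultimately show ?thesis by blast
qed

lemma conormal_condition_iff:
  assumes f: "smooth_map euclidean A euclidean A f"
    and comm: "\<And>g h p. g \<in> G \<Longrightarrow> h \<in> G \<Longrightarrow> g (h p) = h (g p)"
    and f_comm: "\<And>g p. g \<in> G \<Longrightarrow> f (g p) = g (f p)"
  shows "(\<forall>y \<eta>. (y, \<eta>) \<in>
      conormal_of_map (prod_topology euclidean TG) (prod_atlas A \<Gamma>) (prod_atlas A A) (iota_map f) \<inter>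
      conormal_of_map euclidean A (prod_atlas A A) iota_diag \<longrightarrow> \<eta> = 0) \<longleftrightarrow>
    (\<forall>Y \<in> Fix_orbits G f. \<forall>g\<^sub>0 \<in> G. (\<forall>q\<in>Y. (g\<^sub>0 \<circ> f) q = q) \<longrightarrow>
      (\<forall>p\<in>Y. {\<eta> \<in> conormal_fiber euclidean A Y p. pullback A A (g\<^sub>0 \<circ> f) p \<eta> - \<eta> = 0} = {0}))"
    (is "?L \<longleftrightarrow> ?R")
proof
  assume L: ?L
  have "\<not> (\<exists>y \<eta>. (y, \<eta>) \<in>
      conormal_of_map (prod_topology euclidean TG) (prod_atlas A \<Gamma>) (prod_atlas A A) (iota_map f) \<inter>
      conormal_of_map euclidean A (prod_atlas A A) iota_diag \<and> \<eta> \<noteq> 0)"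
    using L by blast
  note none = contrapos_nn[OF this iffD2[OF conormal_inter_iff[OF f]]]
  show ?R
  proof (intro ballI impI)
    fix Y g0 p
    assume Y: "Y \<in> Fix_orbits G f" and g0: "g0 \<in> G" and fix_Y: "\<forall>q\<in>Y. (g0 \<circ> f) q = q" and p: "p \<in> Y"
    obtain p0 where "Y = orbit p0" using Y by (auto simp: Fix_orbits_def orbits_def)
    \<comment> \<open>\<open>conormal_fiber_orbit\<close> speaks of the fiber at the base point of
      an orbit, so \<open>p\<close> is made the base point.\<close>
    then have Y_eq: "Y = orbit p" using orbit_eq p by blast
    have "\<xi> = 0" if \<xi>: "\<xi> \<in> conormal_fiber euclidean A Y p" "pullback A A (g0 \<circ> f) p \<xi> - \<xi> = 0" for \<xi>
    proof (rule ccontr)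
      assume "\<xi> \<noteq> 0"
      have pull: "pullback A A (g0 \<circ> f) p \<xi> = \<xi>" using \<xi>(2) by simp
      have "g0 (f p) = p" using fix_Y p by simp
      show False
      proof (rule fixed_conormal_pushforward[where p = p,
            OF f g0 \<open>g0 (f p) = p\<close> \<open>\<xi> \<noteq> 0\<close> \<xi>(1)[unfolded Y_eq] pull])
        fix g and \<xi>' :: "'e \<Rightarrow>\<^sub>L real"
        assume "g \<in> G" "\<xi>' \<noteq> 0" "g p = f p"
          "\<And>u. blinfun_apply \<xi>' (chart_deriv (chart_at A p) (chart_at A (f p)) g p u) =
            blinfun_apply \<xi>' (chart_deriv (chart_at A p) (chart_at A (f p)) f p u)"
          "\<And>d w. d \<in> \<Gamma> \<Longrightarrow> g \<in> fst d \<Longrightarrow>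
            blinfun_apply \<xi>' (chart_deriv d (chart_at A (f p)) (\<lambda>g. g p) g w) = 0"
        then show False using none by blast
      qed
    qed
    moreover have "0 \<in> conormal_fiber euclidean A Y p" "pullback A A (g0 \<circ> f) p 0 - 0 = 0"
      by (auto simp: conormal_fiber_def pullback_def blinfun_eq_0_iff)
    ultimately show "{\<eta> \<in> conormal_fiber euclidean A Y p. pullback A A (g0 \<circ> f) p \<eta> - \<eta> = 0} = {0}" by blast
  qed
next
  assume R: ?R
  show ?L
  proof (rule ccontr)
    assume "\<not> ?L"
    then have "\<exists>y \<eta>. (y, \<eta>) \<in>
        conormal_of_map (prod_topology euclidean TG) (prod_atlas A \<Gamma>) (prod_atlas A A) (iota_map f) \<inter>
        conormal_of_map euclidean A (prod_atlas A A) iota_diag \<and> \<eta> \<noteq> 0"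
      by simp
    from iffD1[OF conormal_inter_iff[OF f] this]
    obtain p g and \<xi> :: "'e \<Rightarrow>\<^sub>L real" where g: "g \<in> G" and \<xi>: "\<xi> \<noteq> 0" and gp: "g p = f p"
      and eq': "\<forall>u. blinfun_apply \<xi> (chart_deriv (chart_at A p) (chart_at A (f p)) g p u) =
        blinfun_apply \<xi> (chart_deriv (chart_at A p) (chart_at A (f p)) f p u)"
      and orb': "\<forall>d\<in>\<Gamma>. g \<in> fst d \<longrightarrow>
        (\<forall>w. blinfun_apply \<xi> (chart_deriv d (chart_at A (f p)) (\<lambda>g. g p) g w) = 0)"
      by (elim exE bexE conjE) (rule that, assumption+)
    note eq = eq'[rule_format] and orb = orb'[rule_format]
    have f_orbit: "f (h p) = g (h p)" if "h \<in> G" for h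
      using f_comm[OF that, of p] comm[OF that g, of p] gp by simp
    have fixed: "\<forall>q\<in>orbit p. (inv g \<circ> f) q = q"
      using f_orbit inv_apply(2)[OF g] by auto
    have "f ` orbit p = orbit p"
    proof
      show "f ` orbit p \<subseteq> orbit p"
      proof (rule image_subsetI)
        fix q assume "q \<in> orbit p"
        then obtain h where h: "h \<in> G" "q = h p" by blast
        have "f q = (g \<circ> h) p" using f_orbit[OF h(1)] h(2) by simp
        then show "f q \<in> orbit p" using comp_closed[OF g h(1)] by blast
      qed
      show "orbit p \<subseteq> f ` orbit p"
      proof
        fix q assume "q \<in> orbit p"
        then obtain h where h: "h \<in> G" "q = h p" by blast
        have k: "inv g \<circ> h \<in> G" using comp_closed[OF inv_closed[OF g] h(1)] .
        have "f ((inv g \<circ> h) p) = q" unfolding f_orbit[OF k] using inv_apply(1)[OF g] h(2) by simp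
        then show "q \<in> f ` orbit p" using k by blast
      qed
    qed
    moreover have "orbit p \<in> orbits G" by (auto simp: orbits_def)
    ultimately have "orbit p \<in> Fix_orbits G f" by (simp add: Fix_orbits_def)
    then have "{\<eta> \<in> conormal_fiber euclidean A (orbit p) p. pullback A A (inv g \<circ> f) p \<eta> - \<eta> = 0} = {0}"
      using bspec[OF bspec[OF R] inv_closed[OF g]] fixed orbit_self[of p] by (simp only: simp_thms)
    then have zero: "\<xi>' = 0" if "\<xi>' \<in> conormal_fiber euclidean A (orbit p) p"
      "pullback A A (inv g \<circ> f) p \<xi>' = \<xi>'" for \<xi>'
      using that by auto
    show False
      by (rule pullback_fixed_conormal[where f = f and g = g and p = p, OF f g gp \<xi> eq orb])
         (use zero in simp_all)
  qed
qed

end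

theorem proposition1p25:
  fixes A :: "('m::topological_space, 'e::euclidean_space) chart set"
    and T :: "'m \<Rightarrow> 'e"
    and metric :: "'m \<Rightarrow> 'e \<Rightarrow> 'e \<Rightarrow> real"
    and a :: "real \<Rightarrow> 'm \<Rightarrow> 'm"
    and G :: "('m \<Rightarrow> 'm) set"
    and \<Gamma> :: "('m \<Rightarrow> 'm, 'k::euclidean_space) chart set"
    and f :: "'m \<Rightarrow> 'm"
  assumes manifold: "smooth_manifold euclidean A"
    and closed: "compact (UNIV :: 'm set)"
    and field: "smooth_vector_field A T"
    and nonvanishing: "\<And>p. T p \<noteq> 0"
    and metric: "riemannian_metric A metric"
    and flow: "is_flow A T a"
    and preserves: "\<And>t. a t \<in> isometries A metric"
    and G: "G = flow_closure A metric a"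
    and lie: "lie_transformation_group A G \<Gamma>"
    and f_smooth: "smooth_map euclidean A euclidean A f"
    and f_T: "\<And>p. blinfun_apply (tangent_map A A f p) (T p) = T (f p)"
  shows "(\<forall>y \<eta>. (y, \<eta>) \<in>
              conormal_of_map (prod_topology euclidean (transformation_topology G))
                (prod_atlas A \<Gamma>) (prod_atlas A A) (iota_map f) \<inter>
              conormal_of_map euclidean A (prod_atlas A A) iota_diag \<longrightarrow> \<eta> = 0) \<longleftrightarrow>
         (\<forall>Y \<in> Fix_orbits G f. \<forall>g\<^sub>0 \<in> G. (\<forall>q\<in>Y. (g\<^sub>0 \<circ> f) q = q) \<longrightarrow>
            (\<forall>p\<in>Y. {\<eta> \<in> conormal_fiber euclidean A Y p. pullback A A (g\<^sub>0 \<circ> f) p \<eta> - \<eta> = 0} = {0}))"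
proof -
  have iso: "g \<in> isometries A metric" if "g \<in> G" for g using that flow_closure_subset G by blast
  have haus: "Hausdorff_space (euclidean :: 'm topology)" using manifold by (simp add: smooth_manifold_def)
  have curve: "integral_curve A T (\<lambda>t. a t p)" for p by (rule integral_curve_flow[OF manifold flow])
  have a0: "a 0 p = p" for p using flow by (simp add: is_flow_def)
  have a_0: "a 0 = id" using a0 by auto
  \<comment> \<open>As functions of \<open>t\<close>, both sides are integral curves of
    \<open>T\<close> starting at \<open>f p\<close>.\<close>
  have f_flow: "f (a t p) = a t (f p)" for t p
    by (rule integral_curve_unique[OF manifold field integral_curve_map[OF manifold f_smooth f_T curve] curve])
       (simp add: a0)
  \<comment> \<open>With \<open>s\<close> fixed, both sides are integral curves in \<open>t\<close>
    starting at \<open>a s p\<close>.\<close>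
  have add: "a (t + s) p = a t (a s p)" for s t p
    by (rule integral_curve_unique[OF manifold field integral_curve_shift[OF curve] curve]) (simp add: a0)
  have flow_comm: "a s (a t p) = a t (a s p)" for s t p
    using add[of s t p] add[of t s p] by (simp add: add.commute)
  have commute: "k (g p) = g (k p)" if "continuous_on UNIV k" "\<And>t p. k (a t p) = a t (k p)" "g \<in> G" for k g p
    by (rule flow_closure_commute[OF haus that(1,2) preserves that(3)[unfolded G]])
  interpret lie_action A G \<Gamma>
  proof
    show "id \<in> G" using flow_in_flow_closure[of a A metric 0, OF preserves] by (simp add: G a_0)
  qed (use manifold lie iso in \<open>auto simp: isometries_def smooth_map_def\<close>)
  show ?thesis
  proof (rule conormal_condition_iff[OF f_smooth])
    show "f (g p) = g (f p)" if "g \<in> G" for g p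
      by (rule commute[OF _ f_flow that]) (use f_smooth in \<open>simp add: smooth_map_def\<close>)
    fix g h p assume g: "g \<in> G" and h: "h \<in> G"
    \<comment> \<open>The closure argument runs twice: with \<open>k = a t\<close> the flow maps
      commute with all of \<open>G\<close>, and then with \<open>k = g\<close> the group
      \<open>G\<close> is commutative.\<close>
    have "a t (g p) = g (a t p)" for t p
      by (rule commute[OF isometries_continuous[OF preserves] flow_comm g])
    then show "g (h p) = h (g p)" using commute[OF continuous[OF g] _ h] by metis
  qed
qed

end
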